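(* Let $X$ be a Schottky surface with Euler characteristic $\chi(X)$, let $s\in-\mathbb{N}_0$, and let $\mathcal{L}_{X,s}$ be the transfer operator with parameter $s$ associated to $X$ and a choice of Schottky data for $X$. Then $1$ is an eigenvalue of $\mathcal{L}_{X,s}$ with geometric multiplicity at least $1-\chi(X)$. For $s=-n$, $n\in\mathbb{N}_0$, one can construct $1-\chi(X)$ linearly independent eigenfunctions of $\mathcal{L}_{X,s}$ with eigenvalue $1$ from the eigenfunctions with eigenvalue $1$ of the transfer operators $\mathcal{L}_{C,s}$ (essentially two copies of $z^n$, as described in the context) for certain hyperbolic cylinders $C$ covering $X$.
   Context: $\mathbb{N}_0=\{0,1,2,\dots\}$, $\widehat{\mathbb{C}}=\mathbb{C}\cup\{\infty\}$, $\mathbb{H}$ is the upper half plane, and $\mathrm{PSL}_2(\mathbb{R})$ acts on $\widehat{\mathbb{C}}$ by fractional linear transformations $g.z$. Schottky surfaces and Schottky data. A subset of $\widehat{\mathbb{C}}$ is a Euclidean disk if some element of $\mathrm{PSL}_2(\mathbb{R})$ maps it to a Euclidean disk in $\mathbb{C}$ in the usual sense. Choose an integer $r\ge 1$ and $2r$ open Euclidean disks $\mathcal{D}_1,\mathcal{D}_{-1},\dots,\mathcal{D}_r,\mathcal{D}_{-r}$ in $\widehat{\mathbb{C}}$, centered on $\mathbb{R}\cup\{\infty\}$ and with mutually disjoint closures. For $j\in\{1,\dots,r\}$ let $S_j\in\mathrm{PSL}_2(\mathbb{R})$ map the exterior of $\mathcal{D}_j$ to the interior of $\mathcal{D}_{-j}$,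 and put $S_{-j}=S_j^{-1}$. The subgroup $\Gamma$ of $\mathrm{PSL}_2(\mathbb{R})$ generated by $S_1,\dots,S_r$ is a Schottky group. A Schottky surface is a hyperbolic surface $X$ isometric to $\Gamma\backslash\mathbb{H}$ for such a $\Gamma$; the tuple $\bigl(\Gamma,r,\{\mathcal{D}_{\pm j}\}_{j=1}^r,\{S_{\pm j}\}_{j=1}^r\bigr)$ is then called a Schottky data for $X$. The number $r$ does not depend on the choice of Schottky data. The operators $\tau_s$. For $s=-n$ with $n\in\mathbb{N}_0$, and $g\in\mathrm{PSL}_2(\mathbb{R})$ represented by $\begin{pmatrix}a&b\\c&d\end{pmatrix}$, put $$\tau_s(g^{-1})f(z)=\bigl(g'(z)\bigr)^sf(g.z)=(cz+d)^{2n}f\Bigl(\frac{az+b}{cz+d}\Bigr).$$ A function $f$ defined on a neighborhood $U$ of $\infty$ is called holomorphic at $\infty$ (for the parameter $s$) if there is $g\in\mathrm{PSL}_2(\mathbb{R})$ with $g.U\subseteq\mathbb{C}$ such that $\tau_s(g)f$ is holomorphic at $g.\infty$. Function spaces. For a bounded open disk $D\subset\mathbb{C}$, $H^2(D)$ is the Hilbert Bergman space of holomorphic functions on $D$ that are square-integrable with respect to Lebesgue measure. If $D\subset\widehat{\mathbb{C}}$ is a Euclidean disk that is not bounded in $\mathbb{C}$, choose $q\in\mathrm{PSL}_2(\mathbb{R})$ such that $q.D$ is a bounded disk in $\mathbb{C}$; then $f\in H^2(D)$ means $\tau_s(q)f\in H^2(q.D)$. Transfer operator. Let $\mathcal{H}=\bigoplus_{j=1}^rH^2(\mathcal{D}_j)\oplus\bigoplus_{k=1}^rH^2(\mathcal{D}_{-k})$,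 with elements written $f=(f_1,\dots,f_r,f_{-1},\dots,f_{-r})$, $f_i\in H^2(\mathcal{D}_i)$. The transfer operator $\mathcal{L}_{X,s}\colon\mathcal{H}\to\mathcal{H}$ is given by $$(\mathcal{L}_{X,s}f)_i=\sum_{\substack{j\in\{\pm1,\dots,\pm r\}\\ j\neq-i}}\tau_s(S_j)f_j\quad\text{on }\mathcal{D}_i,\qquad i\in\{\pm1,\dots,\pm r\}.$$ Hyperbolic cylinders. A hyperbolic cylinder $C$ is a Schottky surface with $r=1$. If $\ell>0$ is the (primitive) length of its central geodesic, then for any Schottky data of $C$ there is $p\in\mathrm{PSL}_2(\mathbb{R})$ with $S_1=p\,a_\ell\,p^{-1}$, where $a_\ell$ is represented by $\begin{pmatrix}e^{\ell/2}&0\\0&e^{-\ell/2}\end{pmatrix}$. Its transfer operator $\mathcal{L}_{C,s}$ acts by $(f_1,f_{-1})\mapsto(\tau_s(S_1)f_1,\tau_s(S_1^{-1})f_{-1})$. For $s=-n$, $n\in\mathbb{N}_0$, the number $1$ is an eigenvalue of $\mathcal{L}_{C,s}$ of geometric multiplicity $2$, and the eigenspace is essentially spanned by two copies of $z^n$; precisely, it is spanned by $(\tau_s(p)z^n,0)$ and $(0,\tau_s(pS)z^n)$, where $S\in\mathrm{PSL}_2(\mathbb{R})$ is represented by $\begin{pmatrix}0&1\\-1&0\end{pmatrix}$. *)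

theory Defs
  imports
    "HOL-Analysis.Analysis"
    "HOL-Homology.Homology"
    "HOL-Library.Extended_Nat"
    "HOL-Library.Function_Algebras"
begin

section \<open>The group PSL(2,R) and its action on the Riemann sphere\<close>

definition SL2R :: "(real^2^2) monoid" where
  "SL2R = \<lparr>carrier = {A. det A = 1}, mult = (**), one = mat 1\<rparr>"

definition PSL2R :: "(real^2^2) set monoid" where
  "PSL2R = SL2R Mod {mat 1, - mat 1}"

definition mat2 :: "real \<Rightarrow> real \<Rightarrow> real \<Rightarrow> real \<Rightarrow> real^2^2" where
  "mat2 a b c d = vector [vector [a, b], vector [c, d]]"

text \<open>The class of a matrix in \<open>PSL2R\<close>, that is, the coset consisting of \<open>A\<close> and \<open>- A\<close>.\<close>

definition psl :: "real^2^2 \<Rightarrow> (real^2^2) set" where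
  "psl A = {mat 1, - mat 1} #>\<^bsub>SL2R\<^esub> A"

text \<open>A matrix representing an element of \<open>PSL2R\<close>. Everything below that uses it
  is invariant under a change of sign of the matrix.\<close>

definition rep :: "(real^2^2) set \<Rightarrow> real^2^2" where
  "rep g = (SOME A. A \<in> g)"

text \<open>The Riemann sphere is \<open>complex option\<close> with \<open>None\<close> as the point at infinity.\<close>

definition riemann_sphere :: "complex option topology" where
  "riemann_sphere = Alexandroff_compactification (euclidean :: complex topology)"

fun moebius :: "real^2^2 \<Rightarrow> complex option \<Rightarrow> complex option" where
  "moebius A None =
     (if A$2$1 = 0 then None else Some (complex_of_real (A$1$1) / complex_of_real (A$2$1)))"
| "moebius A (Some z) =
     (if of_real (A$2$1) * z + of_real (A$2$2) = 0 then None
      else Some ((of_real (A$1$1) * z + of_real (A$1$2)) /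
                 (of_real (A$2$1) * z + of_real (A$2$2))))"

definition act :: "(real^2^2) set \<Rightarrow> complex option \<Rightarrow> complex option" where
  "act g = moebius (rep g)"


section \<open>Hyperbolic surfaces as metric spaces\<close>

definition upper_half_plane :: "complex set" where
  "upper_half_plane = {z. Im z > 0}"

definition hyp_dist :: "complex \<Rightarrow> complex \<Rightarrow> real" where
  "hyp_dist z w = arcosh (1 + (cmod (z - w))\<^sup>2 / (2 * Im z * Im w))"

definition orbit_of :: "(real^2^2) set set \<Rightarrow> complex \<Rightarrow> complex set" where
  "orbit_of \<Gamma> z = {w. \<exists>g\<in>\<Gamma>. act g (Some z) = Some w}"

definition orbit_space :: "(real^2^2) set set \<Rightarrow> complex set set" where
  "orbit_space \<Gamma> = orbit_of \<Gamma> ` upper_half_plane"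

definition orbit_dist :: "complex set \<Rightarrow> complex set \<Rightarrow> real" where
  "orbit_dist P Q = (INF (z, w)\<in>P \<times> Q. hyp_dist z w)"

definition isometric_to_quotient :: "'a metric \<Rightarrow> (real^2^2) set set \<Rightarrow> bool" where
  "isometric_to_quotient X \<Gamma> \<longleftrightarrow>
     (\<exists>\<phi>. bij_betw \<phi> (mspace X) (orbit_space \<Gamma>) \<and>
          (\<forall>x\<in>mspace X. \<forall>y\<in>mspace X. orbit_dist (\<phi> x) (\<phi> y) = mdist X x y))"

text \<open>Covering maps are defined as in \<^const>\<open>covering_space\<close>, but for arbitrary topologies.
  Coverings of hyperbolic surfaces are moreover required to be local isometries.\<close>

definition covering_map :: "'a topology \<Rightarrow> 'b topology \<Rightarrow> ('a \<Rightarrow> 'b) \<Rightarrow> bool" where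
  "covering_map C X p \<longleftrightarrow>
     continuous_map C X p \<and> p ` topspace C = topspace X \<and>
     (\<forall>x\<in>topspace X. \<exists>T. x \<in> T \<and> openin X T \<and>
        (\<exists>\<V>. \<Union>\<V> = topspace C \<inter> p -` T \<and> (\<forall>U\<in>\<V>. openin C U) \<and> pairwise disjnt \<V> \<and>
             (\<forall>U\<in>\<V>. homeomorphic_map (subtopology C U) (subtopology X T) p)))"

definition hyperbolic_covering :: "'a metric \<Rightarrow> 'b metric \<Rightarrow> ('a \<Rightarrow> 'b) \<Rightarrow> bool" where
  "hyperbolic_covering C X p \<longleftrightarrow>
     covering_map (mtopology_of C) (mtopology_of X) p \<and>
     (\<forall>x\<in>mspace C. \<exists>e>0. \<forall>y\<in>mspace C. \<forall>z\<in>mspace C.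
        mdist C x y < e \<longrightarrow> mdist C x z < e \<longrightarrow> mdist X (p y) (p z) = mdist C y z)"

definition covers :: "'a metric \<Rightarrow> 'b metric \<Rightarrow> bool" where
  "covers C X \<longleftrightarrow> (\<exists>p. hyperbolic_covering C X p)"


section \<open>Euler characteristic\<close>

text \<open>The torsion-free rank of an abelian group (junk if it is infinite).\<close>

definition group_rank :: "('a, 'b) monoid_scheme \<Rightarrow> nat" where
  "group_rank G = Sup (card ` {B. finite B \<and> B \<subseteq> carrier G \<and>
     (\<forall>c :: 'a \<Rightarrow> int. finprod G (\<lambda>x. x [^]\<^bsub>G\<^esub> c x) B = \<one>\<^bsub>G\<^esub> \<longrightarrow> (\<forall>x\<in>B. c x = 0))})"

definition betti :: "nat \<Rightarrow> 'a topology \<Rightarrow> nat" where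
  "betti p T = group_rank (homology_group (int p) T)"

definition euler_characteristic :: "'a topology \<Rightarrow> int" where
  "euler_characteristic T = (\<Sum>p | betti p T \<noteq> 0. (-1) ^ p * int (betti p T))"


section \<open>Schottky data\<close>

text \<open>The boundary of a Euclidean disk in the Riemann sphere is orthogonal to the extended real
  line if and only if some element of \<open>PSL2R\<close> maps the disk to a disk with real center; these
  are the Euclidean disks centered on the extended real line. They may contain the point at
  infinity, or have it on their boundary.\<close>

definition real_centered_open_disk :: "complex option set \<Rightarrow> bool" where
  "real_centered_open_disk E \<longleftrightarrow>
     (\<exists>g\<in>carrier PSL2R. \<exists>x :: real. \<exists>\<rho>>0. act g ` E = Some ` ball (complex_of_real x) \<rho>)"

definition sym_index :: "nat \<Rightarrow> int set" where
  "sym_index r = {i. i \<noteq> 0 \<and> \<bar>i\<bar> \<le> int r}"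

definition schottky_data ::
  "(real^2^2) set set \<Rightarrow> nat \<Rightarrow> (int \<Rightarrow> complex option set) \<Rightarrow> (int \<Rightarrow> (real^2^2) set) \<Rightarrow> bool" where
  "schottky_data \<Gamma> r D S \<longleftrightarrow>
     r \<ge> 1 \<and>
     (\<forall>i\<in>sym_index r. real_centered_open_disk (D i)) \<and>
     (\<forall>i\<in>sym_index r. \<forall>j\<in>sym_index r. i \<noteq> j \<longrightarrow>
        (riemann_sphere closure_of D i) \<inter> (riemann_sphere closure_of D j) = {}) \<and>
     (\<forall>j\<in>{1..int r}. S j \<in> carrier PSL2R \<and>
        act (S j) ` (- (riemann_sphere closure_of D j)) = D (- j) \<and>
        S (- j) = inv\<^bsub>PSL2R\<^esub> (S j)) \<and>
     \<Gamma> = generate PSL2R (S ` {1..int r})"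

definition schottky_data_for ::
  "'a metric \<Rightarrow> (real^2^2) set set \<Rightarrow> nat \<Rightarrow> (int \<Rightarrow> complex option set) \<Rightarrow>
   (int \<Rightarrow> (real^2^2) set) \<Rightarrow> bool" where
  "schottky_data_for X \<Gamma> r D S \<longleftrightarrow> schottky_data \<Gamma> r D S \<and> isometric_to_quotient X \<Gamma>"

definition schottky_surface :: "'a metric \<Rightarrow> bool" where
  "schottky_surface X \<longleftrightarrow> (\<exists>\<Gamma> r D S. schottky_data_for X \<Gamma> r D S)"


section \<open>Transfer operators\<close>

text \<open>The action of \<open>h\<close> is written with \<open>g = h\<^sup>-\<^sup>1\<close>, and \<open>g'(z) = (c z + d)\<^sup>-\<^sup>2\<close>.
  At the point mapped to infinity by \<open>g\<close>, the function \<open>tau s h f\<close> is given by its limit.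
  Thus a function \<open>f\<close> on a disk containing infinity is represented by its values at finite
  points only, and its behaviour at infinity is encoded in that limit.\<close>

definition tau :: "int \<Rightarrow> (real^2^2) set \<Rightarrow> (complex \<Rightarrow> complex) \<Rightarrow> complex \<Rightarrow> complex" where
  "tau s h f z =
     (let A = rep (inv\<^bsub>PSL2R\<^esub> h);
          num = (\<lambda>w. of_real (A$1$1) * w + of_real (A$1$2));
          den = (\<lambda>w. of_real (A$2$1) * w + of_real (A$2$2));
          F = (\<lambda>w. (1 / (den w)\<^sup>2) powi s * f (num w / den w))
      in if den z = 0 then Lim (at z) F else F z)"

definition finite_part :: "complex option set \<Rightarrow> complex set" where
  "finite_part E = {z. Some z \<in> E}"

definition bounded_in_plane :: "complex option set \<Rightarrow> bool" where
  "bounded_in_plane E \<longleftrightarrow> None \<notin> E \<and> bounded (finite_part E)"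

definition square_integrable_holomorphic :: "complex set \<Rightarrow> (complex \<Rightarrow> complex) \<Rightarrow> bool" where
  "square_integrable_holomorphic U f \<longleftrightarrow>
     f holomorphic_on U \<and> set_integrable lebesgue U (\<lambda>z. (cmod (f z))\<^sup>2)"

text \<open>Elements of the Bergman space of \<open>E\<close> are extended by zero to the finite points outside \<open>E\<close>,
  so that they are equal as functions if and only if they agree on \<open>E\<close>. If \<open>E\<close> is not bounded, the
  holomorphy of \<open>tau s q f\<close> on the whole disk \<open>q.E\<close> comprises the holomorphy of \<open>f\<close> at infinity.\<close>

definition bergman :: "int \<Rightarrow> complex option set \<Rightarrow> (complex \<Rightarrow> complex) set" where
  "bergman s E = {f. (\<forall>z. z \<notin> finite_part E \<longrightarrow> f z = 0) \<and>
     (if bounded_in_plane E then square_integrable_holomorphic (finite_part E) f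
      else \<exists>q\<in>carrier PSL2R. bounded_in_plane (act q ` E) \<and>
             square_integrable_holomorphic (finite_part (act q ` E)) (tau s q f))}"

type_synonym disk_family = "int \<Rightarrow> complex \<Rightarrow> complex"

definition bergman_sum ::
  "int \<Rightarrow> nat \<Rightarrow> (int \<Rightarrow> complex option set) \<Rightarrow> disk_family set" where
  "bergman_sum s r D = {f. (\<forall>i\<in>sym_index r. f i \<in> bergman s (D i)) \<and>
                           (\<forall>i. i \<notin> sym_index r \<longrightarrow> f i = (\<lambda>z. 0))}"

definition transfer_op ::
  "int \<Rightarrow> nat \<Rightarrow> (int \<Rightarrow> complex option set) \<Rightarrow> (int \<Rightarrow> (real^2^2) set) \<Rightarrow>
   disk_family \<Rightarrow> disk_family" where
  "transfer_op s r D S f = (\<lambda>i z.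
     if i \<in> sym_index r \<and> z \<in> finite_part (D i)
     then \<Sum>j\<in>sym_index r - {- i}. tau s (S j) (f j) z else 0)"


section \<open>Eigenvalues and multiplicities\<close>

definition family_scale :: "complex \<Rightarrow> disk_family \<Rightarrow> disk_family" where
  "family_scale c f = (\<lambda>i z. c * f i z)"

global_interpretation family: vector_space family_scale
  by unfold_locales (auto simp: family_scale_def fun_eq_iff algebra_simps)

definition eigenspace ::
  "disk_family set \<Rightarrow> (disk_family \<Rightarrow> disk_family) \<Rightarrow> complex \<Rightarrow> disk_family set" where
  "eigenspace V L \<mu> = {f \<in> V. L f = family_scale \<mu> f}"

definition is_eigenvalue ::
  "disk_family set \<Rightarrow> (disk_family \<Rightarrow> disk_family) \<Rightarrow> complex \<Rightarrow> bool" where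
  "is_eigenvalue V L \<mu> \<longleftrightarrow> (\<exists>f\<in>eigenspace V L \<mu>. f \<noteq> 0)"

text \<open>The dimension of the eigenspace, with value \<open>\<infinity>\<close> if it is not finite-dimensional.\<close>

definition geometric_multiplicity ::
  "disk_family set \<Rightarrow> (disk_family \<Rightarrow> disk_family) \<Rightarrow> complex \<Rightarrow> enat" where
  "geometric_multiplicity V L \<mu> =
     (SUP B\<in>{B. finite B \<and> B \<subseteq> eigenspace V L \<mu> \<and> family.independent B}. enat (card B))"


section \<open>Eigenfunctions of hyperbolic cylinders\<close>

definition translation_elt :: "real \<Rightarrow> (real^2^2) set" where
  "translation_elt l = psl (mat2 (exp (l / 2)) 0 0 (exp (- (l / 2))))"

definition inversion_elt :: "(real^2^2) set" where
  "inversion_elt = psl (mat2 0 1 (- 1) 0)"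

definition restrict_to :: "complex option set \<Rightarrow> (complex \<Rightarrow> complex) \<Rightarrow> complex \<Rightarrow> complex" where
  "restrict_to E f = (\<lambda>z. if z \<in> finite_part E then f z else 0)"

text \<open>For a cylinder with \<open>S\<^sub>1 = p a\<^sub>l p\<^sup>-\<^sup>1\<close>, these families with \<open>s = - n\<close> span the eigenspace
  of its transfer operator for the eigenvalue 1.\<close>

definition cylinder_eigenfun1 ::
  "nat \<Rightarrow> (int \<Rightarrow> complex option set) \<Rightarrow> (real^2^2) set \<Rightarrow> disk_family" where
  "cylinder_eigenfun1 n D p =
     (\<lambda>i. if i = 1 then restrict_to (D 1) (tau (- int n) p (\<lambda>z. z ^ n)) else (\<lambda>z. 0))"

definition cylinder_eigenfun2 ::
  "nat \<Rightarrow> (int \<Rightarrow> complex option set) \<Rightarrow> (real^2^2) set \<Rightarrow> disk_family" where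
  "cylinder_eigenfun2 n D p =
     (\<lambda>i. if i = - 1 then restrict_to (D (- 1))
            (tau (- int n) (p \<otimes>\<^bsub>PSL2R\<^esub> inversion_elt) (\<lambda>z. z ^ n)) else (\<lambda>z. 0))"

text \<open>\<open>induced_from_cylinder X n r D S f\<close>: the family \<open>f\<close> is the extension by zero of an
  eigenfunction \<open>g\<close> for the eigenvalue 1 of the transfer operator of a hyperbolic cylinder \<open>C\<close>
  that covers \<open>X\<close> and whose Schottky data consists of the two disks \<open>D j\<close>, \<open>D (- j)\<close> and the
  elements \<open>S j\<close>, \<open>S (- j)\<close> for some \<open>j\<close>.\<close>

definition induced_from_cylinder ::
  "'a metric \<Rightarrow> nat \<Rightarrow> nat \<Rightarrow> (int \<Rightarrow> complex option set) \<Rightarrow> (int \<Rightarrow> (real^2^2) set) \<Rightarrow>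
   disk_family \<Rightarrow> bool" where
  "induced_from_cylinder X n r D S f \<longleftrightarrow>
     (\<exists>j\<in>{1..int r}. \<exists>(C :: complex set metric) \<Gamma>\<^sub>C D\<^sub>C S\<^sub>C l p \<alpha> \<beta> g.
        D\<^sub>C = (\<lambda>i. D (i * j)) \<and> S\<^sub>C = (\<lambda>i. S (i * j)) \<and>
        schottky_data_for C \<Gamma>\<^sub>C 1 D\<^sub>C S\<^sub>C \<and> covers C X \<and>
        l > 0 \<and> p \<in> carrier PSL2R \<and>
        S\<^sub>C 1 = p \<otimes>\<^bsub>PSL2R\<^esub> translation_elt l \<otimes>\<^bsub>PSL2R\<^esub> inv\<^bsub>PSL2R\<^esub> p \<and>
        g = family_scale \<alpha> (cylinder_eigenfun1 n D\<^sub>C p)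
            + family_scale \<beta> (cylinder_eigenfun2 n D\<^sub>C p) \<and>
        g \<in> eigenspace (bergman_sum (- int n) 1 D\<^sub>C) (transfer_op (- int n) 1 D\<^sub>C S\<^sub>C) 1 \<and>
        f = (\<lambda>i. if i = j then g 1 else if i = - j then g (- 1) else (\<lambda>z. 0)))"

end

theory Submission
  imports Defs
begin

text \<open>
  For the \<open>j\<close>-th generator \<open>S\<^sub>j = p a\<^sub>l p\<^sup>-\<^sup>1\<close> let \<open>h = \<tau>\<^sub>s(p) z\<^sup>n\<close>. This is the \<open>n\<close>-th power of the product of
  the two linear forms that are the coordinates in the eigenbasis of \<open>S\<^sub>j\<close>, hence a polynomial
  with \<open>\<tau>\<^sub>s(S\<^sub>j) h = h\<close>. Put \<open>h\<close> on the disk \<open>D\<^sub>j\<close>, \<open>- h\<close> on \<open>D\<^sub>-\<^sub>j\<close>, and 0 on the other disks. The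
  transfer operator reproduces this family: \<open>D\<^sub>j\<close> receives only \<open>h\<close>, \<open>D\<^sub>-\<^sub>j\<close> only \<open>- h\<close>, and every other disk
  receives \<open>h - h = 0\<close> (\<open>axis_family_eigenfunction\<close>). The two halves are eigenfunctions of the
  cylinder of \<open>S\<^sub>j\<close>, and \<open>r\<close> families with different \<open>j\<close> are independent, since they live on
  different disks.

  It remains to compare \<open>r\<close> with the Euler characteristic, that is, to show \<open>1 - \<chi>(X) \<le> r\<close>
  (\<open>\<Gamma>_uniformizes_euler\<close>). The ping-pong argument shows that the group is free on its generators,
  acts discontinuously, and acts freely on the half-plane (\<open>word_inj_base\<close>, \<open>finite_\<Gamma>\<close>,
  \<open>free_action\<close>). So \<open>X\<close> is the quotient of a contractible space by a free group of rank \<open>r\<close>. On singular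
  chains upstairs, Fox derivatives show that the kernel of the projection to chains of \<open>X\<close> consists of
  the sums \<open>\<Sum> (S\<^sub>j - 1) b\<^sub>j\<close>, with unique \<open>b\<^sub>j\<close> (\<open>kernel_projection\<close>,
  \<open>fox_derivative_coinvariant\<close>). A cycle of \<open>X\<close>, subdivided finely enough, lifts to a chain whose boundary has
  this form, and it bounds as soon as all the \<open>b\<^sub>j\<close> do (\<open>projection_bounds\<close>). In dimension at least 2 the \<open>b\<^sub>j\<close>
  are cycles of positive dimension and bound; in dimension 1 the only obstruction is the vector of their \<open>r\<close>
  augmentations. Hence the first Betti number is at most \<open>r\<close> and
  all higher ones vanish, while the one in dimension 0 is 1 because \<open>X\<close> is path-connected.

  The generators do have the form \<open>p a\<^sub>l p\<^sup>-\<^sup>1\<close>: elliptic generators are excluded by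
  the freeness of the action, parabolic ones by the disjointness of the closed disks
  (\<open>generator_hyperbolic\<close>). The cylinders are the quotients by the cyclic groups generated by single
  generators, and they cover \<open>X\<close> because the discontinuous free action of the larger group makes
  the projection a local isometry with evenly covered balls (\<open>uniformized_covering\<close>).
\<close>

section \<open>Torsion-free rank\<close>

text \<open>Elimination of one coordinate at a time, multiplying up instead of dividing.\<close>

lemma integer_vectors_dependent:
  fixes v :: "'b \<Rightarrow> nat \<Rightarrow> int"
  assumes "finite B" "card B > m"
  shows "\<exists>c. (\<exists>x\<in>B. c x \<noteq> 0) \<and> (\<forall>i<m. (\<Sum>x\<in>B. c x * v x i) = 0)"
  using assms
proof (induction m arbitrary: B v)
  case 0
  then obtain x where "x \<in> B" by fastforce
  then show ?case by (intro exI[of _ "\<lambda>_. 1"]) auto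
next
  case (Suc m)
  show ?case
  proof (cases "\<forall>x\<in>B. v x m = 0")
    case True
    from Suc.IH[of B v] Suc.prems obtain c where
      "\<exists>x\<in>B. c x \<noteq> 0" and c: "\<forall>i<m. (\<Sum>x\<in>B. c x * v x i) = 0" by auto
    moreover have "(\<Sum>x\<in>B. c x * v x m) = 0" using True by simp
    ultimately show ?thesis by (metis less_Suc_eq)
  next
    case False
    then obtain a where a: "a \<in> B" "v a m \<noteq> 0" by auto
    \<comment> \<open>A multiple of \<open>v x\<close>, reduced by the pivot \<open>v a\<close> so that the coordinate \<open>m\<close> vanishes.\<close>
    define w where "w x i = v a m * v x i - v x m * v a i" for x i
    have fin: "finite (B - {a})" and "card (B - {a}) > m" using Suc.prems a by auto
    from Suc.IH[OF this, of w] obtain c where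
      c: "\<exists>x\<in>B-{a}. c x \<noteq> 0" "\<forall>i<m. (\<Sum>x\<in>B-{a}. c x * w x i) = 0" by auto
    define d where "d x = (if x = a then - (\<Sum>y\<in>B-{a}. c y * v y m) else v a m * c x)" for x
    have sum: "(\<Sum>x\<in>B. d x * v x i) = (\<Sum>x\<in>B-{a}. c x * w x i)" for i
    proof -
      have "(\<Sum>x\<in>B. d x * v x i) = d a * v a i + (\<Sum>x\<in>B-{a}. d x * v x i)"
        using a Suc.prems(1) by (simp add: sum.remove)
      also have "(\<Sum>x\<in>B-{a}. d x * v x i) = (\<Sum>x\<in>B-{a}. v a m * c x * v x i)"
        by (rule sum.cong) (auto simp: d_def)
      also have "d a * v a i = (\<Sum>x\<in>B-{a}. - (c x * v x m * v a i))"
        by (simp add: d_def sum_distrib_right sum_negf)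
      finally show ?thesis
        by (simp add: w_def sum.distrib[symmetric] algebra_simps)
    qed
    have "(\<Sum>x\<in>B. d x * v x m) = 0" unfolding sum by (simp add: w_def)
    then have "\<forall>i<Suc m. (\<Sum>x\<in>B. d x * v x i) = 0" using c(2) sum less_Suc_eq by simp
    moreover have "\<exists>x\<in>B. d x \<noteq> 0" using c(1) a(2) by (auto simp: d_def)
    ultimately show ?thesis by blast
  qed
qed

text \<open>The bound is proved for all independent sets, which also makes their cardinalities bounded;
  the supremum of an unbounded set of natural numbers has an arbitrary value.\<close>

lemma group_rank_le:
  fixes G :: "('a, 'b) monoid_scheme" and v :: "'a \<Rightarrow> nat \<Rightarrow> int"
  assumes "\<And>B c. \<lbrakk>finite B; B \<subseteq> carrier G; \<And>i. i < m \<Longrightarrow> (\<Sum>x\<in>B. c x * v x i) = 0\<rbrakk>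
              \<Longrightarrow> finprod G (\<lambda>x. x [^]\<^bsub>G\<^esub> (c x :: int)) B = \<one>\<^bsub>G\<^esub>"
  shows "group_rank G \<le> m" "bdd_above (card ` {B. finite B \<and> B \<subseteq> carrier G \<and>
     (\<forall>c :: 'a \<Rightarrow> int. finprod G (\<lambda>x. x [^]\<^bsub>G\<^esub> c x) B = \<one>\<^bsub>G\<^esub> \<longrightarrow> (\<forall>x\<in>B. c x = 0))})"
proof -
  have le: "card B \<le> m" if B: "finite B" "B \<subseteq> carrier G"
    and ind: "\<And>c :: 'a \<Rightarrow> int. finprod G (\<lambda>x. x [^]\<^bsub>G\<^esub> c x) B = \<one>\<^bsub>G\<^esub> \<Longrightarrow> \<forall>x\<in>B. c x = 0" for B
  proof (rule ccontr)
    assume "\<not> card B \<le> m"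
    with integer_vectors_dependent[OF B(1), of m v] obtain c
      where "\<exists>x\<in>B. c x \<noteq> 0" "\<forall>i<m. (\<Sum>x\<in>B. c x * v x i) = 0" by auto
    with assms[OF B, of c] ind[of c] show False by auto
  qed
  then show "bdd_above (card ` {B. finite B \<and> B \<subseteq> carrier G \<and>
     (\<forall>c :: 'a \<Rightarrow> int. finprod G (\<lambda>x. x [^]\<^bsub>G\<^esub> c x) B = \<one>\<^bsub>G\<^esub> \<longrightarrow> (\<forall>x\<in>B. c x = 0))})"
    by (intro bdd_aboveI[of _ m]) auto
  show "group_rank G \<le> m"
    unfolding group_rank_def
    by (rule cSup_least) (use le in \<open>auto intro!: exI[of _ "{}"]\<close>)
qed

text \<open>Passage to classes is a homomorphism, so integer combinations may be formed on cycles.\<close>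

lemma homology_class_combination:
  assumes "finite B" and cyc: "\<And>x. x \<in> B \<Longrightarrow> singular_relcycle p X {} (z x)"
    and cls: "\<And>x. x \<in> B \<Longrightarrow> x = homologous_rel_set p X {} (z x)"
  shows "finprod (homology_group (int p) X) (\<lambda>x. x [^]\<^bsub>homology_group (int p) X\<^esub> (c x :: int)) B
           = homologous_rel_set p X {} (\<Sum>x\<in>B. frag_cmul (c x) (z x))"
proof -
  let ?R = "relcycle_group p X {}" and ?N = "Collect (singular_relboundary p X {})"
  have G: "homology_group (int p) X = ?R Mod ?N"
    by (simp add: nontrivial_relative_homology_group)
  have cl: "r_coset ?R ?N = homologous_rel_set p X {}"
    by (simp add: right_coset_singular_relboundary)
  interpret N: normal ?N ?R by (rule normal_subgroup_singular_relboundary_relcycle)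
  interpret H: comm_group "homology_group (int p) X" by simp
  have pow: "x [^]\<^bsub>homology_group (int p) X\<^esub> (c x :: int) = homologous_rel_set p X {} (frag_cmul (c x) (z x))"
    if x: "x \<in> B" for x
  proof -
    have "(?N #>\<^bsub>?R\<^esub> z x) [^]\<^bsub>?R Mod ?N\<^esub> c x = ?N #>\<^bsub>?R\<^esub> (z x [^]\<^bsub>?R\<^esub> c x)"
      using N.FactGroup_int_pow cyc[OF x] by simp
    moreover have "z x [^]\<^bsub>?R\<^esub> c x = frag_cmul (c x) (z x)"
    proof -
      have "z x [^]\<^bsub>?R\<^esub> c x = z x [^]\<^bsub>chain_group p X\<^esub> c x"
        unfolding relcycle_group_def
        by (rule group.int_pow_subgroup_generated)
           (use cyc[OF x] in \<open>auto simp flip: relcycle_group_def\<close>)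
      also have "\<dots> = frag_cmul (c x) (z x)"
        unfolding chain_group_def using cyc[OF x] 
        by (intro int_pow_free_Abelian_group) (auto simp: singular_relcycle_def singular_chain_def)
      finally show ?thesis .
    qed
    ultimately show ?thesis using cls[OF x] unfolding G cl by metis
  qed
  have "finprod (homology_group (int p) X) (\<lambda>x. homologous_rel_set p X {} (frag_cmul (c x) (z x))) B
           = homologous_rel_set p X {} (\<Sum>x\<in>B. frag_cmul (c x) (z x))"
    using assms(1) cyc
  proof (induction B rule: finite_induct)
    case empty
    have "singular_relboundary_set p X {} = homologous_rel_set p X {} 0"
      using homologous_rel_set_eq_relboundary[of p X "{}" 0] by simp
    then show ?case by simp
  next
    case (insert a B)
    have car: "homologous_rel_set p X {} (frag_cmul (c x) (z x)) \<in> carrier (homology_group (int p) X)"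
      if "x \<in> insert a B" for x
      using insert.prems[OF that] by (auto simp: carrier_relative_homology_group singular_relcycle_cmul)
    have sum: "singular_relcycle p X {} (\<Sum>x\<in>B. frag_cmul (c x) (z x))"
      by (rule singular_relcycle_sum) (use insert.prems in \<open>auto simp: singular_relcycle_cmul\<close>)
    have "homologous_rel_set p X {} (frag_cmul (c a) (z a)) \<otimes>\<^bsub>homology_group (int p) X\<^esub>
          homologous_rel_set p X {} (\<Sum>x\<in>B. frag_cmul (c x) (z x))
          = homologous_rel_set p X {} (frag_cmul (c a) (z a) + (\<Sum>x\<in>B. frag_cmul (c x) (z x)))"
      using N.rcos_sum[of "frag_cmul (c a) (z a)" "\<Sum>x\<in>B. frag_cmul (c x) (z x)"] sum
        insert.prems[of a] unfolding G by (simp add: cl singular_relcycle_cmul)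
    moreover have "finprod (homology_group (int p) X) (\<lambda>x. homologous_rel_set p X {} (frag_cmul (c x) (z x))) (insert a B)
      = homologous_rel_set p X {} (frag_cmul (c a) (z a)) \<otimes>\<^bsub>homology_group (int p) X\<^esub>
        finprod (homology_group (int p) X) (\<lambda>x. homologous_rel_set p X {} (frag_cmul (c x) (z x))) B"
      using insert.hyps car by (intro H.finprod_insert) auto
    ultimately show ?case using insert by simp
  qed
  moreover have "finprod (homology_group (int p) X) (\<lambda>x. x [^]\<^bsub>homology_group (int p) X\<^esub> (c x :: int)) B
    = finprod (homology_group (int p) X) (\<lambda>x. homologous_rel_set p X {} (frag_cmul (c x) (z x))) B"
    by (rule H.finprod_cong') (auto simp: pow carrier_relative_homology_group singular_relcycle_cmul cyc)
  ultimately show ?thesis by simp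
qed

text \<open>A rank bound for homology: it suffices to attach to every cycle an integer vector whose
  vanishing on a combination of cycles forces that combination to bound.\<close>

lemma betti_le:
  fixes v :: "'a chain \<Rightarrow> nat \<Rightarrow> int"
  assumes "\<And>B c. \<lbrakk>finite B; \<And>z. z \<in> B \<Longrightarrow> singular_relcycle p X {} z;
                   \<And>i. i < m \<Longrightarrow> (\<Sum>z\<in>B. c z * v z i) = 0\<rbrakk>
              \<Longrightarrow> singular_relboundary p X {} (\<Sum>z\<in>B. frag_cmul (c z) z)"
  shows "betti p X \<le> m"
  unfolding betti_def
proof (rule group_rank_le)
  let ?z = "\<lambda>x. SOME z. singular_relcycle p X {} z \<and> x = homologous_rel_set p X {} z"
  fix B c assume B: "finite B" "B \<subseteq> carrier (homology_group (int p) X)"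
    and 0: "\<And>i. i < m \<Longrightarrow> (\<Sum>x\<in>B. c x * v (?z x) i) = 0"
  have z: "singular_relcycle p X {} (?z x)" "x = homologous_rel_set p X {} (?z x)" if "x \<in> B" for x
  proof -
    have "\<exists>z. singular_relcycle p X {} z \<and> x = homologous_rel_set p X {} z"
      using B that by (auto simp: carrier_relative_homology_group)
    from someI_ex[OF this] show "singular_relcycle p X {} (?z x)" "x = homologous_rel_set p X {} (?z x)"
      by auto
  qed
  have inj: "inj_on ?z B" using z(2) by (metis (no_types, lifting) inj_onI)
  define d where "d y = c (inv_into B ?z y)" for y
  have d: "d (?z x) = c x" if "x \<in> B" for x
    using inv_into_f_f[OF inj that] by (simp add: d_def)
  have "singular_relboundary p X {} (\<Sum>y\<in>?z ` B. frag_cmul (d y) y)"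
    using B(1) z(1) 0 d by (intro assms) (auto simp: sum.reindex[OF inj])
  also have "(\<Sum>y\<in>?z ` B. frag_cmul (d y) y) = (\<Sum>x\<in>B. frag_cmul (c x) (?z x))"
    using d by (simp add: sum.reindex[OF inj])
  finally have "homologous_rel_set p X {} (\<Sum>x\<in>B. frag_cmul (c x) (?z x)) = \<one>\<^bsub>homology_group (int p) X\<^esub>"
    by (simp add: homologous_rel_set_eq_relboundary)
  then show "finprod (homology_group (int p) X) (\<lambda>x. x [^]\<^bsub>homology_group (int p) X\<^esub> c x) B
      = \<one>\<^bsub>homology_group (int p) X\<^esub>"
    using homology_class_combination[OF B(1), of p X ?z c] z by simp
qed

lemma betti_0_path_connected:
  assumes "path_connected_space X" "topspace X \<noteq> {}"
  shows "betti 0 X = 1"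
proof -
  let ?G = "homology_group 0 X"
  interpret G: comm_group ?G by simp
  have "?G \<cong> integer_group" using isomorphic_integer_zeroth_homology_group[OF assms] .
  then obtain h where h: "h \<in> iso ?G integer_group" unfolding is_iso_def by auto
  then have hom: "h \<in> hom ?G integer_group" and inj: "inj_on h (carrier ?G)"
    and surj: "h ` carrier ?G = UNIV" by (auto simp: iso_def bij_betw_def)
  interpret h: group_hom ?G integer_group h
    using hom by (simp add: group_hom_def group_hom_axioms_def)
  have hpow: "h (x [^]\<^bsub>?G\<^esub> (k::int)) = k * h x" if "x \<in> carrier ?G" for x k
    using h.hom_int_pow[OF that] by simp
  have hprod: "h (finprod ?G (\<lambda>x. x [^]\<^bsub>?G\<^esub> (c x::int)) B) = (\<Sum>x\<in>B. c x * h x)"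
    if "finite B" "B \<subseteq> carrier ?G" for B c
    using that
  proof (induction B rule: finite_induct)
    case (insert a B)
    have "h (finprod ?G (\<lambda>x. x [^]\<^bsub>?G\<^esub> (c x::int)) (insert a B))
       = h (a [^]\<^bsub>?G\<^esub> c a \<otimes>\<^bsub>?G\<^esub> finprod ?G (\<lambda>x. x [^]\<^bsub>?G\<^esub> (c x::int)) B)"
      using insert by (subst G.finprod_insert) auto
    also have "\<dots> = h (a [^]\<^bsub>?G\<^esub> c a) + h (finprod ?G (\<lambda>x. x [^]\<^bsub>?G\<^esub> (c x::int)) B)"
      using insert by (subst h.hom_mult) (auto intro!: G.finprod_closed)
    finally show ?case using insert by (simp add: hpow)
  next
    case empty then show ?case using h.hom_one by simp
  qed
  have rel: "finprod ?G (\<lambda>x. x [^]\<^bsub>?G\<^esub> (c x :: int)) B = \<one>\<^bsub>?G\<^esub>"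
    if "finite B" "B \<subseteq> carrier ?G" "\<And>i. i < 1 \<Longrightarrow> (\<Sum>x\<in>B. c x * (\<lambda>x i::nat. h x) x i) = 0" for B c
  proof -
    have "h (finprod ?G (\<lambda>x. x [^]\<^bsub>?G\<^esub> (c x::int)) B) = h \<one>\<^bsub>?G\<^esub>"
      using hprod[OF that(1,2)] that(3)[of 0] h.hom_one by simp
    then show ?thesis
      using inj that(2) by (intro inj_onD[OF inj]) (auto intro!: G.finprod_closed)
  qed
  obtain g where g: "g \<in> carrier ?G" "h g = 1" using surj by (metis UNIV_I imageE)
  let ?I = "{B. finite B \<and> B \<subseteq> carrier ?G \<and>
     (\<forall>c :: _ \<Rightarrow> int. finprod ?G (\<lambda>x. x [^]\<^bsub>?G\<^esub> c x) B = \<one>\<^bsub>?G\<^esub> \<longrightarrow> (\<forall>x\<in>B. c x = 0))}"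
  have "{g} \<in> ?I"
  proof -
    have "c g = 0" if "finprod ?G (\<lambda>x. x [^]\<^bsub>?G\<^esub> (c x::int)) {g} = \<one>\<^bsub>?G\<^esub>" for c
      using hprod[of "{g}" c] g that h.hom_one by simp
    then show ?thesis using g by blast
  qed
  then have "1 \<in> card ` ?I" by (intro image_eqI[of _ card "{g}"]) simp_all
  moreover have "bdd_above (card ` ?I)"
    by (rule group_rank_le(2)[of ?G 1 "\<lambda>x i. h x"]) (rule rel, auto)
  ultimately have "1 \<le> group_rank ?G"
    unfolding group_rank_def by (intro cSup_upper)
  moreover have "group_rank ?G \<le> 1"
    by (rule group_rank_le(1)[of ?G 1 "\<lambda>x i. h x"]) (rule rel, auto)
  ultimately show ?thesis unfolding betti_def by simp
qed

section \<open>Quotients by freely acting free groups\<close>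

definition reduced_word :: "nat \<Rightarrow> int list \<Rightarrow> bool" where
  "reduced_word r w \<longleftrightarrow> set w \<subseteq> sym_index r \<and> successively (\<lambda>i j. i \<noteq> - j) w"

lemma reduced_word_Nil [simp]: "reduced_word r []"
  by (simp add: reduced_word_def)

lemma reduced_word_Cons:
  "reduced_word r (i # w) \<longleftrightarrow> i \<in> sym_index r \<and> reduced_word r w \<and> (w \<noteq> [] \<longrightarrow> hd w \<noteq> - i)"
  by (cases w) (auto simp: reduced_word_def)

lemma sym_index_uminus [simp]: "- i \<in> sym_index r \<longleftrightarrow> i \<in> sym_index r"
  by (auto simp: sym_index_def)

lemma sym_index_pos: "j \<in> {1..int r} \<Longrightarrow> j \<in> sym_index r"
  by (auto simp: sym_index_def)

text \<open>The generators \<open>T i\<close>, with \<open>T (- i)\<close> inverse to \<open>T i\<close>, act on \<open>H\<close> so that reduced words permute every fibre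
  of \<open>\<pi>\<close> simply transitively. In place of path lifting there are local sections: they suffice
  because cycles of \<open>X\<close> can be subdivided until every simplex is small.\<close>

locale free_quotient =
  fixes H :: "'b topology" and X :: "'a topology" and \<pi> :: "'b \<Rightarrow> 'a"
    and T :: "int \<Rightarrow> 'b \<Rightarrow> 'b" and r :: nat
  assumes contractible: "contractible_space H"
    and cont_\<pi>: "continuous_map H X \<pi>"
    and cont_T: "i \<in> sym_index r \<Longrightarrow> continuous_map H H (T i)"
    and T_uminus: "\<lbrakk>i \<in> sym_index r; z \<in> topspace H\<rbrakk> \<Longrightarrow> T i (T (- i) z) = z"
    and \<pi>_T: "\<lbrakk>i \<in> sym_index r; z \<in> topspace H\<rbrakk> \<Longrightarrow> \<pi> (T i z) = \<pi> z"
    and fibre: "\<lbrakk>y \<in> topspace H; z \<in> topspace H; \<pi> y = \<pi> z\<rbrakk> \<Longrightarrow> \<exists>w. reduced_word r w \<and> z = foldr T w y"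
    and free: "\<lbrakk>z \<in> topspace H; reduced_word r v; reduced_word r w; foldr T v z = foldr T w z\<rbrakk> \<Longrightarrow> v = w"
    and discontinuous: "z \<in> topspace H \<Longrightarrow> \<exists>V. openin H V \<and> z \<in> V \<and>
          (\<forall>w y. reduced_word r w \<longrightarrow> y \<in> V \<longrightarrow> foldr T w y \<in> V \<longrightarrow> w = [])"
    and local_section: "x \<in> topspace X \<Longrightarrow> \<exists>U s. openin X U \<and> x \<in> U \<and>
          continuous_map (subtopology X U) H s \<and> (\<forall>y\<in>U. \<pi> (s y) = y)"
begin

lemma cont_word: "set w \<subseteq> sym_index r \<Longrightarrow> continuous_map H H (foldr T w)"
proof (induction w)
  case (Cons i w)
  then have "continuous_map H H (T i \<circ> foldr T w)"
    by (intro continuous_map_compose[of H H _ H]) (auto intro: cont_T)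
  then show ?case by (simp add: comp_def)
qed (simp add: id_def)

lemma word_in_space: "\<lbrakk>set w \<subseteq> sym_index r; z \<in> topspace H\<rbrakk> \<Longrightarrow> foldr T w z \<in> topspace H"
  using cont_word continuous_map_def by (metis PiE)

lemma \<pi>_word: "\<lbrakk>set w \<subseteq> sym_index r; z \<in> topspace H\<rbrakk> \<Longrightarrow> \<pi> (foldr T w z) = \<pi> z"
  by (induction w) (auto simp: \<pi>_T word_in_space)

lemma simplex_word:
  "\<lbrakk>set w \<subseteq> sym_index r; singular_simplex p H \<sigma>\<rbrakk> \<Longrightarrow> singular_simplex p H (simplex_map p (foldr T w) \<sigma>)"
  by (blast intro: singular_simplex_simplex_map cont_word)

lemma simplex_point:
  "\<lbrakk>singular_simplex p Y \<sigma>; x \<in> standard_simplex p\<rbrakk> \<Longrightarrow> \<sigma> x \<in> topspace Y"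
  by (auto simp: singular_simplex_def continuous_map_def Pi_iff)

text \<open>The word carrying one lift to the other is locally constant on the connected simplex.\<close>

lemma lifts_differ_by_word:
  assumes f: "singular_simplex p H f" and g: "singular_simplex p H g"
    and same: "simplex_map p \<pi> f = simplex_map p \<pi> g"
  shows "\<exists>w. reduced_word r w \<and> simplex_map p (foldr T w) f = g"
proof -
  let ?P = "subtopology (powertop_real UNIV) (standard_simplex p)"
  have top: "topspace ?P = standard_simplex p" by (simp add: topspace_standard_simplex)
  have fg: "continuous_map ?P H f" "continuous_map ?P H g" using f g by (auto simp: singular_simplex_def)
  have pfg: "\<pi> (f x) = \<pi> (g x)" if "x \<in> standard_simplex p" for x
    using same that by (metis comp_apply restrict_apply' simplex_map_def)
  then have "\<exists>w. reduced_word r w \<and> g x = foldr T w (f x)" if "x \<in> standard_simplex p" for x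
    using fibre simplex_point[OF f that] simplex_point[OF g that] that by metis
  then obtain W where W: "\<And>x. x \<in> standard_simplex p \<Longrightarrow> reduced_word r (W x)"
    "\<And>x. x \<in> standard_simplex p \<Longrightarrow> g x = foldr T (W x) (f x)" by metis
  have loc: "\<exists>N. openin ?P N \<and> x \<in> N \<and> (\<forall>y\<in>N. W y = W x)" if x: "x \<in> standard_simplex p" for x
  proof -
    have sub: "set (W x) \<subseteq> sym_index r" using W(1)[OF x] by (simp add: reduced_word_def)
    from discontinuous[OF simplex_point[OF g x]] obtain V where V: "openin H V" "g x \<in> V"
      "\<And>w y. \<lbrakk>reduced_word r w; y \<in> V; foldr T w y \<in> V\<rbrakk> \<Longrightarrow> w = []" by blast
    have c: "continuous_map ?P H (foldr T (W x) \<circ> f)"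
      using fg(1) cont_word[OF sub] by (rule continuous_map_compose)
    define N where "N = {y \<in> topspace ?P. g y \<in> V} \<inter> {y \<in> topspace ?P. (foldr T (W x) \<circ> f) y \<in> V}"
    have "openin ?P N"
      unfolding N_def using openin_continuous_map_preimage[OF fg(2) V(1)]
        openin_continuous_map_preimage[OF c V(1)] by blast
    moreover have "x \<in> N" using x V(2) W(2)[OF x] by (simp add: N_def top)
    moreover have "W y = W x" if "y \<in> N" for y
    proof -
      have y: "y \<in> standard_simplex p" "g y \<in> V" "foldr T (W x) (f y) \<in> V"
        using that by (auto simp: N_def top)
      have fy: "f y \<in> topspace H" and gy: "g y \<in> topspace H"
        using simplex_point f g y(1) by auto
      have "\<pi> (foldr T (W x) (f y)) = \<pi> (g y)" using \<pi>_word[OF sub fy] pfg[OF y(1)] by simp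
      then obtain u where u: "reduced_word r u" "g y = foldr T u (foldr T (W x) (f y))"
        using fibre word_in_space[OF sub fy] gy by blast
      then have "u = []" using V(3)[of u "foldr T (W x) (f y)"] y by simp
      then have "foldr T (W y) (f y) = foldr T (W x) (f y)" using u W(2)[OF y(1)] by simp
      then show ?thesis using free[OF fy] W(1) x y(1) by blast
    qed
    ultimately show ?thesis by blast
  qed
  obtain x0 where x0: "x0 \<in> standard_simplex p" using nonempty_standard_simplex by blast
  have op: "openin ?P {x \<in> standard_simplex p. W x \<in> A}" for A
    unfolding openin_subopen[of ?P "{x \<in> standard_simplex p. W x \<in> A}"]
  proof
    fix x assume x: "x \<in> {x \<in> standard_simplex p. W x \<in> A}"
    then obtain N where N: "openin ?P N" "x \<in> N" "\<forall>y\<in>N. W y = W x" using loc by blast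
    then have "N \<subseteq> standard_simplex p" using openin_subset top by metis
    then show "\<exists>N. openin ?P N \<and> x \<in> N \<and> N \<subseteq> {x \<in> standard_simplex p. W x \<in> A}"
      using N x by (metis (mono_tags, lifting) mem_Collect_eq subset_eq)
  qed
  have "connected_space ?P"
    using connectedin_standard_simplex[of p] by (simp add: connectedin_def)
  moreover have "{x \<in> standard_simplex p. W x \<in> {W x0}} \<inter> {x \<in> standard_simplex p. W x \<in> - {W x0}} = {}"
    "topspace ?P \<subseteq> {x \<in> standard_simplex p. W x \<in> {W x0}} \<union> {x \<in> standard_simplex p. W x \<in> - {W x0}}"
    unfolding top by auto
  ultimately have "{x \<in> standard_simplex p. W x \<in> - {W x0}} = {}"
    using x0 op[of "{W x0}"] op[of "- {W x0}"] unfolding connected_space_def by blast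
  then have const: "W x = W x0" if "x \<in> standard_simplex p" for x using that by blast
  have "simplex_map p (foldr T (W x0)) f = g"
  proof
    fix x show "simplex_map p (foldr T (W x0)) f x = g x"
      using W(2)[of x] const[of x] g
      by (cases "x \<in> standard_simplex p") (auto simp: simplex_map_def singular_simplex_def extensional_def)
  qed
  then show ?thesis using W(1)[OF x0] by blast
qed

subsection \<open>Fox derivatives\<close>

definition base_lift :: "nat \<Rightarrow> ((nat \<Rightarrow> real) \<Rightarrow> 'a) \<Rightarrow> (nat \<Rightarrow> real) \<Rightarrow> 'b" where
  "base_lift p \<tau> = (SOME \<sigma>. singular_simplex p H \<sigma> \<and> simplex_map p \<pi> \<sigma> = \<tau>)"

definition lift_word :: "nat \<Rightarrow> ((nat \<Rightarrow> real) \<Rightarrow> 'b) \<Rightarrow> int list" where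
  "lift_word p \<sigma> = (THE w. reduced_word r w \<and>
     simplex_map p (foldr T w) (base_lift p (simplex_map p \<pi> \<sigma>)) = \<sigma>)"

lemma base_lift:
  assumes "singular_simplex p H \<sigma>"
  shows "singular_simplex p H (base_lift p (simplex_map p \<pi> \<sigma>))"
    "simplex_map p \<pi> (base_lift p (simplex_map p \<pi> \<sigma>)) = simplex_map p \<pi> \<sigma>"
proof -
  have "\<exists>\<sigma>'. singular_simplex p H \<sigma>' \<and> simplex_map p \<pi> \<sigma>' = simplex_map p \<pi> \<sigma>" using assms by blast
  from someI_ex[OF this] show "singular_simplex p H (base_lift p (simplex_map p \<pi> \<sigma>))"
    "simplex_map p \<pi> (base_lift p (simplex_map p \<pi> \<sigma>)) = simplex_map p \<pi> \<sigma>"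
    unfolding base_lift_def by auto
qed

lemma simplex_word_inj:
  assumes \<sigma>: "singular_simplex p H \<sigma>" and "reduced_word r v" "reduced_word r w"
    and eq: "simplex_map p (foldr T v) \<sigma> = simplex_map p (foldr T w) \<sigma>"
  shows "v = w"
proof -
  obtain x where x: "x \<in> standard_simplex p" using nonempty_standard_simplex by blast
  then have "foldr T v (\<sigma> x) = foldr T w (\<sigma> x)"
    using fun_cong[OF eq, of x] by (simp add: simplex_map_def)
  then show ?thesis using free[OF simplex_point[OF \<sigma> x]] assms by blast
qed

lemma lift_word:
  assumes "singular_simplex p H \<sigma>"
  shows "reduced_word r (lift_word p \<sigma>)"
    "simplex_map p (foldr T (lift_word p \<sigma>)) (base_lift p (simplex_map p \<pi> \<sigma>)) = \<sigma>"
proof -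
  have "\<exists>!w. reduced_word r w \<and> simplex_map p (foldr T w) (base_lift p (simplex_map p \<pi> \<sigma>)) = \<sigma>"
    using lifts_differ_by_word[OF base_lift(1)[OF assms] assms base_lift(2)[OF assms]]
      simplex_word_inj[OF base_lift(1)[OF assms]] by metis
  from theI'[OF this] show "reduced_word r (lift_word p \<sigma>)"
    "simplex_map p (foldr T (lift_word p \<sigma>)) (base_lift p (simplex_map p \<pi> \<sigma>)) = \<sigma>"
    unfolding lift_word_def by auto
qed

lemma lift_word_eqI:
  assumes "singular_simplex p H \<sigma>" "reduced_word r w"
    "simplex_map p (foldr T w) (base_lift p (simplex_map p \<pi> \<sigma>)) = \<sigma>"
  shows "lift_word p \<sigma> = w"
  using simplex_word_inj[OF base_lift(1)[OF assms(1)]] lift_word[OF assms(1)] assms by metis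

text \<open>The Fox derivative of \<open>w \<sigma> - \<sigma>\<close>, read off from the word \<open>w\<close> by the rule
  \<open>S v - 1 = (S - 1) v + (v - 1)\<close>, where for an inverse generator \<open>S\<^sup>-\<^sup>1 - 1 = - (S - 1) S\<^sup>-\<^sup>1\<close>.
  For every simplex a lift of its projection serves as the origin of its orbit.\<close>

primrec fox :: "nat \<Rightarrow> int \<Rightarrow> ((nat \<Rightarrow> real) \<Rightarrow> 'b) \<Rightarrow> int list \<Rightarrow> 'b chain" where
  "fox p j \<sigma> [] = 0"
| "fox p j \<sigma> (i # w) = (if i = j then frag_of (simplex_map p (foldr T w) \<sigma>)
      else if i = - j then - frag_of (simplex_map p (foldr T (i # w)) \<sigma>) else 0) + fox p j \<sigma> w"

definition fox_derivative :: "nat \<Rightarrow> int \<Rightarrow> 'b chain \<Rightarrow> 'b chain" where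
  "fox_derivative p j =
     frag_extend (\<lambda>\<sigma>. fox p j (base_lift p (simplex_map p \<pi> \<sigma>)) (lift_word p \<sigma>))"

lemma fox_derivative_linear:
  "fox_derivative p j 0 = 0"
  "fox_derivative p j (a - b) = fox_derivative p j a - fox_derivative p j b"
  "fox_derivative p j (frag_cmul k a) = frag_cmul k (fox_derivative p j a)"
  "finite I \<Longrightarrow> fox_derivative p j (\<Sum>i\<in>I. g i) = (\<Sum>i\<in>I. fox_derivative p j (g i))"
  by (auto simp: fox_derivative_def frag_extend_diff frag_extend_cmul frag_extend_sum)

lemma fox_chain:
  "\<lbrakk>set w \<subseteq> sym_index r; singular_simplex p H \<sigma>\<rbrakk> \<Longrightarrow> singular_chain p H (fox p j \<sigma> w)"
proof (induction w)
  case (Cons i w)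
  have "singular_simplex p H (simplex_map p (foldr T (i # w)) \<sigma>)"
       "singular_simplex p H (simplex_map p (foldr T w) \<sigma>)"
    using Cons.prems by (auto intro!: simplex_word simp del: foldr.simps)
  then show ?case using Cons
    by (auto intro!: singular_chain_add singular_chain_diff simp: singular_chain_minus singular_chain_of simp del: foldr.simps)
qed simp

lemma fox_derivative_chain:
  assumes "singular_chain p H c" shows "singular_chain p H (fox_derivative p j c)"
  unfolding fox_derivative_def
proof (rule singular_chain_extend)
  fix \<sigma> assume "\<sigma> \<in> Poly_Mapping.keys c"
  then have "singular_simplex p H \<sigma>" using assms by (auto simp: singular_chain_def)
  from fox_chain[OF _ base_lift(1)[OF this]] lift_word(1)[OF this]
  show "singular_chain p H (fox p j (base_lift p (simplex_map p \<pi> \<sigma>)) (lift_word p \<sigma>))"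
    by (auto simp: reduced_word_def)
qed

lemma simplex_map_word_Cons:
  "simplex_map p (foldr T (i # w)) \<sigma> = simplex_map p (T i) (simplex_map p (foldr T w) \<sigma>)"
  by (auto simp: simplex_map_def)

lemma simplex_map_T_uminus:
  assumes "i \<in> sym_index r" "singular_simplex p H \<sigma>"
  shows "simplex_map p (T i) (simplex_map p (T (- i)) \<sigma>) = \<sigma>"
proof -
  have "simplex_map p (T i \<circ> T (- i)) \<sigma> = \<sigma>"
    by (rule simplex_map_id_gen[OF assms(2)]) (use T_uminus assms(1) in auto)
  then show ?thesis by (simp add: simplex_map_compose)
qed

text \<open>Prefixing a generator either lengthens the reduced word or cancels its first letter; the two
  clauses of the recursion give the same difference.\<close>

lemma fox_derivative_generator:
  assumes jk: "j \<in> {1..int r}" "k \<in> {1..int r}" and \<sigma>: "singular_simplex p H \<sigma>"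
  shows "fox_derivative p k (frag_of (simplex_map p (T j) \<sigma>)) =
           fox_derivative p k (frag_of \<sigma>) + (if j = k then frag_of \<sigma> else 0)"
proof -
  let ?b = "base_lift p (simplex_map p \<pi> \<sigma>)" and ?w = "lift_word p \<sigma>"
  let ?\<sigma>' = "simplex_map p (T j) \<sigma>"
  have j: "j \<in> sym_index r" using jk sym_index_pos by blast
  have \<sigma>': "singular_simplex p H ?\<sigma>'" using \<sigma> cont_T[OF j] by (rule singular_simplex_simplex_map)
  have proj: "simplex_map p \<pi> ?\<sigma>' = simplex_map p \<pi> \<sigma>"
  proof -
    have "simplex_map p \<pi> ?\<sigma>' = simplex_map p (\<pi> \<circ> T j) \<sigma>" by (simp add: simplex_map_compose)
    also have "\<dots> = simplex_map p \<pi> \<sigma>" by (rule simplex_map_eq[OF \<sigma>]) (simp add: \<pi>_T j)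
    finally show ?thesis .
  qed
  have b: "singular_simplex p H ?b" and w: "reduced_word r ?w" and bw: "simplex_map p (foldr T ?w) ?b = \<sigma>"
    using base_lift lift_word \<sigma> by auto
  show ?thesis
  proof (cases "\<exists>u. ?w = - j # u")
    case True
    then obtain u where u: "?w = - j # u" by blast
    have ru: "reduced_word r u" using w u by (simp add: reduced_word_Cons)
    have "simplex_map p (T j) (simplex_map p (T (- j)) (simplex_map p (foldr T u) ?b)) = simplex_map p (foldr T u) ?b"
      using ru by (intro simplex_map_T_uminus j simplex_word b) (simp add: reduced_word_def)
    then have *: "simplex_map p (foldr T u) ?b = ?\<sigma>'"
      using bw u simplex_map_word_Cons[of p "- j" u ?b] by simp
    then have "lift_word p ?\<sigma>' = u" using ru by (intro lift_word_eqI \<sigma>') (simp_all add: proj)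
    then show ?thesis using jk bw[unfolded u]
      by (auto simp: fox_derivative_def proj u simp del: foldr.simps)
  next
    case False
    then have red: "reduced_word r (j # ?w)" using w j by (cases ?w) (auto simp: reduced_word_Cons)
    then have "lift_word p ?\<sigma>' = j # ?w"
      by (intro lift_word_eqI \<sigma>') (simp_all only: proj simplex_map_word_Cons bw)
    then show ?thesis using jk bw by (auto simp: fox_derivative_def proj)
  qed
qed

text \<open>This is where freeness enters: the operators \<open>T j - 1\<close> are jointly injective, and the Fox
  derivatives recover the chains to which they were applied.\<close>

lemma fox_derivative_coinvariant:
  assumes "j \<in> {1..int r}" "k \<in> {1..int r}" "singular_chain p H c"
  shows "fox_derivative p k (chain_map p (T j) c - c) = (if j = k then c else 0)"
  using assms(3) unfolding singular_chain_def
proof (induction c rule: frag_induction)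
  case (one \<sigma>)
  then show ?case using fox_derivative_generator[OF assms(1,2), of p \<sigma>]
    by (simp add: fox_derivative_linear)
next
  case (diff a b)
  have "chain_map p (T j) (a - b) - (a - b) = (chain_map p (T j) a - a) - (chain_map p (T j) b - b)"
    by (simp add: chain_map_diff)
  then show ?case using diff by (simp only: fox_derivative_linear) simp
qed (simp add: fox_derivative_linear)

lemma fox_fundamental:
  assumes "set w \<subseteq> sym_index r" and \<sigma>: "singular_simplex p H \<sigma>"
  shows "frag_of (simplex_map p (foldr T w) \<sigma>) - frag_of \<sigma> =
           (\<Sum>j\<in>{1..int r}. chain_map p (T j) (fox p j \<sigma> w) - fox p j \<sigma> w)"
  using assms(1)
proof (induction w)
  case Nil
  have "simplex_map p id \<sigma> = \<sigma>" using \<sigma> by (intro simplex_map_id_gen) auto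
  then show ?case by (simp add: id_def)
next
  case (Cons i w)
  define u where "u = simplex_map p (foldr T w) \<sigma>"
  have u: "singular_simplex p H u" unfolding u_def using Cons.prems by (intro simplex_word \<sigma>) auto
  have i: "i \<in> sym_index r" using Cons.prems by simp
  define a where "a j = (if i = j then frag_of u else if i = - j then - frag_of (simplex_map p (T i) u) else 0)" for j
  have fox: "fox p j \<sigma> (i # w) = a j + fox p j \<sigma> w" for j
    unfolding fox.simps a_def u_def simplex_map_word_Cons by simp
  have "(\<Sum>j\<in>{1..int r}. chain_map p (T j) (a j) - a j) = (\<Sum>j\<in>{\<bar>i\<bar>}. chain_map p (T j) (a j) - a j)"
    using i by (intro sum.mono_neutral_right) (auto simp: a_def sym_index_def abs_if)
  also have "\<dots> = frag_of (simplex_map p (T i) u) - frag_of u"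
  proof (cases "i > 0")
    case False
    then have "\<bar>i\<bar> = - i" "i \<noteq> - i" using i by (auto simp: sym_index_def)
    then show ?thesis
      using simplex_map_T_uminus[OF _ u, of "- i"] i by (simp add: a_def chain_map_minus)
  qed (simp add: a_def)
  finally have a: "(\<Sum>j\<in>{1..int r}. chain_map p (T j) (a j) - a j) = frag_of (simplex_map p (T i) u) - frag_of u" .
  have "(\<Sum>j\<in>{1..int r}. chain_map p (T j) (fox p j \<sigma> (i # w)) - fox p j \<sigma> (i # w))
     = (\<Sum>j\<in>{1..int r}. (chain_map p (T j) (a j) - a j) + (chain_map p (T j) (fox p j \<sigma> w) - fox p j \<sigma> w))"
    by (rule sum.cong) (simp_all only: fox chain_map_add, simp)
  also have "\<dots> = (frag_of (simplex_map p (T i) u) - frag_of u) + (frag_of u - frag_of \<sigma>)"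
    unfolding sum.distrib a using Cons by (simp add: u_def)
  finally show ?case by (simp only: simplex_map_word_Cons u_def) simp
qed

text \<open>Subtracting from every simplex the origin of its orbit gives a combination of the \<open>T j - 1\<close>;
  the origins cancel exactly when the projection vanishes.\<close>

lemma kernel_projection:
  assumes "singular_chain p H c" "chain_map p \<pi> c = 0"
  shows "c = (\<Sum>j\<in>{1..int r}. chain_map p (T j) (fox_derivative p j c) - fox_derivative p j c)"
proof -
  have "c - frag_extend (frag_of \<circ> base_lift p) (chain_map p \<pi> c)
       = (\<Sum>j\<in>{1..int r}. chain_map p (T j) (fox_derivative p j c) - fox_derivative p j c)"
    using assms(1) unfolding singular_chain_def
  proof (induction c rule: frag_induction)
    case (one \<sigma>)
    then have \<sigma>: "singular_simplex p H \<sigma>" by simp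
    then have "set (lift_word p \<sigma>) \<subseteq> sym_index r" using lift_word(1) by (simp add: reduced_word_def)
    from fox_fundamental[OF this base_lift(1)[OF \<sigma>]] lift_word(2)[OF \<sigma>]
    show ?case by (simp add: fox_derivative_def)
  next
    case (diff a b)
    let ?e = "\<lambda>c. frag_extend (frag_of \<circ> base_lift p) (chain_map p \<pi> c)"
    have "a - b - ?e (a - b) = (a - ?e a) - (b - ?e b)"
      by (simp add: chain_map_diff frag_extend_diff)
    also have "\<dots> = (\<Sum>j\<in>{1..int r}. (chain_map p (T j) (fox_derivative p j a) - fox_derivative p j a)
                      - (chain_map p (T j) (fox_derivative p j b) - fox_derivative p j b))"
      unfolding diff sum_subtractf ..
    also have "\<dots> = (\<Sum>j\<in>{1..int r}. chain_map p (T j) (fox_derivative p j (a - b)) - fox_derivative p j (a - b))"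
      by (rule sum.cong) (simp_all only: fox_derivative_linear chain_map_diff, simp)
    finally show ?case .
  qed (simp add: fox_derivative_linear)
  then show ?thesis using assms(2) by simp
qed

end

lemma frag_cmul_diff: "frag_cmul k (a - b) = frag_cmul k a - frag_cmul k b"
  by (rule poly_mapping_eqI) (simp add: lookup_minus right_diff_distrib)

lemma homologous_bounds:
  "\<lbrakk>singular_relboundary p X S d; homologous_rel p X S c d\<rbrakk> \<Longrightarrow> singular_relboundary p X S c"
  unfolding homologous_rel_def using singular_relboundary_add[of p X S "c - d" d] by simp

context free_quotient
begin

subsection \<open>Homology of the quotient\<close>

lemma cycle_bounds_upstairs:
  assumes "singular_relcycle p H {} c" "p \<noteq> 0"
  shows "singular_relboundary p H {} c"
proof -
  have "trivial_group (reduced_homology_group (int p) H)"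
    using contractible by (rule trivial_reduced_homology_group_contractible_space)
  then have "trivial_group (homology_group (int p) H)"
    using assms(2) by (simp add: un_reduced_homology_group)
  then have "homologous_rel_set p H {} c = \<one>\<^bsub>homology_group (int p) H\<^esub>"
    using assms(1) unfolding trivial_group_def
    by (metis carrier_relative_homology_group imageI mem_Collect_eq singletonD)
  then show ?thesis by (simp add: homologous_rel_set_eq_relboundary)
qed

definition augmentation :: "'b chain \<Rightarrow> int" where
  "augmentation c = Poly_Mapping.lookup (frag_extend (\<lambda>_. frag_of ()) c) ()"

lemma augmentation_linear:
  "augmentation 0 = 0" "augmentation (frag_of \<sigma>) = 1"
  "augmentation (a - b) = augmentation a - augmentation b"
  "augmentation (frag_cmul k a) = k * augmentation a"
  "finite I \<Longrightarrow> augmentation (\<Sum>i\<in>I. g i) = (\<Sum>i\<in>I. augmentation (g i))"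
  by (auto simp: augmentation_def frag_extend_diff frag_extend_cmul frag_extend_sum lookup_minus lookup_sum)

text \<open>In a path-connected space every point is homologous to a fixed one.\<close>

lemma zero_augmentation_bounds:
  assumes c: "singular_chain 0 H c" and "augmentation c = 0"
  shows "singular_relboundary 0 H {} c"
proof (cases "topspace H = {}")
  case True
  then show ?thesis using c by (simp add: singular_chain_empty)
next
  case False
  then obtain a where a: "a \<in> topspace H" by blast
  let ?s = "restrict (\<lambda>_. a) (standard_simplex 0)"
  have s: "singular_simplex 0 H ?s" using a by (simp add: singular_simplex_def)
  have pc: "path_connected_space H" by (rule contractible_imp_path_connected_space[OF contractible])
  have "homologous_rel 0 H {} c (frag_cmul (augmentation c) (frag_of ?s))"
    using c unfolding singular_chain_def
  proof (induction c rule: frag_induction)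
    case (one \<sigma>)
    then have "homologous_rel 0 H {} (frag_of \<sigma>) (frag_of ?s)"
      using iso_integer_zeroth_homology_group_aux[OF pc _ s] by blast
    then show ?case by (simp only: augmentation_linear frag_cmul_one)
  next
    case (diff a b)
    then show ?case using homologous_rel_diff by (force simp: augmentation_linear frag_cmul_diff_distrib)
  qed (simp add: augmentation_linear)
  then show ?thesis using assms(2) by (simp add: homologous_rel_def)
qed

lemma lift_cycle:
  assumes "singular_relcycle p X {} z"
  shows "\<exists>c. singular_chain p H c \<and> homologous_rel p X {} z (chain_map p \<pi> c)"
proof -
  let ?C = "{U. openin X U \<and> (\<exists>s. continuous_map (subtopology X U) H s \<and> (\<forall>y\<in>U. \<pi> (s y) = y))}"
  have "topspace X \<subseteq> \<Union>?C" using local_section by (fastforce intro!: subsetI)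
  then obtain z' where z': "singular_relcycle p X {} z'" "homologous_rel p X {} z z'"
    and small: "\<And>f. f \<in> Poly_Mapping.keys z' \<Longrightarrow> \<exists>V\<in>?C. f \<in> standard_simplex p \<rightarrow> V"
    using small_homologous_rel_relcycle_exists[of ?C X p "{}" z] assms by blast
  have "\<exists>\<sigma>. singular_simplex p H \<sigma> \<and> simplex_map p \<pi> \<sigma> = f" if f: "f \<in> Poly_Mapping.keys z'" for f
  proof -
    obtain V s where V: "f \<in> standard_simplex p \<rightarrow> V" "continuous_map (subtopology X V) H s"
      "\<And>y. y \<in> V \<Longrightarrow> \<pi> (s y) = y" using small[OF f] by blast
    have fs: "singular_simplex p X f"
      using f z'(1) by (auto simp: singular_relcycle_def singular_chain_def)
    then have "singular_simplex p (subtopology X V) f" using V(1) by (auto simp: singular_simplex_subtopology)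
    then have "singular_simplex p H (simplex_map p s f)" using V(2) by (rule singular_simplex_simplex_map)
    moreover have "simplex_map p \<pi> (simplex_map p s f) = f"
    proof
      fix x show "simplex_map p \<pi> (simplex_map p s f) x = f x"
        using V(1,3) fs
        by (cases "x \<in> standard_simplex p") (auto simp: simplex_map_def singular_simplex_def extensional_def)
    qed
    ultimately show ?thesis by blast
  qed
  then obtain L where L: "\<And>f. f \<in> Poly_Mapping.keys z' \<Longrightarrow> singular_simplex p H (L f) \<and> simplex_map p \<pi> (L f) = f"
    by metis
  let ?c = "frag_extend (frag_of \<circ> L) z'"
  have "singular_chain p H ?c"
    by (rule singular_chain_extend) (simp add: L singular_chain_of)
  moreover have "chain_map p \<pi> ?c = z'"
  proof -
    have "chain_map p \<pi> ?c = frag_extend (\<lambda>f. frag_of (simplex_map p \<pi> (L f))) z'"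
      unfolding chain_map_def frag_extend_compose by (simp add: comp_def)
    also have "\<dots> = frag_extend frag_of z'" by (rule frag_extend_eq) (simp add: L)
    finally show ?thesis by (simp flip: frag_expansion)
  qed
  ultimately show ?thesis using z'(2) by metis
qed

text \<open>A lift of a cycle has a boundary in the kernel of the projection. If all Fox derivatives of
  that boundary bound, the lift can be corrected to a cycle of the contractible space
  \<open>H\<close> without changing its projection.\<close>

lemma projection_bounds:
  assumes c: "singular_chain (Suc p) H c"
    and 0: "chain_map p \<pi> (chain_boundary (Suc p) c) = 0"
    and b: "\<And>j. j \<in> {1..int r} \<Longrightarrow>
       singular_relboundary p H {} (fox_derivative p j (chain_boundary (Suc p) c))"
  shows "singular_relboundary (Suc p) X {} (chain_map (Suc p) \<pi> c)"
proof -
  let ?I = "{1..int r}" and ?q = "Suc p"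
  let ?b = "\<lambda>j. fox_derivative p j (chain_boundary ?q c)"
  obtain e where e: "\<And>j. j \<in> ?I \<Longrightarrow> singular_chain ?q H (e j)"
    "\<And>j. j \<in> ?I \<Longrightarrow> chain_boundary ?q (e j) = ?b j"
    using b unfolding singular_boundary by metis
  define d where "d = c - (\<Sum>j\<in>?I. chain_map ?q (T j) (e j) - e j)"
  have Te: "singular_chain ?q H (chain_map ?q (T j) (e j) - e j)" if "j \<in> ?I" for j
    by (intro singular_chain_diff singular_chain_chain_map[OF e(1) cont_T] e(1) that sym_index_pos[OF that])
  have d: "singular_chain ?q H d"
    unfolding d_def by (rule singular_chain_diff[OF c singular_chain_sum[OF Te]])
  have "chain_boundary ?q c = (\<Sum>j\<in>?I. chain_map p (T j) (?b j) - ?b j)"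
    using kernel_projection[OF _ 0] singular_chain_boundary[OF c] by simp
  also have "\<dots> = (\<Sum>j\<in>?I. chain_boundary ?q (chain_map ?q (T j) (e j) - e j))"
    by (rule sum.cong) (simp_all add: chain_boundary_diff chain_boundary_chain_map[OF e(1)] e(2))
  finally have "chain_boundary ?q d = 0"
    unfolding d_def chain_boundary_diff chain_boundary_sum comp_def by simp
  then have "singular_relboundary ?q H {} d"
    using d by (intro cycle_bounds_upstairs) (auto simp: singular_cycle)
  then have "singular_relboundary ?q X {} (chain_map ?q \<pi> d)"
    by (rule singular_relboundary_chain_map[OF _ cont_\<pi>]) simp
  moreover have "chain_map ?q \<pi> (chain_map ?q (T j) (e j)) = chain_map ?q \<pi> (e j)" if j: "j \<in> ?I" for j
  proof -
    have "chain_map ?q (\<pi> \<circ> T j) (e j) = chain_map ?q \<pi> (e j)"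
      by (rule chain_map_eq[OF e(1)[OF j]]) (use j sym_index_pos in \<open>auto simp: \<pi>_T\<close>)
    then show ?thesis by (simp add: chain_map_compose)
  qed
  then have "chain_map ?q \<pi> d = chain_map ?q \<pi> c"
    unfolding d_def by (simp add: chain_map_diff chain_map_sum)
  ultimately show ?thesis by simp
qed

lemma projected_boundary_zero:
  assumes "singular_relcycle p X {} z" "singular_chain p H c" "homologous_rel p X {} z (chain_map p \<pi> c)"
  shows "chain_map (p - Suc 0) \<pi> (chain_boundary p c) = 0"
proof -
  have "singular_relcycle p X {} (chain_map p \<pi> c)"
    using assms homologous_rel_singular_relcycle by blast
  then show ?thesis unfolding singular_cycle chain_boundary_chain_map[OF assms(2)] by simp
qed

text \<open>The boundary of a lift of a cycle is \<open>\<Sum> (T j - 1) b\<^sub>j\<close>. Taking boundaries once more, the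
  injectivity of the \<open>T j - 1\<close> makes every \<open>b\<^sub>j\<close> a cycle, which bounds in the contractible space
  because its dimension is positive.\<close>

lemma betti_ge_2: "betti (Suc (Suc p)) X = 0"
proof -
  have "betti (Suc (Suc p)) X \<le> 0"
  proof (rule betti_le)
    fix B :: "'a chain set" and n :: "'a chain \<Rightarrow> int"
    let ?q = "Suc (Suc p)" and ?z = "\<Sum>z\<in>B. frag_cmul (n z) z"
    assume "finite B" "\<And>z. z \<in> B \<Longrightarrow> singular_relcycle ?q X {} z"
    then have z: "singular_relcycle ?q X {} ?z"
      by (intro singular_relcycle_sum singular_relcycle_cmul)
    then obtain c where c: "singular_chain ?q H c" "homologous_rel ?q X {} ?z (chain_map ?q \<pi> c)"
      using lift_cycle by blast
    let ?d = "chain_boundary ?q c"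
    have d: "singular_chain (Suc p) H ?d" using singular_chain_boundary[OF c(1)] by simp
    have 0: "chain_map (Suc p) \<pi> ?d = 0" using projected_boundary_zero[OF z c] by simp
    have "singular_relboundary (Suc p) H {} (fox_derivative (Suc p) k ?d)" if k: "k \<in> {1..int r}" for k
    proof -
      let ?b = "\<lambda>j. fox_derivative (Suc p) j ?d"
      have b: "singular_chain (Suc p) H (?b j)" for j using fox_derivative_chain[OF d] .
      have bb: "singular_chain p H (chain_boundary (Suc p) (?b j))" for j
        using singular_chain_boundary[OF b] by simp
      have "0 = chain_boundary (Suc p) ?d"
        using chain_boundary_boundary_alt[OF c(1)] by simp
      also have "?d = (\<Sum>j\<in>{1..int r}. chain_map (Suc p) (T j) (?b j) - ?b j)"
        by (rule kernel_projection[OF d 0])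
      also have "chain_boundary (Suc p) \<dots> =
        (\<Sum>j\<in>{1..int r}. chain_map p (T j) (chain_boundary (Suc p) (?b j)) - chain_boundary (Suc p) (?b j))"
        unfolding chain_boundary_sum comp_def chain_boundary_diff chain_boundary_chain_map[OF b] by simp
      finally have "0 = fox_derivative p k \<dots>" by (metis fox_derivative_linear(1))
      also have "\<dots> = (\<Sum>j\<in>{1..int r}. if j = k then chain_boundary (Suc p) (?b j) else 0)"
        unfolding fox_derivative_linear(4)[OF finite_atLeastAtMost_int]
        by (rule sum.cong) (use k bb in \<open>simp_all add: fox_derivative_coinvariant\<close>)
      also have "\<dots> = chain_boundary (Suc p) (?b k)" using k by simp
      finally have "singular_relcycle (Suc p) H {} (?b k)" using b by (simp add: singular_cycle)
      then show ?thesis by (rule cycle_bounds_upstairs) simp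
    qed
    then have "singular_relboundary ?q X {} (chain_map ?q \<pi> c)"
      using projection_bounds[OF c(1) 0] by blast
    then show "singular_relboundary ?q X {} ?z"
      using c(2) by (rule homologous_bounds)
  qed
  then show ?thesis by simp
qed

text \<open>For a one-dimensional cycle the chains \<open>b\<^sub>j\<close> have dimension 0 and bound when their augmentations
  vanish, so the \<open>r\<close> augmentations are the integer vector that controls the rank.\<close>

lemma betti_1_le: "betti 1 X \<le> r"
proof -
  define L where "L z = (SOME c. singular_chain 1 H c \<and> homologous_rel 1 X {} z (chain_map 1 \<pi> c))" for z
  have L: "singular_chain 1 H (L z)" "homologous_rel 1 X {} z (chain_map 1 \<pi> (L z))"
    if "singular_relcycle 1 X {} z" for z
    using someI_ex[OF lift_cycle[OF that]] by (auto simp: L_def)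
  \<comment> \<open>Coordinates are numbered from 0, generators from 1.\<close>
  define v where "v z i = augmentation (fox_derivative 0 (int i + 1) (chain_boundary 1 (L z)))" for z i
  show ?thesis
  proof (rule betti_le)
    fix B :: "'a chain set" and n :: "'a chain \<Rightarrow> int"
    assume B: "finite B" "\<And>z. z \<in> B \<Longrightarrow> singular_relcycle 1 X {} z"
      and 0: "\<And>i. i < r \<Longrightarrow> (\<Sum>z\<in>B. n z * v z i) = 0"
    let ?z = "\<Sum>z\<in>B. frag_cmul (n z) z" and ?c = "\<Sum>z\<in>B. frag_cmul (n z) (L z)"
    have z: "singular_relcycle 1 X {} ?z"
      using B by (intro singular_relcycle_sum singular_relcycle_cmul)
    have c: "singular_chain 1 H ?c"
      by (intro singular_chain_sum singular_chain_cmul L(1) B(2))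
    have "homologous_rel 1 X {} (frag_cmul k z) (frag_cmul k (chain_map 1 \<pi> (L z)))" if "z \<in> B" for k z
      using singular_relboundary_cmul[of 1 X "{}" "z - chain_map 1 \<pi> (L z)" k] L(2)[OF B(2)[OF that]]
      by (simp only: homologous_rel_def frag_cmul_diff)
    then have "homologous_rel 1 X {} ?z (\<Sum>z\<in>B. frag_cmul (n z) (chain_map 1 \<pi> (L z)))"
      using B by (intro homologous_rel_sum) auto
    also have "(\<Sum>z\<in>B. frag_cmul (n z) (chain_map 1 \<pi> (L z))) = chain_map 1 \<pi> ?c"
      using B(1) by (simp add: chain_map_sum)
    finally have hom: "homologous_rel 1 X {} ?z (chain_map 1 \<pi> ?c)" .
    have "singular_relboundary 0 H {} (fox_derivative 0 j (chain_boundary (Suc 0) ?c))" if j: "j \<in> {1..int r}" for j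
    proof (rule zero_augmentation_bounds)
      show "singular_chain 0 H (fox_derivative 0 j (chain_boundary (Suc 0) ?c))"
        using singular_chain_boundary[OF c] by (intro fox_derivative_chain) simp
      have "chain_boundary (Suc 0) ?c = (\<Sum>z\<in>B. frag_cmul (n z) (chain_boundary 1 (L z)))"
        by (simp add: chain_boundary_sum comp_def chain_boundary_cmul)
      then have "augmentation (fox_derivative 0 j (chain_boundary (Suc 0) ?c)) = (\<Sum>z\<in>B. n z * v z (nat (j - 1)))"
        using B(1) j by (simp add: fox_derivative_linear augmentation_linear v_def)
      then show "augmentation (fox_derivative 0 j (chain_boundary (Suc 0) ?c)) = 0"
        using 0[of "nat (j - 1)"] j by auto
    qed
    moreover have "chain_map 0 \<pi> (chain_boundary (Suc 0) ?c) = 0"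
      using projected_boundary_zero[OF z c hom] by simp
    ultimately have "singular_relboundary 1 X {} (chain_map 1 \<pi> ?c)"
      using projection_bounds[of 0 ?c] c by simp
    then show "singular_relboundary 1 X {} ?z"
      using hom by (rule homologous_bounds)
  qed
qed

theorem euler_characteristic_ge:
  assumes "topspace H \<noteq> {}" "\<pi> ` topspace H = topspace X"
  shows "euler_characteristic X \<ge> 1 - int r"
proof -
  have "path_connectedin X (\<pi> ` topspace H)"
    using contractible_imp_path_connected_space[OF contractible]
    by (intro path_connectedin_continuous_map_image[OF cont_\<pi>]) (simp add: path_connectedin_topspace)
  then have "path_connected_space X" by (simp add: assms(2) path_connectedin_topspace)
  then have b0: "betti 0 X = 1" by (rule betti_0_path_connected) (use assms in auto)
  have "p = 0 \<or> p = 1" if "betti p X \<noteq> 0" for p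
    using that betti_ge_2[of "p - 2"] by (cases "p \<ge> 2") (auto simp: numeral_2_eq_2 Suc_diff_Suc)
  then have "{p. betti p X \<noteq> 0} \<subseteq> {0, 1}" by blast
  then have "euler_characteristic X = (\<Sum>p\<in>{0,1}. (-1) ^ p * int (betti p X))"
    unfolding euler_characteristic_def by (intro sum.mono_neutral_left) auto
  then show ?thesis using b0 betti_1_le by simp
qed

end

section \<open>Fractional linear transformations\<close>

lemma mat2_nth [simp]:
  "mat2 a b c d $ 1 $ 1 = a" "mat2 a b c d $ 1 $ 2 = b"
  "mat2 a b c d $ 2 $ 1 = c" "mat2 a b c d $ 2 $ 2 = d"
  by (simp_all add: mat2_def)

lemma matrix22_eq_iff:
  "(A :: real^2^2) = B \<longleftrightarrow> A$1$1 = B$1$1 \<and> A$1$2 = B$1$2 \<and> A$2$1 = B$2$1 \<and> A$2$2 = B$2$2"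
  by (auto simp: vec_eq_iff forall_2)

lemma matrix22_mult [simp]:
  fixes A B :: "real^2^2"
  shows "(A ** B)$i$j = A$i$1 * B$1$j + A$i$2 * B$2$j"
  by (simp add: matrix_matrix_mult_def sum_2)

lemma mat_1_nth [simp]:
  "(mat 1 :: real^2^2)$1$1 = 1" "(mat 1 :: real^2^2)$1$2 = 0"
  "(mat 1 :: real^2^2)$2$1 = 0" "(mat 1 :: real^2^2)$2$2 = 1"
  by (simp_all add: mat_def)

definition adj2 :: "real^2^2 \<Rightarrow> real^2^2" where
  "adj2 A = mat2 (A$2$2) (- (A$1$2)) (- (A$2$1)) (A$1$1)"

lemma adj2_nth [simp]:
  "adj2 A $ 1 $ 1 = A$2$2" "adj2 A $ 1 $ 2 = - (A$1$2)" "adj2 A $ 2 $ 1 = - (A$2$1)" "adj2 A $ 2 $ 2 = A$1$1"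
  by (simp_all add: adj2_def)

lemma det_adj2 [simp]: "det (adj2 A) = det A" by (simp add: det_2 algebra_simps)

lemma adj2_mult: "det A = 1 \<Longrightarrow> adj2 A ** A = mat 1" "det A = 1 \<Longrightarrow> A ** adj2 A = mat 1"
  by (auto simp: matrix22_eq_iff det_2 algebra_simps)

lemma group_SL2R: "group SL2R"
proof (rule groupI)
  fix A assume "A \<in> carrier SL2R"
  then show "\<exists>B\<in>carrier SL2R. B \<otimes>\<^bsub>SL2R\<^esub> A = \<one>\<^bsub>SL2R\<^esub>"
    by (intro bexI[of _ "adj2 A"]) (auto simp: SL2R_def adj2_mult)
qed (auto simp: SL2R_def det_mul matrix_mul_assoc)

lemma SL2R_sel [simp]: "A \<in> carrier SL2R \<longleftrightarrow> det A = 1" "A \<otimes>\<^bsub>SL2R\<^esub> B = A ** B" "\<one>\<^bsub>SL2R\<^esub> = mat 1"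
  by (auto simp: SL2R_def)

lemma det_uminus2 [simp]: "det (- A :: real^2^2) = det A" by (simp add: det_2)

lemma normal_pm_1: "{mat 1, - mat 1} \<lhd> SL2R"
proof (rule group.normal_invI[OF group_SL2R])
  have inv: "inv\<^bsub>SL2R\<^esub> (- mat 1) = - mat 1"
    by (rule group.inv_equality[OF group_SL2R]) (auto simp: matrix22_eq_iff)
  have inv1: "inv\<^bsub>SL2R\<^esub> (mat 1) = mat 1"
    by (rule group.inv_equality[OF group_SL2R]) auto
  have neg: "- mat 1 ** A = - A" for A :: "real^2^2" by (simp add: matrix22_eq_iff)
  show "subgroup {mat 1, - mat 1} SL2R"
    by (rule group.subgroupI[OF group_SL2R]) (auto simp: inv inv1 neg det_2)
  fix A B assume "B \<in> {mat 1, - mat 1 :: real^2^2}" "A \<in> carrier SL2R"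
  moreover have "A ** (- mat 1) ** inv\<^bsub>SL2R\<^esub> A = - (A ** inv\<^bsub>SL2R\<^esub> A)" for A
    by (simp add: matrix22_eq_iff)
  ultimately show "A \<otimes>\<^bsub>SL2R\<^esub> B \<otimes>\<^bsub>SL2R\<^esub> inv\<^bsub>SL2R\<^esub> A \<in> {mat 1, - mat 1}"
    using group.r_inv[OF group_SL2R] by auto
qed

interpretation PSL: group PSL2R
  unfolding PSL2R_def by (rule normal.factorgroup_is_group[OF normal_pm_1])

lemma psl_eq: "psl A = {A, - A}"
  by (auto simp: psl_def r_coset_def matrix22_eq_iff)

lemma carrier_PSL2R: "carrier PSL2R = psl ` {A. det A = 1}"
  by (auto simp: PSL2R_def carrier_FactGroup psl_def)

lemma psl_in_carrier [simp]: "det A = 1 \<Longrightarrow> psl A \<in> carrier PSL2R"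
  by (auto simp: carrier_PSL2R)

lemma PSL2R_cases:
  assumes "g \<in> carrier PSL2R" obtains A where "det A = 1" "g = psl A"
  using assms by (auto simp: carrier_PSL2R)

lemma psl_mult: "\<lbrakk>det A = 1; det B = 1\<rbrakk> \<Longrightarrow> psl A \<otimes>\<^bsub>PSL2R\<^esub> psl B = psl (A ** B)"
  using normal.rcos_sum[OF normal_pm_1, of A B] by (simp add: PSL2R_def psl_def)

lemma psl_one: "\<one>\<^bsub>PSL2R\<^esub> = psl (mat 1)"
  by (simp add: PSL2R_def psl_eq)

lemma psl_inv: "det A = 1 \<Longrightarrow> inv\<^bsub>PSL2R\<^esub> (psl A) = psl (adj2 A)"
  by (rule PSL.inv_equality) (auto simp: psl_mult psl_one adj2_mult)

lemma psl_eq_iff: "psl A = psl B \<longleftrightarrow> A = B \<or> A = - B"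
  by (auto simp: psl_eq doubleton_eq_iff)

lemma rep_psl: "rep (psl A) = A \<or> rep (psl A) = - A"
  using someI[of "\<lambda>x. x \<in> psl A" A] by (auto simp: rep_def psl_eq)

lemma moebius_uminus: "moebius (- A) = moebius A"
proof
  fix p show "moebius (- A) p = moebius A p"
  proof (cases p)
    case (Some z)
    let ?n = "of_real (A$1$1) * z + of_real (A$1$2)" and ?d = "of_real (A$2$1) * z + of_real (A$2$2)"
    have "of_real ((- A)$2$1) * z + of_real ((- A)$2$2) = - ?d"
      "of_real ((- A)$1$1) * z + of_real ((- A)$1$2) = - ?n" by simp_all
    then show ?thesis unfolding Some moebius.simps
      by (simp only: neg_equal_0_iff_equal minus_divide_divide)
  qed simp
qed

lemma act_psl: "act (psl A) = moebius A"
  using rep_psl[of A] by (auto simp: act_def moebius_uminus)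

text \<open>The point of the sphere with homogeneous coordinates \<open>(u, v)\<close>; in these coordinates the action is
  linear and the case distinctions at infinity disappear.\<close>

definition homog :: "complex \<Rightarrow> complex \<Rightarrow> complex option" where
  "homog u v = (if v = 0 then None else Some (u / v))"

lemma moebius_homog:
  assumes "det A = 1" "u \<noteq> 0 \<or> v \<noteq> 0"
  shows "moebius A (homog u v) =
    homog (of_real (A$1$1) * u + of_real (A$1$2) * v) (of_real (A$2$1) * u + of_real (A$2$2) * v)"
proof (cases "v = 0")
  case True then show ?thesis using assms by (auto simp: homog_def)
next
  case False
  then have "of_real (A$2$1) * (u / v) + of_real (A$2$2) = (of_real (A$2$1) * u + of_real (A$2$2) * v) / v"
    "of_real (A$1$1) * (u / v) + of_real (A$1$2) = (of_real (A$1$1) * u + of_real (A$1$2) * v) / v"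
    by (simp_all add: field_simps)
  then show ?thesis using False by (auto simp: homog_def)
qed

lemma homog_cases: obtains u v where "p = homog u v" "u \<noteq> 0 \<or> v \<noteq> 0"
proof (cases p)
  case None then show ?thesis using that[of 1 0] by (simp add: homog_def)
next
  case (Some z) then show ?thesis using that[of z 1] by (simp add: homog_def)
qed

lemma of_real_det2: "det (A :: real^2^2) = 1 \<Longrightarrow>
  complex_of_real (A$1$1) * of_real (A$2$2) - of_real (A$1$2) * of_real (A$2$1) = 1"
  by (simp add: det_2 flip: of_real_mult of_real_diff)

lemma linear_nonzero:
  fixes a b c d u v :: complex
  assumes "a * d - b * c = 1" "u \<noteq> 0 \<or> v \<noteq> 0"
  shows "a * u + b * v \<noteq> 0 \<or> c * u + d * v \<noteq> 0"
proof (rule ccontr)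
  assume "\<not> ?thesis"
  then have 0: "a * u + b * v = 0" "c * u + d * v = 0" by auto
  have "(a * d - b * c) * u = d * (a * u + b * v) - b * (c * u + d * v)"
    "(a * d - b * c) * v = a * (c * u + d * v) - c * (a * u + b * v)" by (simp_all add: algebra_simps)
  with 0 have "(a * d - b * c) * u = 0" "(a * d - b * c) * v = 0" by simp_all
  then show False using assms by simp
qed

lemma moebius_mult:
  assumes "det A = 1" "det B = 1"
  shows "moebius (A ** B) p = moebius A (moebius B p)"
proof -
  obtain u v where p: "p = homog u v" "u \<noteq> 0 \<or> v \<noteq> 0" by (rule homog_cases)
  have "det (A ** B) = 1" using assms by (simp add: det_mul)
  then show ?thesis
    using assms p linear_nonzero[OF of_real_det2[OF assms(2)] p(2)]
    by (simp add: moebius_homog) (simp add: algebra_simps)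
qed

lemma act_mult: "\<lbrakk>g \<in> carrier PSL2R; h \<in> carrier PSL2R\<rbrakk> \<Longrightarrow> act (g \<otimes>\<^bsub>PSL2R\<^esub> h) p = act g (act h p)"
  by (elim PSL2R_cases) (simp add: psl_mult act_psl moebius_mult)

lemma act_one [simp]: "act \<one>\<^bsub>PSL2R\<^esub> p = p"
  by (cases p) (auto simp: psl_one act_psl)

lemma act_inv: "g \<in> carrier PSL2R \<Longrightarrow> act (inv\<^bsub>PSL2R\<^esub> g) (act g p) = p"
  "g \<in> carrier PSL2R \<Longrightarrow> act g (act (inv\<^bsub>PSL2R\<^esub> g) p) = p"
  by (simp_all flip: act_mult)

section \<open>The hyperbolic plane\<close>

definition hact :: "(real^2^2) set \<Rightarrow> complex \<Rightarrow> complex" where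
  "hact g z = the (act g (Some z))"

abbreviation UHP :: "complex set" where "UHP \<equiv> upper_half_plane"

lemma in_UHP: "z \<in> UHP \<longleftrightarrow> Im z > 0" by (simp add: upper_half_plane_def)

lemma denominator_nonzero:
  assumes "det (A :: real^2^2) = 1" "z \<in> UHP"
  shows "of_real (A$2$1) * z + of_real (A$2$2) \<noteq> 0"
proof
  assume *: "of_real (A$2$1) * z + of_real (A$2$2) = 0"
  then have "Im (of_real (A$2$1) * z + of_real (A$2$2)) = 0" by simp
  then have "A$2$1 = 0" using assms(2) by (simp add: in_UHP)
  with * show False using assms(1) by (simp add: det_2)
qed

lemma hact_psl:
  assumes "det A = 1" "z \<in> UHP"
  shows "hact (psl A) z = (of_real (A$1$1) * z + of_real (A$1$2)) / (of_real (A$2$1) * z + of_real (A$2$2))"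
  using denominator_nonzero[OF assms] by (simp add: hact_def act_psl)

lemma Im_hact_psl:
  assumes "det A = 1" "z \<in> UHP"
  shows "Im (hact (psl A) z) = Im z / (cmod (of_real (A$2$1) * z + of_real (A$2$2)))\<^sup>2"
proof -
  let ?d = "of_real (A$2$1) * z + of_real (A$2$2)"
  have "hact (psl A) z = ((of_real (A$1$1) * z + of_real (A$1$2)) * cnj ?d) / (of_real ((cmod ?d)\<^sup>2))"
    unfolding hact_psl[OF assms] by (subst complex_div_cnj) simp
  then have "Im (hact (psl A) z) = Im ((of_real (A$1$1) * z + of_real (A$1$2)) * cnj ?d) / (cmod ?d)\<^sup>2"
    by (metis Im_divide_of_real)
  also have "Im ((of_real (A$1$1) * z + of_real (A$1$2)) * cnj ?d) = det A * Im z"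
    by (simp add: det_2 algebra_simps)
  finally show ?thesis using assms by simp
qed

lemma hact_UHP: "\<lbrakk>g \<in> carrier PSL2R; z \<in> UHP\<rbrakk> \<Longrightarrow> hact g z \<in> UHP"
  by (erule PSL2R_cases) (use denominator_nonzero in \<open>auto simp: in_UHP Im_hact_psl\<close>)

lemma act_Some: "\<lbrakk>g \<in> carrier PSL2R; z \<in> UHP\<rbrakk> \<Longrightarrow> act g (Some z) = Some (hact g z)"
  by (erule PSL2R_cases) (use denominator_nonzero in \<open>auto simp: hact_def act_psl\<close>)

lemma hact_mult:
  "\<lbrakk>g \<in> carrier PSL2R; h \<in> carrier PSL2R; z \<in> UHP\<rbrakk> \<Longrightarrow> hact (g \<otimes>\<^bsub>PSL2R\<^esub> h) z = hact g (hact h z)"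
  using act_mult[of g h "Some z"] by (simp add: act_Some hact_UHP)

lemma hact_one [simp]: "hact \<one>\<^bsub>PSL2R\<^esub> z = z" by (simp add: hact_def)

lemma hact_inv:
  assumes "g \<in> carrier PSL2R" "z \<in> UHP"
  shows "hact (inv\<^bsub>PSL2R\<^esub> g) (hact g z) = z" "hact g (hact (inv\<^bsub>PSL2R\<^esub> g) z) = z"
  using assms by (simp_all flip: hact_mult)

lemma hyp_dist_hact:
  assumes "g \<in> carrier PSL2R" "z \<in> UHP" "w \<in> UHP"
  shows "hyp_dist (hact g z) (hact g w) = hyp_dist z w"
proof -
  obtain A where A: "det A = 1" "g = psl A" using assms(1) by (rule PSL2R_cases)
  let ?a = "complex_of_real (A$1$1)" and ?b = "complex_of_real (A$1$2)"
    and ?c = "complex_of_real (A$2$1)" and ?d = "complex_of_real (A$2$2)"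
  have nz: "?c * z + ?d \<noteq> 0" "?c * w + ?d \<noteq> 0" using denominator_nonzero A assms by auto
  have "hact g z - hact g w = (?a * ?d - ?b * ?c) * (z - w) / ((?c * z + ?d) * (?c * w + ?d))"
    using nz by (simp add: A(2) hact_psl A(1) assms diff_frac_eq) (simp add: algebra_simps)
  then have "cmod (hact g z - hact g w) = cmod (z - w) / (cmod (?c * z + ?d) * cmod (?c * w + ?d))"
    using of_real_det2[OF A(1)] by (simp add: norm_divide norm_mult)
  moreover have cancel: "(t / (p * q))\<^sup>2 / (2 * (x / p\<^sup>2) * (y / q\<^sup>2)) = t\<^sup>2 / (2 * x * y)"
    if "p \<noteq> 0" "q \<noteq> 0" for t p q x y :: real
    using that by (cases "x = 0 \<or> y = 0") (auto simp: field_simps)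
  ultimately have "(cmod (hact g z - hact g w))\<^sup>2 / (2 * Im (hact g z) * Im (hact g w)) = (cmod (z - w))\<^sup>2 / (2 * Im z * Im w)"
    unfolding A(2) Im_hact_psl[OF A(1) assms(2)] Im_hact_psl[OF A(1) assms(3)]
    by (simp add: cancel[of "cmod (?c * z + ?d)" "cmod (?c * w + ?d)"] nz)
  then show ?thesis by (simp add: hyp_dist_def)
qed

lemma hyp_quot_nonneg: "\<lbrakk>z \<in> UHP; w \<in> UHP\<rbrakk> \<Longrightarrow> (cmod (z - w))\<^sup>2 / (2 * Im z * Im w) \<ge> 0"
  by (simp add: in_UHP)

lemma cosh_hyp_dist:
  "\<lbrakk>z \<in> UHP; w \<in> UHP\<rbrakk> \<Longrightarrow> cosh (hyp_dist z w) = 1 + (cmod (z - w))\<^sup>2 / (2 * Im z * Im w)"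
  using hyp_quot_nonneg[of z w] by (simp add: hyp_dist_def)

lemma hyp_dist_nonneg: "\<lbrakk>z \<in> UHP; w \<in> UHP\<rbrakk> \<Longrightarrow> hyp_dist z w \<ge> 0"
  using hyp_quot_nonneg[of z w] by (simp add: hyp_dist_def arcosh_nonneg_real)

lemma cosh_le_iff: "\<lbrakk>0 \<le> (x::real); 0 \<le> y\<rbrakk> \<Longrightarrow> cosh x \<le> cosh y \<longleftrightarrow> x \<le> y"
  using cosh_real_nonneg_le_iff by blast

lemma hyp_dist_less_iff:
  "\<lbrakk>z \<in> UHP; w \<in> UHP; e \<ge> 0\<rbrakk> \<Longrightarrow> hyp_dist z w < e \<longleftrightarrow> (cmod (z - w))\<^sup>2 / (2 * Im z * Im w) < cosh e - 1"
  using cosh_le_iff[of e "hyp_dist z w"] cosh_hyp_dist hyp_dist_nonneg by (smt (verit))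

text \<open>In the coordinates of the hyperboloid model, \<open>cosh\<close> of the distance is the Lorentz
  product, and the triangle inequality is the Cauchy--Schwarz inequality for the space-like parts.\<close>

lemma hyp_dist_triangle_i:
  assumes z: "z \<in> UHP" and w: "w \<in> UHP"
  shows "hyp_dist z w \<le> hyp_dist z \<i> + hyp_dist \<i> w"
proof -
  define X0 where "X0 z = ((Re z)\<^sup>2 + (Im z)\<^sup>2 + 1) / (2 * Im z)" for z
  define X1 where "X1 z = Re z / Im z" for z
  define X2 where "X2 z = ((Re z)\<^sup>2 + (Im z)\<^sup>2 - 1) / (2 * Im z)" for z
  have dist2: "(cmod (z - w))\<^sup>2 = (Re z - Re w)\<^sup>2 + (Im z - Im w)\<^sup>2" for z w
    by (simp add: cmod_power2)
  have i: "\<i> \<in> UHP" by (simp add: in_UHP)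
  have ci: "cosh (hyp_dist z \<i>) = X0 z" if "z \<in> UHP" for z
    using that unfolding cosh_hyp_dist[OF that i] X0_def dist2
    by (simp add: in_UHP field_simps power2_eq_square)
  have ci': "cosh (hyp_dist \<i> z) = X0 z" if "z \<in> UHP" for z
    using ci[OF that] by (simp add: hyp_dist_def norm_minus_commute mult_ac)
  have hyperboloid: "(X0 z)\<^sup>2 - ((X1 z)\<^sup>2 + (X2 z)\<^sup>2) = 1" if "z \<in> UHP" for z
    using that unfolding X0_def X1_def X2_def in_UHP
    by (simp add: field_simps power2_eq_square)
  have sh: "sinh (hyp_dist z \<i>) = sqrt ((X1 z)\<^sup>2 + (X2 z)\<^sup>2)"
  proof -
    have "(sinh (hyp_dist z \<i>))\<^sup>2 = (X1 z)\<^sup>2 + (X2 z)\<^sup>2"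
      using hyperboloid[OF z] ci[OF z] cosh_square_eq[of "hyp_dist z \<i>"] by simp
    then show ?thesis using hyp_dist_nonneg[OF z i] by (metis abs_of_nonneg real_sqrt_abs sinh_real_nonneg_iff)
  qed
  have sh': "sinh (hyp_dist \<i> w) = sqrt ((X1 w)\<^sup>2 + (X2 w)\<^sup>2)"
  proof -
    have "(sinh (hyp_dist \<i> w))\<^sup>2 = (X1 w)\<^sup>2 + (X2 w)\<^sup>2"
      using hyperboloid[OF w] ci'[OF w] cosh_square_eq[of "hyp_dist \<i> w"] by simp
    then show ?thesis using hyp_dist_nonneg[OF i w] by (metis abs_of_nonneg real_sqrt_abs sinh_real_nonneg_iff)
  qed
  have "cosh (hyp_dist z w) = X0 z * X0 w - (X1 z * X1 w + X2 z * X2 w)"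
    using z w unfolding cosh_hyp_dist[OF z w] X0_def X1_def X2_def dist2
    by (simp add: in_UHP field_simps power2_eq_square)
  also have "\<dots> \<le> X0 z * X0 w + sqrt ((X1 z)\<^sup>2 + (X2 z)\<^sup>2) * sqrt ((X1 w)\<^sup>2 + (X2 w)\<^sup>2)"
  proof -
    have "(X1 z * X1 w + X2 z * X2 w)\<^sup>2 \<le> ((X1 z)\<^sup>2 + (X2 z)\<^sup>2) * ((X1 w)\<^sup>2 + (X2 w)\<^sup>2)"
      using sum_squares_ge_zero[of "X1 z * X2 w - X2 z * X1 w" 0] by (simp add: power2_eq_square algebra_simps)
    then have "\<bar>X1 z * X1 w + X2 z * X2 w\<bar> \<le> sqrt (((X1 z)\<^sup>2 + (X2 z)\<^sup>2) * ((X1 w)\<^sup>2 + (X2 w)\<^sup>2))"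
      by (metis real_sqrt_abs real_sqrt_le_iff)
    then show ?thesis by (simp add: real_sqrt_mult)
  qed
  also have "\<dots> = cosh (hyp_dist z \<i> + hyp_dist \<i> w)"
    by (simp add: cosh_add ci z ci' w sh sh')
  finally show ?thesis using cosh_le_iff hyp_dist_nonneg z w i by simp
qed

lemma transitive_UHP:
  assumes "z \<in> UHP" obtains g where "g \<in> carrier PSL2R" "hact g z = \<i>"
proof -
  let ?s = "sqrt (Im z)"
  have pos: "?s > 0" using assms by (simp add: in_UHP)
  let ?A = "mat2 (1 / ?s) (- Re z / ?s) 0 ?s"
  have d: "det ?A = 1" using pos by (simp add: det_2)
  have "hact (psl ?A) z = (z - of_real (Re z)) / of_real (?s * ?s)"
    unfolding hact_psl[OF d assms] mat2_nth of_real_mult using pos by (simp add: diff_divide_distrib)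
  also have "\<dots> = \<i>"
  proof -
    have "z - of_real (Re z) = \<i> * of_real (Im z)" "?s * ?s = Im z" "Im z \<noteq> 0"
      using assms by (auto simp: complex_eq_iff in_UHP)
    then show ?thesis by simp
  qed
  finally show ?thesis by (rule that[OF psl_in_carrier[OF d]])
qed


lemma hyp_dist_commute: "hyp_dist z w = hyp_dist w z"
  by (simp add: hyp_dist_def norm_minus_commute mult_ac)

lemma hyp_dist_triangle:
  assumes "x \<in> UHP" "y \<in> UHP" "z \<in> UHP"
  shows "hyp_dist x z \<le> hyp_dist x y + hyp_dist y z"
proof -
  obtain g where g: "g \<in> carrier PSL2R" "hact g y = \<i>" using transitive_UHP[OF assms(2)] .
  have "hyp_dist (hact g x) (hact g z) \<le> hyp_dist (hact g x) (hact g y) + hyp_dist (hact g y) (hact g z)"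
    unfolding g(2) by (rule hyp_dist_triangle_i) (auto intro: hact_UHP g assms)
  then show ?thesis unfolding hyp_dist_hact[OF g(1) assms(1) assms(3)]
      hyp_dist_hact[OF g(1) assms(1) assms(2)] hyp_dist_hact[OF g(1) assms(2) assms(3)] .
qed

lemma hyp_dist_zero_iff:
  assumes "z \<in> UHP" "w \<in> UHP" shows "hyp_dist z w = 0 \<longleftrightarrow> z = w"
proof
  assume "hyp_dist z w = 0"
  then have "(cmod (z - w))\<^sup>2 / (2 * Im z * Im w) = 0" using cosh_hyp_dist[OF assms] by simp
  then show "z = w" using assms by (simp add: in_UHP)
qed (simp add: hyp_dist_def)

text \<open>Together with its converse below this says that the hyperbolic metric induces the Euclidean topology.
  A point at Euclidean distance \<open>t\<close> from \<open>z\<close> has height at most \<open>y + t\<close>, and \<open>t\<^sup>2 / (y + t)\<close> increases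
  with \<open>t\<close>.\<close>

lemma hyp_ball_in_ball:
  assumes z: "z \<in> UHP" and e: "e > 0"
  obtains d where "d > 0" "\<And>w. \<lbrakk>w \<in> UHP; hyp_dist z w < d\<rbrakk> \<Longrightarrow> cmod (z - w) < e"
proof -
  let ?y = "Im z"
  have y: "?y > 0" using z by (simp add: in_UHP)
  define c where "c = e\<^sup>2 / (2 * ?y * (?y + e))"
  have c: "c > 0" using e y by (simp add: c_def)
  define d where "d = arcosh (1 + c)"
  have d2: "cosh d = 1 + c" and "d \<ge> 0" using c by (auto simp: d_def arcosh_nonneg_real)
  moreover have "d \<noteq> 0" using d2 c by auto
  ultimately have d: "d > 0" "cosh d = 1 + c" by auto
  have "cmod (z - w) < e" if w: "w \<in> UHP" "hyp_dist z w < d" for w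
  proof (rule ccontr)
    assume "\<not> cmod (z - w) < e"
    define t where "t = cmod (z - w)"
    have t: "t \<ge> e" using \<open>\<not> cmod (z - w) < e\<close> by (simp add: t_def)
    have "t\<^sup>2 / (2 * ?y * Im w) < c"
      using w hyp_dist_less_iff[OF z w(1), of d] d by (simp add: t_def)
    then have "t\<^sup>2 < c * (2 * ?y * Im w)" using w(1) y by (simp add: in_UHP field_simps)
    also have "Im w \<le> ?y + t" using abs_Im_le_cmod[of "z - w"] by (simp add: t_def)
    then have "c * (2 * ?y * Im w) \<le> c * (2 * ?y * (?y + t))" using c y by simp
    also have "\<dots> = e\<^sup>2 * (?y + t) / (?y + e)" using y e by (simp add: c_def)
    also have "\<dots> \<le> t\<^sup>2"
    proof -
      have "e * e \<le> t * t" "e * e * t \<le> t * t * e"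
        using t e mult_mono[of e t e t] mult_left_mono[of e t "e * t"] by (auto simp: mult_ac)
      moreover from this have "?y * (e * e) \<le> ?y * (t * t)" using y by (intro mult_left_mono) auto
      ultimately have "e\<^sup>2 * (?y + t) \<le> t\<^sup>2 * (?y + e)"
        by (simp add: power2_eq_square algebra_simps)
      then show ?thesis using y e by (simp add: pos_divide_le_eq)
    qed
    finally show False by simp
  qed
  then show ?thesis using that d(1) by blast
qed

lemma ball_in_hyp_ball:
  assumes z: "z \<in> UHP" and e: "e > 0"
  obtains d where "d > 0" "\<And>w. cmod (z - w) < d \<Longrightarrow> w \<in> UHP \<and> hyp_dist z w < e"
proof -
  let ?q = "\<lambda>w. (cmod (z - w))\<^sup>2 / (2 * Im z * Im w)"
  have y: "Im z > 0" using z by (simp add: in_UHP)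
  have "isCont ?q z" using y by (intro continuous_intros) auto
  then have "(?q \<longlongrightarrow> 0) (at z)" by (simp add: isCont_def)
  moreover have "cosh e - 1 > 0" using e cosh_real_nonneg_less_iff[of 0 e] by simp
  ultimately have "\<forall>\<^sub>F w in at z. ?q w < cosh e - 1" by (rule order_tendstoD)
  moreover have "\<forall>\<^sub>F w in at z. w \<in> UHP"
    using y unfolding in_UHP by (intro order_tendstoD[OF tendsto_Im[OF tendsto_ident_at]])
  ultimately have "\<forall>\<^sub>F w in at z. w \<in> UHP \<and> ?q w < cosh e - 1" by eventually_elim auto
  then obtain d where d: "d > 0" "\<And>w. \<lbrakk>w \<noteq> z; dist w z < d\<rbrakk> \<Longrightarrow> w \<in> UHP \<and> ?q w < cosh e - 1"
    unfolding eventually_at by auto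
  have "w \<in> UHP \<and> hyp_dist z w < e" if "cmod (z - w) < d" for w
  proof (cases "w = z")
    case True then show ?thesis using z e hyp_dist_zero_iff[OF z z] by simp
  next
    case False
    then have "w \<in> UHP" "?q w < cosh e - 1"
      using d(2)[of w] that by (auto simp: dist_norm norm_minus_commute)
    then show ?thesis using hyp_dist_less_iff[OF z, of w e] e by simp
  qed
  then show ?thesis using that d(1) by blast
qed

text \<open>With \<open>t\<close> the Euclidean distance of \<open>z\<close> and \<open>w\<close>, a bound on the hyperbolic distance gives
  \<open>t\<^sup>2 < A Im w\<close>. As \<open>Im w\<close> is between \<open>y - t\<close> and \<open>y + t\<close>, this bounds \<open>t\<close> from above and
  \<open>Im w\<close> away from 0.\<close>

lemma hyp_ball_compact:
  assumes z: "z \<in> UHP"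
  obtains K where "compact K" "K \<subseteq> UHP" "\<And>w. \<lbrakk>w \<in> UHP; hyp_dist z w < R\<rbrakk> \<Longrightarrow> w \<in> K"
proof -
  let ?y = "Im z"
  have y: "?y > 0" using z by (simp add: in_UHP)
  define C where "C = cosh R"
  have C: "C \<ge> 1" by (simp add: C_def cosh_real_ge_1)
  define A where "A = 2 * ?y * C"
  have A: "A > 0" using y C by (simp add: A_def)
  define K where "K = cball z (A + ?y) \<inter> {w. Im w \<ge> min (?y / 2) (?y\<^sup>2 / (4 * A))}"
  have "closed {w. Im w \<ge> min (?y / 2) (?y\<^sup>2 / (4 * A))}"
    by (intro closed_Collect_le continuous_intros)
  then have "compact K" unfolding K_def by (intro compact_Int_closed) auto
  moreover have "K \<subseteq> UHP"
  proof
    fix w assume "w \<in> K"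
    then have "Im w \<ge> min (?y / 2) (?y\<^sup>2 / (4 * A))" by (simp add: K_def)
    moreover have "min (?y / 2) (?y\<^sup>2 / (4 * A)) > 0" using y A by simp
    ultimately show "w \<in> UHP" unfolding in_UHP by (rule less_le_trans[rotated])
  qed
  moreover have "w \<in> K" if w: "w \<in> UHP" "hyp_dist z w < R" for w
  proof -
    define t where "t = cmod (z - w)"
    have R: "R > 0" using w hyp_dist_nonneg[OF z w(1)] by simp
    have v: "Im w > 0" using w by (simp add: in_UHP)
    have "t\<^sup>2 / (2 * ?y * Im w) < C"
      using w hyp_dist_less_iff[OF z w(1), of R] R by (simp add: t_def C_def)
    then have *: "t\<^sup>2 < A * Im w" using v y by (simp add: A_def field_simps)
    have Im: "\<bar>?y - Im w\<bar> \<le> t" using abs_Im_le_cmod[of "z - w"] by (simp add: t_def)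
    have "t \<le> A + ?y"
    proof (rule ccontr)
      assume t: "\<not> t \<le> A + ?y"
      have "t\<^sup>2 < A * (?y + t)" using * Im A by (smt (verit) mult_left_mono)
      also have "\<dots> \<le> ?y * t + A * t" using t y A mult_left_mono[of A t ?y] by (simp add: algebra_simps)
      also have "\<dots> \<le> t\<^sup>2" using t y A mult_right_mono[of "A + ?y" t t] by (simp add: power2_eq_square algebra_simps)
      finally show False by simp
    qed
    moreover have "Im w \<ge> ?y\<^sup>2 / (4 * A)" if "Im w < ?y / 2"
    proof -
      have "?y / 2 \<le> t" using that Im by simp
      then have "(?y / 2)\<^sup>2 \<le> t\<^sup>2" using y by (intro power_mono) auto
      then show ?thesis using * A by (simp add: power2_eq_square field_simps)
    qed
    ultimately show ?thesis unfolding K_def t_def by (fastforce simp: dist_norm min_le_iff_disj not_less)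
  qed
  ultimately show ?thesis using that by blast
qed

lemma separated_finite_in_ball:
  assumes z: "z \<in> UHP" and S: "S \<subseteq> UHP" and d: "d > 0"
    and sep: "\<And>x y. \<lbrakk>x \<in> S; y \<in> S; x \<noteq> y\<rbrakk> \<Longrightarrow> hyp_dist x y \<ge> d"
  shows "finite {w \<in> S. hyp_dist z w < R}"
proof (rule ccontr)
  let ?F = "{w \<in> S. hyp_dist z w < R}"
  assume inf: "infinite ?F"
  obtain K where K: "compact K" "K \<subseteq> UHP" "\<And>w. \<lbrakk>w \<in> UHP; hyp_dist z w < R\<rbrakk> \<Longrightarrow> w \<in> K"
    using hyp_ball_compact[OF z, of R] by blast
  have "?F \<subseteq> K" using K(3) S by auto
  then obtain x where x: "x \<in> K" "x islimpt ?F"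
    using K(1) inf unfolding compact_eq_Bolzano_Weierstrass by blast
  have xU: "x \<in> UHP" using x K by blast
  have d2: "d / 2 > 0" using d by simp
  obtain e where e: "e > 0" "\<And>w. cmod (x - w) < e \<Longrightarrow> w \<in> UHP \<and> hyp_dist x w < d / 2"
    using ball_in_hyp_ball[OF xU d2] by blast
  have "infinite (?F \<inter> ball x e)" using x(2) e(1) islimpt_eq_infinite_ball by blast
  then obtain u where u: "u \<in> ?F \<inter> ball x e" using infinite_imp_nonempty by blast
  from \<open>infinite (?F \<inter> ball x e)\<close> have "infinite (?F \<inter> ball x e - {u})" by simp
  then have "?F \<inter> ball x e - {u} \<noteq> {}" by (rule infinite_imp_nonempty)
  then obtain v where v: "v \<in> ?F \<inter> ball x e" "v \<noteq> u" by blast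
  have "hyp_dist x u < d / 2" "hyp_dist x v < d / 2" using e(2) u v by (auto simp: dist_norm)
  then have "hyp_dist u v < d"
    using hyp_dist_triangle[of u x v] u v S xU hyp_dist_commute[of u x] by fastforce
  then show False using sep[of u v] u v by auto
qed

section \<open>Disks orthogonal to the real line\<close>

text \<open>The disks orthogonal to the extended real line are the sets where a Hermitian form with real
  coefficients and positive discriminant \<open>b\<^sup>2 - a c\<close> is negative. The coefficient \<open>a\<close> is the value at
  infinity; only the sign of the values is meaningful on the sphere.\<close>

definition qform :: "real \<Rightarrow> real \<Rightarrow> real \<Rightarrow> complex option \<Rightarrow> real" where
  "qform a b c p = (case p of None \<Rightarrow> a | Some z \<Rightarrow> a * (cmod z)\<^sup>2 + 2 * b * Re z + c)"

lemma qform_simps [simp]: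
  "qform a b c None = a" "qform a b c (Some z) = a * (cmod z)\<^sup>2 + 2 * b * Re z + c"
  by (simp_all add: qform_def)

lemma qform_uminus: "qform (- a) (- b) (- c) p = - qform a b c p"
  by (cases p) auto

lemma qform_homog:
  assumes "u \<noteq> 0 \<or> v \<noteq> 0"
  shows "sgn (qform a b c (homog u v)) = sgn (a * (cmod u)\<^sup>2 + 2 * b * Re (u * cnj v) + c * (cmod v)\<^sup>2)"
proof (cases "v = 0")
  case True
  then show ?thesis using assms by (simp add: homog_def sgn_mult)
next
  case False
  then have nz: "(cmod v)\<^sup>2 > 0" by simp
  have gen: "a * U + 2 * b * R + c * N = N * (a * (U / N) + 2 * b * (R / N) + c)" if "N > 0" for U R N :: real
    using that by (simp add: field_simps)
  have "Re (u / v) = Re (u * cnj v) / (cmod v)\<^sup>2"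
    by (subst complex_div_cnj) (simp only: Re_divide_of_real)
  then have "qform a b c (Some (u / v)) = a * ((cmod u)\<^sup>2 / (cmod v)\<^sup>2) + 2 * b * (Re (u * cnj v) / (cmod v)\<^sup>2) + c"
    by (simp only: qform_simps norm_divide power_divide)
  then have "a * (cmod u)\<^sup>2 + 2 * b * Re (u * cnj v) + c * (cmod v)\<^sup>2 = (cmod v)\<^sup>2 * qform a b c (Some (u / v))"
    using gen[OF nz] by simp
  then show ?thesis using False nz by (simp add: homog_def sgn_mult)
qed

lemma qform_pullback:
  assumes A: "det A = 1" and disc: "b\<^sup>2 - a * c > 0"
  obtains a' b' c' where "b'\<^sup>2 - a' * c' > 0" "\<And>p. sgn (qform a b c (moebius A p)) = sgn (qform a' b' c' p)"
proof
  define \<alpha> \<beta> \<gamma> \<delta> where abcd: "\<alpha> = A$1$1" "\<beta> = A$1$2" "\<gamma> = A$2$1" "\<delta> = A$2$2"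
  have det: "\<alpha> * \<delta> - \<beta> * \<gamma> = 1" using A by (simp add: det_2 abcd)
  define a' where "a' = a * \<alpha>\<^sup>2 + 2 * b * \<alpha> * \<gamma> + c * \<gamma>\<^sup>2"
  define b' where "b' = a * \<alpha> * \<beta> + b * (\<alpha> * \<delta> + \<beta> * \<gamma>) + c * \<gamma> * \<delta>"
  define c' where "c' = a * \<beta>\<^sup>2 + 2 * b * \<beta> * \<delta> + c * \<delta>\<^sup>2"
  have "b'\<^sup>2 - a' * c' = (b\<^sup>2 - a * c) * (\<alpha> * \<delta> - \<beta> * \<gamma>)\<^sup>2"
    unfolding a'_def b'_def c'_def by (simp add: power2_eq_square algebra_simps)
  then show "b'\<^sup>2 - a' * c' > 0" using disc det by simp
  fix p
  obtain u v where p: "p = homog u v" "u \<noteq> 0 \<or> v \<noteq> 0" by (rule homog_cases)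
  let ?u = "of_real \<alpha> * u + of_real \<beta> * v" and ?v = "of_real \<gamma> * u + of_real \<delta> * v"
  have nz: "?u \<noteq> 0 \<or> ?v \<noteq> 0"
    using linear_nonzero[OF of_real_det2[OF A] p(2)] by (simp add: abcd)
  have "a * (cmod ?u)\<^sup>2 + 2 * b * Re (?u * cnj ?v) + c * (cmod ?v)\<^sup>2
     = a' * (cmod u)\<^sup>2 + 2 * b' * Re (u * cnj v) + c' * (cmod v)\<^sup>2"
    unfolding a'_def b'_def c'_def cmod_power2 by (simp add: power2_eq_square algebra_simps)
  then show "sgn (qform a b c (moebius A p)) = sgn (qform a' b' c' p)"
    unfolding p(1) moebius_homog[OF A p(2), folded abcd] qform_homog[OF p(2)] qform_homog[OF nz]
    by (rule arg_cong)
qed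

lemma sgn_eq_less_iff: "sgn (x::real) = sgn y \<Longrightarrow> (x < 0 \<longleftrightarrow> y < 0) \<and> (x \<le> 0 \<longleftrightarrow> y \<le> 0) \<and> (x = 0 \<longleftrightarrow> y = 0)"
  by (auto simp: sgn_if split: if_splits)

lemma real_centered_open_disk_qform:
  assumes "real_centered_open_disk E"
  obtains a b c where "b\<^sup>2 - a * c > 0" "E = {p. qform a b c p < 0}"
proof -
  obtain g x \<rho> where g: "g \<in> carrier PSL2R" and \<rho>: "\<rho> > 0"
    and E: "act g ` E = Some ` ball (complex_of_real x) \<rho>"
    using assms unfolding real_centered_open_disk_def by blast
  obtain A where A: "det A = 1" "g = psl A" using g by (rule PSL2R_cases)
  have ball: "p \<in> Some ` ball (complex_of_real x) \<rho> \<longleftrightarrow> qform 1 (- x) (x\<^sup>2 - \<rho>\<^sup>2) p < 0" for p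
  proof (cases p)
    case (Some z)
    have "z \<in> ball (complex_of_real x) \<rho> \<longleftrightarrow> (cmod (of_real x - z))\<^sup>2 < \<rho>\<^sup>2"
      using \<rho> power2_less_imp_less[of "cmod (of_real x - z)" \<rho>]
        power_strict_mono[of "cmod (of_real x - z)" \<rho> 2] by (auto simp: dist_norm)
    also have "(cmod (of_real x - z))\<^sup>2 = (cmod z)\<^sup>2 - 2 * x * Re z + x\<^sup>2"
      unfolding cmod_power2 by (simp add: power2_eq_square algebra_simps)
    finally show ?thesis using Some by auto
  qed auto
  have "p \<in> E \<longleftrightarrow> act g p \<in> act g ` E" for p
    using act_inv(1)[OF g] by (metis image_iff)
  then have p: "p \<in> E \<longleftrightarrow> qform 1 (- x) (x\<^sup>2 - \<rho>\<^sup>2) (moebius A p) < 0" for p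
    unfolding E ball by (simp add: A act_psl)
  have "(- x)\<^sup>2 - 1 * (x\<^sup>2 - \<rho>\<^sup>2) > 0" using \<rho> by simp
  then obtain a b c where "b\<^sup>2 - a * c > 0"
    "\<And>p. sgn (qform 1 (- x) (x\<^sup>2 - \<rho>\<^sup>2) (moebius A p)) = sgn (qform a b c p)"
    using qform_pullback[OF A(1)] by metis
  with p have "b\<^sup>2 - a * c > 0" "E = {p. qform a b c p < 0}"
    using sgn_eq_less_iff by blast+
  then show ?thesis using that by blast
qed

lemma openin_riemann_sphere_finite:
  assumes "openin riemann_sphere T" shows "open {w. Some w \<in> T}"
proof -
  from assms consider U where "open U" "T = Some ` U"
    | C where "compact C" "T = insert None (Some ` (- C))"
    unfolding riemann_sphere_def openin_Alexandroff_compactification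
    by (auto simp: Compl_eq_Diff_UNIV)
  then show ?thesis
  proof cases
    case 1 then have "{w. Some w \<in> T} = U" by auto
    with 1 show ?thesis by simp
  next
    case 2 then have "{w. Some w \<in> T} = - C" by auto
    with 2 show ?thesis by (simp add: compact_imp_closed open_Compl)
  qed
qed

lemma openin_riemann_sphere_infinity:
  assumes "openin riemann_sphere T" "None \<in> T"
  obtains M where "\<And>w. cmod w > M \<Longrightarrow> Some w \<in> T"
proof -
  from assms obtain C where C: "compact C" "T = insert None (Some ` (- C))"
    unfolding riemann_sphere_def openin_Alexandroff_compactification
    by (auto simp: Compl_eq_Diff_UNIV)
  then obtain M where "\<And>w. w \<in> C \<Longrightarrow> cmod w \<le> M" using compact_imp_bounded bounded_iff by metis
  then show ?thesis using that[of M] C by force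
qed

lemma topspace_riemann_sphere [simp]: "topspace riemann_sphere = UNIV"
proof -
  have "p \<in> topspace riemann_sphere" for p
    by (cases p) (auto simp: riemann_sphere_def)
  then show ?thesis by blast
qed

lemma continuous_on_qform: "continuous_on UNIV (\<lambda>z. qform a b c (Some z))"
  unfolding qform_simps by (intro continuous_intros)

lemma qform_near_infinity:
  assumes "a < 0" obtains M where "\<And>w. cmod w > M \<Longrightarrow> qform a b c (Some w) < 0"
proof
  fix w assume w: "cmod w > max 1 ((2 * \<bar>b\<bar> + \<bar>c\<bar>) / (- a))"
  then have "cmod w > 1" and "(2 * \<bar>b\<bar> + \<bar>c\<bar>) / (- a) < cmod w" by auto
  then have *: "2 * \<bar>b\<bar> + \<bar>c\<bar> < (- a) * cmod w" using assms by (simp add: field_simps)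
  have "b * Re w \<le> \<bar>b\<bar> * \<bar>Re w\<bar>" by (metis abs_ge_self abs_mult)
  also have "\<dots> \<le> \<bar>b\<bar> * cmod w" using abs_Re_le_cmod[of w] by (intro mult_left_mono) auto
  finally have "b * Re w \<le> \<bar>b\<bar> * cmod w" .
  moreover have "\<bar>c\<bar> * 1 \<le> \<bar>c\<bar> * cmod w" using \<open>cmod w > 1\<close> by (intro mult_left_mono) auto
  moreover have "(2 * \<bar>b\<bar> + \<bar>c\<bar>) * cmod w = 2 * (\<bar>b\<bar> * cmod w) + \<bar>c\<bar> * cmod w" by (simp add: algebra_simps)
  ultimately have "2 * b * Re w + c \<le> (2 * \<bar>b\<bar> + \<bar>c\<bar>) * cmod w" by linarith
  also have "\<dots> < (- a) * cmod w * cmod w" using * \<open>cmod w > 1\<close> by (intro mult_strict_right_mono) auto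
  finally show "qform a b c (Some w) < 0" by (simp add: power2_eq_square)
qed

lemma openin_qform: "openin riemann_sphere {p. qform a b c p < 0}"
proof (cases "a < 0")
  case True
  let ?C = "{z. qform a b c (Some z) \<ge> 0}"
  obtain M where M: "\<And>w. cmod w > M \<Longrightarrow> qform a b c (Some w) < 0" using qform_near_infinity[OF True] by blast
  have cl: "closed ?C" by (intro closed_Collect_le continuous_on_qform continuous_on_const)
  moreover have "bounded ?C" using M by (intro boundedI[of _ M]) (metis mem_Collect_eq not_le)
  ultimately have comp: "compact ?C" by (simp add: compact_eq_bounded_closed)
  have "{p. qform a b c p < 0} = insert None (Some ` (UNIV - ?C))"
  proof (rule Set.set_eqI)
    fix p show "p \<in> {p. qform a b c p < 0} \<longleftrightarrow> p \<in> insert None (Some ` (UNIV - ?C))"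
      using True by (cases p) auto
  qed
  with cl comp show ?thesis
    unfolding riemann_sphere_def openin_Alexandroff_compactification
    by (intro disjI2 exI[of _ ?C]) simp
next
  case False
  have "open {z. qform a b c (Some z) < 0}" by (intro open_Collect_less continuous_on_qform continuous_on_const)
  moreover have "{p. qform a b c p < 0} = Some ` {z. qform a b c (Some z) < 0}"
  proof (rule Set.set_eqI)
    fix p show "p \<in> {p. qform a b c p < 0} \<longleftrightarrow> p \<in> Some ` {z. qform a b c (Some z) < 0}"
      using False by (cases p) auto
  qed
  ultimately show ?thesis
    unfolding riemann_sphere_def openin_Alexandroff_compactification by auto
qed

text \<open>On the boundary circle the gradient of the form does not vanish.\<close>

lemma qform_negative_nearby:
  assumes disc: "b\<^sup>2 - a * c > 0" and 0: "qform a b c (Some z) = 0" and e: "e > 0"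
  obtains w where "cmod (w - z) < e" "qform a b c (Some w) < 0"
proof -
  define X Y where XY: "X = a * Re z + b" "Y = a * Im z"
  have q: "a * ((Re z)\<^sup>2 + (Im z)\<^sup>2) + 2 * b * Re z + c = 0" using 0 by (simp add: cmod_power2)
  have "X\<^sup>2 + Y\<^sup>2 = a * (a * ((Re z)\<^sup>2 + (Im z)\<^sup>2) + 2 * b * Re z + c) + (b\<^sup>2 - a * c)"
    by (simp add: XY power2_eq_square algebra_simps)
  then have G: "X\<^sup>2 + Y\<^sup>2 > 0" using q disc by simp
  define g where "g = sqrt (X\<^sup>2 + Y\<^sup>2)"
  have g: "g > 0" "g\<^sup>2 = X\<^sup>2 + Y\<^sup>2" using G by (auto simp: g_def)
  \<comment> \<open>The step against the gradient is short enough for the linear term to outweigh the quadratic one.\<close>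
  define t where "t = min (e / (2 * g)) (1 / (\<bar>a\<bar> + 1))"
  have t: "t > 0" "t \<le> e / (2 * g)" "t \<le> 1 / (\<bar>a\<bar> + 1)" using e g by (auto simp: t_def)
  define w where "w = z - of_real t * Complex X Y"
  have "cmod (w - z) = t * g" using t by (simp add: w_def norm_mult g_def complex_norm)
  also have "\<dots> \<le> e / 2" using t(2) g by (simp add: field_simps)
  finally have "cmod (w - z) < e" using e by simp
  moreover have "qform a b c (Some w) < 0"
  proof -
    have "qform a b c (Some w) = (a * ((Re z)\<^sup>2 + (Im z)\<^sup>2) + 2 * b * Re z + c) - 2 * t * (X * (a * Re z + b) + Y * (a * Im z)) + a * t\<^sup>2 * (X\<^sup>2 + Y\<^sup>2)"
      unfolding qform_simps cmod_power2 by (simp add: w_def power2_eq_square algebra_simps)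
    also have "\<dots> = - t * (X\<^sup>2 + Y\<^sup>2) * (2 - a * t)"
      using q by (simp flip: XY) (simp add: power2_eq_square algebra_simps)
    finally have *: "qform a b c (Some w) = - t * (X\<^sup>2 + Y\<^sup>2) * (2 - a * t)" .
    have "t * (\<bar>a\<bar> + 1) \<le> 1" using t(3) by (simp add: field_simps)
    moreover have "a * t \<le> \<bar>a\<bar> * t" using t(1) by (intro mult_right_mono) auto
    moreover have "t * (\<bar>a\<bar> + 1) = \<bar>a\<bar> * t + t" by (simp add: algebra_simps)
    ultimately have "a * t \<le> 1" using t(1) by linarith
    then have "t * (X\<^sup>2 + Y\<^sup>2) * (2 - a * t) > 0" using t(1) G by simp
    then show ?thesis using * by simp
  qed
  ultimately show ?thesis using that by blast
qed

lemma closure_of_qform: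
  assumes disc: "b\<^sup>2 - a * c > 0"
  shows "riemann_sphere closure_of {p. qform a b c p < 0} = {p. qform a b c p \<le> 0}"
proof (rule equalityI)
  have "closedin riemann_sphere {p. qform a b c p \<le> 0}"
  proof -
    have "UNIV - {p. qform a b c p \<le> 0} = {p. qform (- a) (- b) (- c) p < 0}"
      by (auto simp: qform_uminus)
    then show ?thesis using openin_qform by (simp add: closedin_def)
  qed
  then show "riemann_sphere closure_of {p. qform a b c p < 0} \<subseteq> {p. qform a b c p \<le> 0}"
    by (intro closure_of_minimal) auto
  show "{p. qform a b c p \<le> 0} \<subseteq> riemann_sphere closure_of {p. qform a b c p < 0}"
  proof
    fix p assume p: "p \<in> {p. qform a b c p \<le> 0}"
    show "p \<in> riemann_sphere closure_of {p. qform a b c p < 0}"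
      unfolding in_closure_of
    proof (intro conjI allI impI)
      fix T assume T: "p \<in> T \<and> openin riemann_sphere T"
      show "\<exists>y. y \<in> {p. qform a b c p < 0} \<and> y \<in> T"
      proof (cases "qform a b c p < 0")
        case False
        then have 0: "qform a b c p = 0" using p by simp
        show ?thesis
        proof (cases p)
          case None
          then have a: "a = 0" and b: "b\<^sup>2 > 0" using 0 disc by auto
          obtain M where M: "\<And>w. cmod w > M \<Longrightarrow> Some w \<in> T"
            using openin_riemann_sphere_infinity T None by metis
          define s where "s = max ((\<bar>M\<bar> + 1) / \<bar>b\<bar>) ((\<bar>c\<bar> + 1) / b\<^sup>2)"
          have b': "\<bar>b\<bar> > 0" using b by simp
          have "s \<ge> (\<bar>M\<bar> + 1) / \<bar>b\<bar>" "s \<ge> (\<bar>c\<bar> + 1) / b\<^sup>2" by (simp_all add: s_def)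
          then have "s * \<bar>b\<bar> \<ge> \<bar>M\<bar> + 1" "s * b\<^sup>2 \<ge> \<bar>c\<bar> + 1"
            using b b' by (simp_all add: pos_divide_le_eq)
          moreover from this have "s > 0" using b by (smt (verit) zero_less_mult_pos2)
          ultimately have "\<bar>s\<bar> * \<bar>b\<bar> > M" "c < 2 * (s * (b * b))"
            by (auto simp: power2_eq_square)
          then have "cmod (of_real (- s * b)) > M" "qform a b c (Some (of_real (- s * b))) < 0"
            using a by (auto simp: norm_mult power2_eq_square mult_ac simp del: of_real_mult)
          then show ?thesis using M by blast
        next
          case (Some z)
          have "open {w. Some w \<in> T}" "z \<in> {w. Some w \<in> T}"
            using T Some openin_riemann_sphere_finite by auto
          then obtain e where e: "e > 0" "\<And>w. cmod (w - z) < e \<Longrightarrow> Some w \<in> T"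
            unfolding open_dist dist_norm by blast
          then show ?thesis using qform_negative_nearby[OF disc 0[unfolded Some] e(1)] by blast
        qed
      qed (use T in blast)
    qed auto
  qed
qed

section \<open>Schottky groups\<close>

lemma convex_UHP: "convex UHP"
proof -
  have "UHP = {z. Im z > 0}" by (simp add: upper_half_plane_def)
  then show ?thesis using convex_halfspace_Im_gt[of 0] by simp
qed

locale schottky =
  fixes \<Gamma> :: "(real^2^2) set set" and r :: nat
    and D :: "int \<Rightarrow> complex option set" and S :: "int \<Rightarrow> (real^2^2) set"
  assumes data: "schottky_data \<Gamma> r D S"
begin

abbreviation I where "I \<equiv> sym_index r"
abbreviation K where "K i \<equiv> riemann_sphere closure_of D i"
abbreviation T where "T i \<equiv> hact (S i)"

lemma r_pos: "r \<ge> 1" using data by (simp add: schottky_data_def)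

lemma finite_I: "finite I"
  by (rule finite_subset[of _ "{- int r..int r}"]) (auto simp: sym_index_def)

lemma K_disjoint: "\<lbrakk>i \<in> I; j \<in> I; i \<noteq> j\<rbrakk> \<Longrightarrow> K i \<inter> K j = {}"
  using data by (simp add: schottky_data_def)

lemma D_subset_K: "D i \<subseteq> K i"
  using closure_of_subset[of "D i" riemann_sphere] by simp

lemma I_cases: assumes "i \<in> I" obtains "i \<in> {1..int r}" | "- i \<in> {1..int r}"
  using assms by (fastforce simp: sym_index_def abs_if split: if_splits)

lemma S_uminus: assumes "i \<in> I" shows "S i \<in> carrier PSL2R" "S (- i) = inv\<^bsub>PSL2R\<^esub> (S i)"
proof -
  have *: "S j \<in> carrier PSL2R" "S (- j) = inv\<^bsub>PSL2R\<^esub> (S j)" if "j \<in> {1..int r}" for j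
    using data that by (auto simp: schottky_data_def)
  show "S i \<in> carrier PSL2R" "S (- i) = inv\<^bsub>PSL2R\<^esub> (S i)"
    using assms by (cases rule: I_cases; use *[of i] *[of "- i"] in force)+
qed

lemma S_carrier [simp]: "i \<in> I \<Longrightarrow> S i \<in> carrier PSL2R" by (rule S_uminus)

lemma D_qform:
  assumes "i \<in> I"
  shows "\<exists>a b c. b\<^sup>2 - a * c > 0 \<and> D i = {p. qform a b c p < 0} \<and> K i = {p. qform a b c p \<le> 0}"
proof -
  have "real_centered_open_disk (D i)" using data assms by (simp add: schottky_data_def)
  then obtain a b c where "b\<^sup>2 - a * c > 0" "D i = {p. qform a b c p < 0}"
    by (rule real_centered_open_disk_qform)
  moreover from this have "K i = {p. qform a b c p \<le> 0}" by (simp add: closure_of_qform)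
  ultimately show ?thesis by blast
qed

text \<open>Stated for the closed disks this inclusion holds alike for a generator and for its inverse.\<close>

lemma act_outside_K:
  assumes i: "i \<in> I" and p: "p \<notin> K i" shows "act (S i) p \<in> K (- i)"
proof -
  have *: "act (S j) ` (- K j) = D (- j)" if "j \<in> {1..int r}" for j
    using data that by (simp add: schottky_data_def)
  from i show ?thesis
  proof (cases rule: I_cases)
    case 1
    then show ?thesis using *[OF 1] p D_subset_K by blast
  next
    case 2
    show ?thesis
    proof (rule ccontr)
      assume "act (S i) p \<notin> K (- i)"
      then have "act (S (- i)) (act (S i) p) \<in> D i" using *[OF 2] by auto
      moreover have "act (S (- i)) (act (S i) p) = p" using i by (simp add: S_uminus act_inv)
      ultimately show False using p D_subset_K by auto
    qed
  qed
qed

lemma D_openin: "i \<in> I \<Longrightarrow> openin riemann_sphere (D i)"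
  using D_qform openin_qform by metis

text \<open>The inverse generator maps the other disks into the open disk, not just into its closure,
  since near a boundary point the form also takes positive values.\<close>

lemma act_into_D:
  assumes i: "i \<in> I" and j: "j \<in> I" and ij: "i \<noteq> - j" and z: "Some z \<in> D i"
  shows "act (S (- j)) (Some z) \<in> D j"
proof -
  obtain a b c where q: "b\<^sup>2 - a * c > 0" "D j = {p. qform a b c p < 0}" "K j = {p. qform a b c p \<le> 0}"
    using D_qform[OF j] by blast
  have "S (- j) \<in> carrier PSL2R" using j by simp
  then obtain A where A: "det A = 1" "S (- j) = psl A" by (rule PSL2R_cases)
  obtain a' b' c' where q': "b'\<^sup>2 - a' * c' > 0" "\<And>p. sgn (qform a b c (moebius A p)) = sgn (qform a' b' c' p)"
    using qform_pullback[OF A(1) q(1)] by metis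
  have le: "qform a' b' c' p \<le> 0" if "p \<in> D i" for p
  proof -
    have "p \<notin> K (- j)" using that D_subset_K[of i] K_disjoint[of i "- j"] i j ij by auto
    then have "act (S (- j)) p \<in> K j" using act_outside_K[of "- j" p] j by simp
    then show ?thesis using q(3) q'(2)[of p] sgn_eq_less_iff[OF q'(2)[of p]] by (auto simp: A act_psl)
  qed
  have "qform a' b' c' (Some z) \<noteq> 0"
  proof
    assume 0: "qform a' b' c' (Some z) = 0"
    have "open {w. Some w \<in> D i}" using D_openin[OF i] by (rule openin_riemann_sphere_finite)
    then obtain e where e: "e > 0" "\<And>w. cmod (w - z) < e \<Longrightarrow> Some w \<in> D i"
      using z unfolding open_dist dist_norm by blast
    have "(- b')\<^sup>2 - (- a') * (- c') > 0" "qform (- a') (- b') (- c') (Some z) = 0"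
      using q'(1) 0 unfolding qform_uminus by auto
    then obtain w where "cmod (w - z) < e" "qform (- a') (- b') (- c') (Some w) < 0"
      using qform_negative_nearby[OF _ _ e(1)] by metis
    then show False using le[of "Some w"] e(2)[of w] unfolding qform_uminus by auto
  qed
  then have "qform a' b' c' (Some z) < 0" using le[OF z] by simp
  then show ?thesis using q(2) sgn_eq_less_iff[OF q'(2)[of "Some z"]] by (simp add: A act_psl)
qed

lemma D_meets_UHP: assumes "i \<in> I" obtains z where "z \<in> UHP" "Some z \<in> D i"
proof -
  have "real_centered_open_disk (D i)" using data assms by (simp add: schottky_data_def)
  then obtain g x \<rho> where g: "g \<in> carrier PSL2R" and \<rho>: "\<rho> > 0"
    and E: "act g ` D i = Some ` ball (complex_of_real x) \<rho>"
    unfolding real_centered_open_disk_def by blast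
  \<comment> \<open>The centre is real, so half of the round disk lies in the half-plane.\<close>
  let ?w = "of_real x + of_real (\<rho> / 2) * \<i>"
  have w: "?w \<in> UHP" using \<rho> by (simp add: in_UHP)
  have "?w \<in> ball (complex_of_real x) \<rho>" using \<rho> by (simp add: dist_norm norm_mult)
  then obtain p where p: "p \<in> D i" "act g p = Some ?w" using E by (metis imageE imageI)
  let ?h = "inv\<^bsub>PSL2R\<^esub> g"
  have h: "?h \<in> carrier PSL2R" using g by simp
  have "p = act ?h (Some ?w)" using p act_inv(1)[OF g] by metis
  then have "p = Some (hact ?h ?w)" using act_Some[OF h w] by simp
  then show ?thesis using that[of "hact ?h ?w"] p hact_UHP[OF h w] by simp
qed

definition domain where "domain = {z \<in> UHP. \<forall>i\<in>I. Some z \<notin> K i}"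

lemma K_finite_closed: assumes "i \<in> I" shows "closed {z. Some z \<in> K i}"
proof -
  obtain a b c where q: "K i = {p. qform a b c p \<le> 0}"
    using D_qform[OF assms] by blast
  show ?thesis unfolding q mem_Collect_eq
    by (intro closed_Collect_le continuous_on_qform continuous_on_const)
qed

text \<open>The connected half-plane is not a disjoint union of finitely many, but at least two, nonempty
  closed subsets.\<close>

lemma domain_nonempty: "domain \<noteq> {}"
proof
  assume empty: "domain = {}"
  let ?A = "{z. Some z \<in> K 1}" and ?B = "\<Union>i\<in>I - {1}. {z. Some z \<in> K i}"
  have I: "1 \<in> I" "- 1 \<in> I" using r_pos by (auto simp: sym_index_def)
  have A: "closed ?A" by (rule K_finite_closed[OF I(1)])
  have B: "closed ?B" using finite_I K_finite_closed by (intro closed_UN) auto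
  have AB: "UHP \<subseteq> ?A \<union> ?B" using empty by (auto simp: domain_def)
  have "?A \<inter> ?B \<inter> UHP = {}" using K_disjoint[OF I(1)] by auto
  then have "?A \<inter> UHP = {} \<or> ?B \<inter> UHP = {}"
    using connected_closedD[OF convex_connected[OF convex_UHP] _ AB A B] by simp
  moreover have "?A \<inter> UHP \<noteq> {}" using D_meets_UHP[OF I(1)] D_subset_K by blast
  moreover have "?B \<inter> UHP \<noteq> {}"
  proof -
    obtain z where "z \<in> UHP" "Some z \<in> D (- 1)" using D_meets_UHP[OF I(2)] .
    moreover from this have "Some z \<in> K (- 1)" using D_subset_K by blast
    ultimately have "z \<in> ?B \<inter> UHP" using I(2) by (intro IntI UN_I[of "- 1"]) auto
    then show ?thesis by blast
  qed
  ultimately show False by blast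
qed

definition base where "base = (SOME z. z \<in> domain)"

lemma base: "base \<in> domain" using domain_nonempty by (simp add: base_def some_in_eq)

lemma base_UHP: "base \<in> UHP" and base_K: "i \<in> I \<Longrightarrow> Some base \<notin> K i"
  using base by (auto simp: domain_def)

lemma T_UHP: "\<lbrakk>i \<in> I; z \<in> UHP\<rbrakk> \<Longrightarrow> T i z \<in> UHP" by (simp add: hact_UHP)

lemma T_uminus: "\<lbrakk>i \<in> I; z \<in> UHP\<rbrakk> \<Longrightarrow> T i (T (- i) z) = z"
  by (simp add: S_uminus hact_inv)

lemma T_uminus': "\<lbrakk>i \<in> I; z \<in> UHP\<rbrakk> \<Longrightarrow> T (- i) (T i z) = z"
  using T_uminus[of "- i" z] by simp

lemma word_UHP: "\<lbrakk>set w \<subseteq> I; z \<in> UHP\<rbrakk> \<Longrightarrow> foldr T w z \<in> UHP"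
  by (induction w) (auto intro: T_UHP)

lemma T_outside_K: "\<lbrakk>i \<in> I; z \<in> UHP; Some z \<notin> K i\<rbrakk> \<Longrightarrow> Some (T i z) \<in> K (- i)"
  using act_outside_K[of i "Some z"] by (simp add: act_Some)

text \<open>Each letter moves the point into the disk of its inverse, which is outside the disk of
  the next letter because the word is reduced.\<close>

lemma ping_pong:
  assumes "reduced_word r w" "w \<noteq> []" "z \<in> UHP" "Some z \<notin> K (last w)"
  shows "Some (foldr T w z) \<in> K (- hd w)"
  using assms(1,2,4)
proof (induction w)
  case (Cons i w)
  have i: "i \<in> I" and w: "reduced_word r w" using Cons.prems by (auto simp: reduced_word_Cons)
  have U: "foldr T w z \<in> UHP" using w assms(3) by (intro word_UHP) (auto simp: reduced_word_def)
  have "Some (foldr T w z) \<notin> K i"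
  proof (cases "w = []")
    case False
    then have "Some (foldr T w z) \<in> K (- hd w)" using Cons w by simp
    moreover have "hd w \<in> I" "hd w \<noteq> - i"
      using False w Cons.prems(1) by (cases w; simp add: reduced_word_Cons)+
    then have "K (- hd w) \<inter> K i = {}" using i by (intro K_disjoint) auto
    ultimately show ?thesis by blast
  qed (use Cons.prems in simp)
  then show ?case using T_outside_K[OF i U] by simp
qed simp

lemma last_hd_I: "\<lbrakk>reduced_word r w; w \<noteq> []\<rbrakk> \<Longrightarrow> last w \<in> I \<and> hd w \<in> I"
  by (auto simp: reduced_word_def)

lemma ping_pong_base: "\<lbrakk>reduced_word r w; w \<noteq> []\<rbrakk> \<Longrightarrow> Some (foldr T w base) \<in> K (- hd w)"
  using ping_pong base_UHP base_K last_hd_I by blast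

lemma word_inj_base:
  "\<lbrakk>reduced_word r v; reduced_word r w; foldr T v base = foldr T w base\<rbrakk> \<Longrightarrow> v = w"
proof (induction v arbitrary: w)
  case Nil
  show ?case
  proof (rule ccontr)
    assume "[] \<noteq> w"
    then have w: "w \<noteq> []" by blast
    have "- hd w \<in> I" using last_hd_I[OF Nil(2) w] by simp
    then show False using ping_pong_base[OF Nil(2) w] base_K Nil(3) by (metis foldr.simps(1) id_apply)
  qed
next
  case (Cons i v)
  show ?case
  proof (cases w)
    case Nil
    have "foldr T (i # v) base = base" using Cons.prems(3) Nil by simp
    moreover have "- i \<in> I" using Cons.prems(1) by (simp add: reduced_word_Cons)
    ultimately show ?thesis using ping_pong_base[OF Cons.prems(1)] base_K by (metis list.distinct(1) list.sel(1))
  next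
    case (Cons j u)
    have v: "i \<in> I" "reduced_word r v" and u: "j \<in> I" "reduced_word r u"
      using Cons.prems Cons by (auto simp: reduced_word_Cons)
    have "Some (foldr T (i # v) base) \<in> K (- i)" "Some (foldr T (i # v) base) \<in> K (- j)"
      using ping_pong_base[OF Cons.prems(1)] ping_pong_base[OF Cons.prems(2)] Cons.prems(3) Cons
      by (simp_all del: foldr.simps)
    then have ij: "i = j" using K_disjoint[of "- i" "- j"] u(1) v(1) by (metis IntI empty_iff neg_equal_iff_equal sym_index_uminus)
    have U: "foldr T v base \<in> UHP" "foldr T u base \<in> UHP"
      using u v by (auto intro!: word_UHP simp: reduced_word_def base_UHP)
    have "T i (foldr T v base) = T i (foldr T u base)" using Cons.prems(3) unfolding Cons ij by simp
    then have "foldr T v base = foldr T u base" using T_uminus'[OF v(1)] U by metis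
    then show ?thesis using Cons.IH[OF v(2) u(2)] ij Cons by simp
  qed
qed

definition word_elt :: "int list \<Rightarrow> (real^2^2) set" where
  "word_elt w = foldr (\<lambda>i g. S i \<otimes>\<^bsub>PSL2R\<^esub> g) w \<one>\<^bsub>PSL2R\<^esub>"

lemma word_elt_simps [simp]:
  "word_elt [] = \<one>\<^bsub>PSL2R\<^esub>" "word_elt (i # w) = S i \<otimes>\<^bsub>PSL2R\<^esub> word_elt w"
  by (simp_all add: word_elt_def)

lemma word_elt_carrier: "set w \<subseteq> I \<Longrightarrow> word_elt w \<in> carrier PSL2R"
  by (induction w) auto

lemma hact_word_elt: "\<lbrakk>set w \<subseteq> I; z \<in> UHP\<rbrakk> \<Longrightarrow> hact (word_elt w) z = foldr T w z"
  by (induction w) (auto simp: hact_mult word_elt_carrier)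

lemma \<Gamma>_subgroup: "subgroup \<Gamma> PSL2R"
proof -
  have "\<Gamma> = generate PSL2R (S ` {1..int r})" using data by (simp add: schottky_data_def)
  moreover have "S ` {1..int r} \<subseteq> carrier PSL2R" using sym_index_pos by fastforce
  ultimately show ?thesis using PSL.generate_is_subgroup by simp
qed

lemma \<Gamma>_carrier: "g \<in> \<Gamma> \<Longrightarrow> g \<in> carrier PSL2R" using \<Gamma>_subgroup subgroup.mem_carrier by fast

lemma S_in_\<Gamma>: "i \<in> I \<Longrightarrow> S i \<in> \<Gamma>"
proof (erule I_cases)
  have \<Gamma>: "\<Gamma> = generate PSL2R (S ` {1..int r})" using data by (simp add: schottky_data_def)
  show "S i \<in> \<Gamma>" if "i \<in> {1..int r}" unfolding \<Gamma> using that by (intro generate.incl) auto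
  show "S i \<in> \<Gamma>" if "- i \<in> {1..int r}"
    using generate.inv[of "S (- i)" "S ` {1..int r}" PSL2R] that S_uminus(2)[OF sym_index_pos[OF that]]
    unfolding \<Gamma> by auto
qed

lemma word_elt_\<Gamma>: "set w \<subseteq> I \<Longrightarrow> word_elt w \<in> \<Gamma>"
  by (induction w) (auto intro: subgroup.m_closed[OF \<Gamma>_subgroup] subgroup.one_closed[OF \<Gamma>_subgroup] S_in_\<Gamma>)

lemma reduced_set: "reduced_word r w \<Longrightarrow> set w \<subseteq> I" by (simp add: reduced_word_def)

lemma reduced_generator_mult:
  assumes "i \<in> I" "reduced_word r w"
  shows "\<exists>u. reduced_word r u \<and> S i \<otimes>\<^bsub>PSL2R\<^esub> word_elt w = word_elt u"
proof (cases "\<exists>v. w = - i # v")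
  case True
  then obtain v where v: "w = - i # v" by blast
  have rv: "reduced_word r v" using assms v by (simp add: reduced_word_Cons)
  have "S i \<otimes>\<^bsub>PSL2R\<^esub> (inv\<^bsub>PSL2R\<^esub> (S i) \<otimes>\<^bsub>PSL2R\<^esub> word_elt v) = word_elt v"
    using assms rv by (simp add: word_elt_carrier reduced_set flip: PSL.m_assoc)
  then show ?thesis using rv v assms by (auto simp: S_uminus)
next
  case False
  then have "reduced_word r (i # w)" using assms by (cases w) (auto simp: reduced_word_Cons)
  then show ?thesis by (intro exI[of _ "i # w"]) simp
qed

lemma reduced_word_mult:
  assumes "set v \<subseteq> I" "reduced_word r w"
  shows "\<exists>u. reduced_word r u \<and> word_elt v \<otimes>\<^bsub>PSL2R\<^esub> word_elt w = word_elt u"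
  using assms(1)
proof (induction v)
  case Nil
  then show ?case using assms by (auto simp: word_elt_carrier reduced_set)
next
  case (Cons i v)
  then obtain u where u: "reduced_word r u" "word_elt v \<otimes>\<^bsub>PSL2R\<^esub> word_elt w = word_elt u" by auto
  have "word_elt (i # v) \<otimes>\<^bsub>PSL2R\<^esub> word_elt w = S i \<otimes>\<^bsub>PSL2R\<^esub> word_elt u"
    using Cons.prems assms(2) by (simp add: word_elt_carrier reduced_set PSL.m_assoc flip: u(2))
  then show ?case using reduced_generator_mult[of i u] u(1) Cons.prems by simp
qed

lemma \<Gamma>_words: assumes "g \<in> \<Gamma>" obtains w where "reduced_word r w" "g = word_elt w"
proof -
  have "g \<in> generate PSL2R (S ` {1..int r})" using assms data by (simp add: schottky_data_def)
  then have "\<exists>w. reduced_word r w \<and> g = word_elt w"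
  proof (induction rule: generate.induct)
    case one then show ?case by (intro exI[of _ "[]"]) simp
  next
    case (incl h)
    then obtain j where "j \<in> {1..int r}" "h = S j" by auto
    then show ?case using sym_index_pos[of j r] by (intro exI[of _ "[j]"]) (simp add: reduced_word_Cons)
  next
    case (inv h)
    then obtain j where "j \<in> {1..int r}" "h = S j" by auto
    then show ?case using sym_index_pos[of j r]
      by (intro exI[of _ "[- j]"]) (simp add: reduced_word_Cons S_uminus)
  next
    case (eng g h)
    then show ?case using reduced_word_mult reduced_set by metis
  qed
  then show ?thesis using that by blast
qed

end

subsection \<open>Discontinuity and freeness of the action\<close>

context schottky
begin

lemma base_neighbourhood:
  obtains d where "d > 0" "\<And>w i. \<lbrakk>w \<in> UHP; hyp_dist base w < d; i \<in> I\<rbrakk> \<Longrightarrow> Some w \<notin> K i"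
proof -
  have "closed (\<Union>i\<in>I. {z. Some z \<in> K i})" using finite_I K_finite_closed by (intro closed_UN) auto
  then have "open (- (\<Union>i\<in>I. {z. Some z \<in> K i}))" by (rule open_Compl)
  moreover have "base \<in> - (\<Union>i\<in>I. {z. Some z \<in> K i})" using base_K by auto
  ultimately obtain e where e: "e > 0" "\<And>w. cmod (w - base) < e \<Longrightarrow> w \<in> - (\<Union>i\<in>I. {z. Some z \<in> K i})"
    unfolding open_dist dist_norm by blast
  obtain d where "d > 0" "\<And>w. \<lbrakk>w \<in> UHP; hyp_dist base w < d\<rbrakk> \<Longrightarrow> cmod (base - w) < e"
    using hyp_ball_in_ball[OF base_UHP e(1)] by blast
  then show ?thesis using that[of d] e(2) by (metis (mono_tags, lifting) ComplD UN_I mem_Collect_eq norm_minus_commute)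
qed

text \<open>All translates of the base point by nontrivial elements lie in the closed disks, and the base point
  does not; by homogeneity of the orbit the distance of the base point from the disks separates all
  its points.\<close>

lemma base_orbit_separated:
  obtains d where "d > 0" "\<And>g h. \<lbrakk>g \<in> \<Gamma>; h \<in> \<Gamma>; g \<noteq> h\<rbrakk> \<Longrightarrow> hyp_dist (hact g base) (hact h base) \<ge> d"
proof -
  obtain d where d: "d > 0" "\<And>w i. \<lbrakk>w \<in> UHP; hyp_dist base w < d; i \<in> I\<rbrakk> \<Longrightarrow> Some w \<notin> K i"
    using base_neighbourhood by blast
  have "hyp_dist (hact g base) (hact h base) \<ge> d" if gh: "g \<in> \<Gamma>" "h \<in> \<Gamma>" "g \<noteq> h" for g h
  proof -
    let ?k = "inv\<^bsub>PSL2R\<^esub> g \<otimes>\<^bsub>PSL2R\<^esub> h"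
    have c: "g \<in> carrier PSL2R" "h \<in> carrier PSL2R" using gh \<Gamma>_carrier by auto
    have "?k \<in> \<Gamma>" using gh \<Gamma>_subgroup by (simp add: subgroup.m_closed subgroup.m_inv_closed)
    then obtain w where w: "reduced_word r w" "?k = word_elt w" by (rule \<Gamma>_words)
    have "g \<otimes>\<^bsub>PSL2R\<^esub> ?k = h" using c by (simp flip: PSL.m_assoc)
    then have "?k \<noteq> \<one>\<^bsub>PSL2R\<^esub>" using c gh(3) by (metis PSL.r_one)
    then have "w \<noteq> []" using w(2) by (metis word_elt_simps(1))
    then have "Some (hact ?k base) \<in> K (- hd w)" "- hd w \<in> I"
      using w ping_pong_base[of w] last_hd_I[of w] by (auto simp: hact_word_elt reduced_set base_UHP)
    moreover have k: "hact ?k base \<in> UHP" using c by (simp add: hact_UHP base_UHP)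
    ultimately have "hyp_dist base (hact ?k base) \<ge> d" using d(2)[of "hact ?k base" "- hd w"] by fastforce
    moreover have "hact g (hact ?k base) = hact h base"
      using c by (simp add: hact_mult hact_inv hact_UHP base_UHP)
    ultimately show ?thesis using hyp_dist_hact[OF c(1) base_UHP k] by simp
  qed
  then show ?thesis using that d(1) by blast
qed

lemma finite_\<Gamma>_base: assumes z: "z \<in> UHP" shows "finite {g \<in> \<Gamma>. hyp_dist z (hact g base) < R}"
proof -
  obtain d where d: "d > 0" "\<And>g h. \<lbrakk>g \<in> \<Gamma>; h \<in> \<Gamma>; g \<noteq> h\<rbrakk> \<Longrightarrow> hyp_dist (hact g base) (hact h base) \<ge> d"
    using base_orbit_separated by blast
  let ?O = "(\<lambda>g. hact g base) ` \<Gamma>"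
  have U: "?O \<subseteq> UHP" using \<Gamma>_carrier hact_UHP base_UHP by auto
  have fin: "finite {w \<in> ?O. hyp_dist z w < R}"
    by (rule separated_finite_in_ball[OF z U d(1)]) (use d(2) in blast)
  have "inj_on (\<lambda>g. hact g base) \<Gamma>"
  proof (rule inj_onI, rule ccontr)
    fix g h assume gh: "g \<in> \<Gamma>" "h \<in> \<Gamma>" "hact g base = hact h base" "g \<noteq> h"
    then have "hyp_dist (hact g base) (hact h base) = 0" using U hyp_dist_zero_iff by auto
    then show False using d(2)[OF gh(1,2,4)] d(1) by simp
  qed
  then have inj: "inj_on (\<lambda>g. hact g base) {g \<in> \<Gamma>. hyp_dist z (hact g base) < R}"
    by (rule inj_on_subset) auto
  have sub: "(\<lambda>g. hact g base) ` {g \<in> \<Gamma>. hyp_dist z (hact g base) < R} \<subseteq> {w \<in> ?O. hyp_dist z w < R}"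
    by auto
  show ?thesis by (rule finite_imageD[OF finite_subset[OF sub fin] inj])
qed

lemma finite_\<Gamma>: assumes z: "z \<in> UHP" and w: "w \<in> UHP" shows "finite {g \<in> \<Gamma>. hyp_dist z (hact g w) < R}"
proof (rule finite_subset[OF _ finite_\<Gamma>_base[OF z, of "R + hyp_dist w base"]], clarify)
  fix g assume g: "g \<in> \<Gamma>" "hyp_dist z (hact g w) < R"
  have c: "g \<in> carrier PSL2R" using g \<Gamma>_carrier by auto
  have "hyp_dist z (hact g base) \<le> hyp_dist z (hact g w) + hyp_dist (hact g w) (hact g base)"
    using c by (intro hyp_dist_triangle) (auto intro: hact_UHP base_UHP z w)
  also have "hyp_dist (hact g w) (hact g base) = hyp_dist w base"
    by (rule hyp_dist_hact[OF c w base_UHP])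
  finally show "hyp_dist z (hact g base) < R + hyp_dist w base" using g(2) by simp
qed

text \<open>A fixed point of a cyclically reduced word would be fixed by all its powers, which move the
  base point to infinitely many points at the same distance; conjugation reduces every word to a
  cyclically reduced one.\<close>

lemma word_no_fixed_point:
  "\<lbrakk>reduced_word r w; w \<noteq> []; z \<in> UHP\<rbrakk> \<Longrightarrow> foldr T w z \<noteq> z"
proof (induction "length w" arbitrary: w z rule: less_induct)
  case less
  note w = less.prems(1,2) and z = less.prems(3)
  have lI: "last w \<in> I" "hd w \<in> I" using last_hd_I[OF w] by auto
  show ?case
  proof
    assume fix_z: "foldr T w z = z"
    show False
    proof (cases "last w = - hd w")
      case False
      let ?f = "foldr T w"
      have U: "(?f ^^ m) x \<in> UHP" if "x \<in> UHP" for m x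
        using that by (induction m) (simp_all add: word_UHP[OF reduced_set[OF w(1)]])
      have cyc: "Some ((?f ^^ Suc m) base) \<in> K (- hd w)" for m
      proof (induction m)
        case 0 then show ?case using ping_pong_base[OF w] by simp
      next
        case (Suc m)
        have "K (- hd w) \<inter> K (last w) = {}" using lI False by (intro K_disjoint) auto
        then have "Some ((?f ^^ Suc m) base) \<notin> K (last w)" using Suc by blast
        from ping_pong[OF w U[OF base_UHP] this] show ?case by simp
      qed
      have fixm: "(?f ^^ m) z = z" for m by (induction m) (auto simp: fix_z)
      have \<Gamma>m: "\<exists>g\<in>\<Gamma>. \<forall>x\<in>UHP. (?f ^^ m) x = hact g x" for m
      proof (induction m)
        case 0 then show ?case using subgroup.one_closed[OF \<Gamma>_subgroup] by (intro bexI[of _ "\<one>\<^bsub>PSL2R\<^esub>"]) auto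
      next
        case (Suc m)
        then obtain g where g: "g \<in> \<Gamma>" "\<And>x. x \<in> UHP \<Longrightarrow> (?f ^^ m) x = hact g x" by blast
        have ws: "set w \<subseteq> I" using w reduced_set by blast
        have "word_elt w \<otimes>\<^bsub>PSL2R\<^esub> g \<in> \<Gamma>"
          using word_elt_\<Gamma>[OF ws] g(1) \<Gamma>_subgroup by (simp add: subgroup.m_closed)
        moreover have "(?f ^^ Suc m) x = hact (word_elt w \<otimes>\<^bsub>PSL2R\<^esub> g) x" if "x \<in> UHP" for x
          using that g(2)[OF that] hact_word_elt[OF ws] U[OF that, of m] \<Gamma>_carrier[OF g(1)]
          by (simp add: hact_mult word_elt_carrier[OF ws])
        ultimately show ?case by blast
      qed
      then obtain G where G: "\<And>m. G m \<in> \<Gamma>" "\<And>m x. x \<in> UHP \<Longrightarrow> (?f ^^ m) x = hact (G m) x" by metis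
      have "hyp_dist z (hact (G m) z) < 1" for m
        using fixm[of m] G(2)[OF z, of m] hyp_dist_zero_iff[OF z z] by simp
      then have "range G \<subseteq> {g \<in> \<Gamma>. hyp_dist z (hact g z) < 1}" using G(1) by auto
      then have "finite (range G)" using finite_\<Gamma>[OF z z] finite_subset by blast
      then have "\<not> inj G" using infinite_UNIV_nat finite_imageD by blast
      then obtain m k where "G m = G k" "m \<noteq> k" unfolding inj_def by blast
      then obtain m k where mk: "G m = G k" "m < k" by (metis nat_neq_iff)
      have inj: "inj_on ?f UHP"
      proof (rule inj_onI)
        fix x y assume xy: "x \<in> UHP" "y \<in> UHP" "?f x = ?f y"
        have ws: "set w \<subseteq> I" using w reduced_set by blast
        show "x = y" using xy hact_inv(1)[OF word_elt_carrier[OF ws]] hact_word_elt[OF ws] by metis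
      qed
      have "(?f ^^ m) x = (?f ^^ (m + l)) x \<Longrightarrow> x \<in> UHP \<Longrightarrow> (?f ^^ l) x = x" for l x
      proof (induction m)
        case (Suc m)
        then show ?case using inj_onD[OF inj, of "(?f ^^ m) x" "(?f ^^ (m + l)) x"] U by simp
      qed simp
      from this[of base "k - m"] have "(?f ^^ (k - m)) base = base"
        using mk G(2)[OF base_UHP] base_UHP by (metis le_add_diff_inverse less_imp_le)
      moreover obtain l where "k - m = Suc l" using mk(2) by (metis Suc_diff_Suc)
      ultimately have "Some base \<in> K (- hd w)" using cyc[of l] by simp
      then show False using base_K[of "- hd w"] lI by simp
    next
      case True
      obtain i v where v: "w = i # v" using w by (cases w) auto
      have "v \<noteq> []"
      proof
        assume "v = []"
        then have "i = - i" using True v by simp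
        then show False using lI v by (simp add: sym_index_def)
      qed
      then obtain u where u: "v = u @ [- i]" using True v by (metis append_butlast_last_id last_ConsR list.sel(1))
      have i: "i \<in> I" using lI v by simp
      have ru: "reduced_word r u"
        using w(1) unfolding v u reduced_word_def by (auto simp: successively_append_iff successively_Cons)
      have "u \<noteq> []"
        using w(1) unfolding v u reduced_word_def by auto
      have "foldr T u (T (- i) z) = T (- i) z"
      proof -
        have "T i (foldr T u (T (- i) z)) = z" using fix_z unfolding v u by simp
        moreover have "foldr T u (T (- i) z) \<in> UHP"
          using ru z i by (intro word_UHP reduced_set T_UHP) auto
        ultimately show ?thesis using T_uminus'[OF i] by metis
      qed
      moreover have "foldr T u (T (- i) z) \<noteq> T (- i) z"
        using less.hyps[of u "T (- i) z"] ru \<open>u \<noteq> []\<close> z i T_UHP[of "- i" z] by (simp add: v u)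
      ultimately show False by blast
    qed
  qed
qed

lemma free_action: assumes "g \<in> \<Gamma>" "z \<in> UHP" "hact g z = z" shows "g = \<one>\<^bsub>PSL2R\<^esub>"
proof -
  obtain w where w: "reduced_word r w" "g = word_elt w" using assms(1) by (rule \<Gamma>_words)
  then have "w = []" using word_no_fixed_point[OF w(1) _ assms(2)] assms by (auto simp: hact_word_elt reduced_set)
  then show ?thesis using w by simp
qed

lemma word_elt_inj: "\<lbrakk>reduced_word r v; reduced_word r w; word_elt v = word_elt w\<rbrakk> \<Longrightarrow> v = w"
  using word_inj_base hact_word_elt base_UHP reduced_set by metis

lemma injectivity_radius:
  assumes z: "z \<in> UHP"
  obtains e where "e > 0" "\<And>g. \<lbrakk>g \<in> \<Gamma>; g \<noteq> \<one>\<^bsub>PSL2R\<^esub>\<rbrakk> \<Longrightarrow> hyp_dist z (hact g z) \<ge> 4 * e"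
proof -
  let ?F = "{g \<in> \<Gamma>. hyp_dist z (hact g z) < 1} - {\<one>\<^bsub>PSL2R\<^esub>}"
  define m where "m = Min (insert 1 ((\<lambda>g. hyp_dist z (hact g z)) ` ?F))"
  have fin: "finite (insert 1 ((\<lambda>g. hyp_dist z (hact g z)) ` ?F))" using finite_\<Gamma>[OF z z] by simp
  have "hyp_dist z (hact g z) > 0" if "g \<in> ?F" for g
  proof -
    have g: "hact g z \<in> UHP" using that \<Gamma>_carrier hact_UHP z by auto
    have "hact g z \<noteq> z" using that free_action z by blast
    then show ?thesis using hyp_dist_zero_iff[OF z g] hyp_dist_nonneg[OF z g] by force
  qed
  then have "m > 0" unfolding m_def using fin by (subst Min_gr_iff) auto
  moreover have "hyp_dist z (hact g z) \<ge> m" if "g \<in> \<Gamma>" "g \<noteq> \<one>\<^bsub>PSL2R\<^esub>" for g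
  proof (cases "hyp_dist z (hact g z) < 1")
    case True
    then show ?thesis unfolding m_def using that fin by (intro Min_le) auto
  next
    case False
    then show ?thesis unfolding m_def using Min_le[OF fin, of 1] by simp
  qed
  ultimately show ?thesis using that[of "m / 4"] by simp
qed

end

section \<open>Quotients of the hyperbolic plane\<close>

lemma continuous_map_mtopology_of:
  "continuous_map (mtopology_of C) (mtopology_of X) f \<longleftrightarrow> f ` mspace C \<subseteq> mspace X \<and>
     (\<forall>a\<in>mspace C. \<forall>\<epsilon>>0. \<exists>\<delta>>0. \<forall>x. x \<in> mspace C \<and> mdist C a x < \<delta> \<longrightarrow> mdist X (f a) (f x) < \<epsilon>)"
  unfolding mtopology_of_def
  by (rule Metric_space.metric_continuous_map[OF Metric_space_mspace_mdist Metric_space_mspace_mdist])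

lemma openin_mtopology_of_ball:
  assumes "x \<in> mspace X" shows "openin (mtopology_of X) {y \<in> mspace X. mdist X x y < e}"
proof -
  have "{y \<in> mspace X. mdist X x y < e} = Metric_space.mball (mspace X) (mdist X) x e"
    using assms Metric_space.in_mball[OF Metric_space_mspace_mdist, of _ X x e] by auto
  then show ?thesis
    unfolding mtopology_of_def using Metric_space.openin_mball[OF Metric_space_mspace_mdist, of X x e] by simp
qed

lemma mdist_self: "x \<in> mspace X \<Longrightarrow> mdist X x x = 0"
  by simp

lemma isometric_continuous:
  assumes "f ` U \<subseteq> V" "U \<subseteq> mspace C" "V \<subseteq> mspace X"
    "\<And>y z. \<lbrakk>y \<in> U; z \<in> U\<rbrakk> \<Longrightarrow> mdist X (f y) (f z) = mdist C y z"
  shows "continuous_map (subtopology (mtopology_of C) U) (subtopology (mtopology_of X) V) f"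
  unfolding mtopology_of_submetric[symmetric] continuous_map_mtopology_of mspace_submetric mdist_submetric
proof (intro conjI ballI allI impI)
  show "f ` (U \<inter> mspace C) \<subseteq> V \<inter> mspace X" using assms by blast
  fix a and \<epsilon> :: real assume "a \<in> U \<inter> mspace C" "\<epsilon> > 0"
  then show "\<exists>\<delta>>0. \<forall>x. x \<in> U \<inter> mspace C \<and> mdist C a x < \<delta> \<longrightarrow> mdist X (f a) (f x) < \<epsilon>"
    using assms(4) by (intro exI[of _ \<epsilon>]) auto
qed

lemma isometric_bij_homeomorphic:
  assumes bij: "bij_betw f U V" and UV: "U \<subseteq> mspace C" "V \<subseteq> mspace X"
    and iso: "\<And>y z. \<lbrakk>y \<in> U; z \<in> U\<rbrakk> \<Longrightarrow> mdist X (f y) (f z) = mdist C y z"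
  shows "homeomorphic_map (subtopology (mtopology_of C) U) (subtopology (mtopology_of X) V) f"
proof -
  let ?g = "inv_into U f"
  have img: "f ` U = V" "?g ` V = U" using bij by (auto simp: bij_betw_def)
  have fg: "f (?g v) = v" if "v \<in> V" for v using that img by (simp add: f_inv_into_f)
  have gf: "?g (f u) = u" if "u \<in> U" for u using that bij by (simp add: bij_betw_def)
  have "homeomorphic_maps (subtopology (mtopology_of C) U) (subtopology (mtopology_of X) V) f ?g"
    unfolding homeomorphic_maps_def
  proof (intro conjI ballI)
    show "continuous_map (subtopology (mtopology_of C) U) (subtopology (mtopology_of X) V) f"
      using img UV iso by (intro isometric_continuous) auto
    have gU: "?g v \<in> U" if "v \<in> V" for v using img that by blast
    show "continuous_map (subtopology (mtopology_of X) V) (subtopology (mtopology_of C) U) ?g"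
      by (rule isometric_continuous) (use img UV in blast, use UV in blast, use UV in blast,
          use iso fg gU in metis)
  qed (use fg gf in auto)
  then show ?thesis using homeomorphic_map_maps by blast
qed

text \<open>A map of the hyperbolic plane onto a metric space that identifies it with the quotient
  by \<open>G\<close>; the infimum defining the distance of orbits is expressed by strict inequalities.\<close>

definition uniformizes :: "(real^2^2) set set \<Rightarrow> 'a metric \<Rightarrow> (complex \<Rightarrow> 'a) \<Rightarrow> bool" where
  "uniformizes G Y q \<longleftrightarrow> q ` UHP = mspace Y \<and>
     (\<forall>z\<in>UHP. \<forall>w\<in>UHP. \<forall>R. mdist Y (q z) (q w) < R \<longleftrightarrow> (\<exists>g\<in>G. hyp_dist z (hact g w) < R))"

lemma orbit_of_eq:
  assumes "G \<subseteq> carrier PSL2R" "z \<in> UHP" shows "orbit_of G z = (\<lambda>g. hact g z) ` G"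
proof -
  have *: "act g (Some z) = Some (hact g z)" if "g \<in> G" for g using assms that act_Some by blast
  show ?thesis by (auto simp: orbit_of_def *)
qed

lemma orbit_dist_less:
  assumes G: "subgroup G PSL2R" and z: "z \<in> UHP" and w: "w \<in> UHP"
  shows "orbit_dist (orbit_of G z) (orbit_of G w) < R \<longleftrightarrow> (\<exists>g\<in>G. hyp_dist z (hact g w) < R)"
proof -
  have c: "g \<in> carrier PSL2R" if "g \<in> G" for g using G that subgroup.mem_carrier by fast
  then have Gc: "G \<subseteq> carrier PSL2R" by blast
  let ?P = "orbit_of G z \<times> orbit_of G w"
  have eq: "?P = (\<lambda>g. hact g z) ` G \<times> (\<lambda>g. hact g w) ` G" using Gc z w by (simp add: orbit_of_eq)
  have "?P \<noteq> {}" using subgroup.one_closed[OF G] unfolding eq by blast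
  moreover have "bdd_below ((\<lambda>(z, w). hyp_dist z w) ` ?P)"
    unfolding eq using c z w by (intro bdd_belowI[of _ 0]) (auto intro!: hyp_dist_nonneg hact_UHP)
  ultimately have "orbit_dist (orbit_of G z) (orbit_of G w) < R \<longleftrightarrow> (\<exists>x\<in>?P. (case x of (z, w) \<Rightarrow> hyp_dist z w) < R)"
    unfolding orbit_dist_def by (rule cINF_less_iff)
  also have "\<dots> \<longleftrightarrow> (\<exists>g\<in>G. \<exists>h\<in>G. hyp_dist (hact g z) (hact h w) < R)" unfolding eq by auto
  also have "\<dots> \<longleftrightarrow> (\<exists>g\<in>G. hyp_dist z (hact g w) < R)"
  proof
    assume "\<exists>g\<in>G. \<exists>h\<in>G. hyp_dist (hact g z) (hact h w) < R"
    then obtain g h where gh: "g \<in> G" "h \<in> G" "hyp_dist (hact g z) (hact h w) < R" by blast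
    let ?k = "inv\<^bsub>PSL2R\<^esub> g \<otimes>\<^bsub>PSL2R\<^esub> h"
    have k: "?k \<in> G" using gh G by (simp add: subgroup.m_closed subgroup.m_inv_closed)
    have "hact g (hact ?k w) = hact h w"
      using c gh w by (simp add: hact_mult hact_inv hact_UHP)
    then have "hyp_dist z (hact ?k w) = hyp_dist (hact g z) (hact h w)"
      using hyp_dist_hact[OF c[OF gh(1)] z hact_UHP[OF c[OF k] w]] by simp
    then show "\<exists>g\<in>G. hyp_dist z (hact g w) < R" using k gh(3) by (intro bexI[of _ ?k]) auto
  next
    assume "\<exists>g\<in>G. hyp_dist z (hact g w) < R"
    then show "\<exists>g\<in>G. \<exists>h\<in>G. hyp_dist (hact g z) (hact h w) < R"
      using subgroup.one_closed[OF G] by (metis hact_one)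
  qed
  finally show ?thesis .
qed

lemma isometric_to_quotient_uniformizes:
  assumes G: "subgroup G PSL2R" and X: "isometric_to_quotient X G"
  obtains q where "uniformizes G X q"
proof -
  obtain \<phi> where \<phi>: "bij_betw \<phi> (mspace X) (orbit_space G)"
    "\<And>x y. \<lbrakk>x \<in> mspace X; y \<in> mspace X\<rbrakk> \<Longrightarrow> orbit_dist (\<phi> x) (\<phi> y) = mdist X x y"
    using X unfolding isometric_to_quotient_def by blast
  define q where "q z = inv_into (mspace X) \<phi> (orbit_of G z)" for z
  have q: "q z \<in> mspace X" "\<phi> (q z) = orbit_of G z" if "z \<in> UHP" for z
  proof -
    have "orbit_of G z \<in> \<phi> ` mspace X" using \<phi>(1) that by (auto simp: bij_betw_def orbit_space_def)
    then show "q z \<in> mspace X" "\<phi> (q z) = orbit_of G z"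
      unfolding q_def by (auto simp: inv_into_into f_inv_into_f)
  qed
  have "q ` UHP = mspace X"
  proof
    show "mspace X \<subseteq> q ` UHP"
    proof
      fix x assume x: "x \<in> mspace X"
      have "\<phi> ` mspace X = orbit_of G ` UHP" using \<phi>(1) by (simp add: bij_betw_def orbit_space_def)
      then have "\<phi> x \<in> orbit_of G ` UHP" using x by blast
      then obtain z where z: "z \<in> UHP" "\<phi> x = orbit_of G z" by blast
      then have "q z = x" using x \<phi>(1) by (simp add: q_def bij_betw_def flip: z(2))
      then show "x \<in> q ` UHP" using z by blast
    qed
  qed (use q in blast)
  moreover have "mdist X (q z) (q w) = orbit_dist (orbit_of G z) (orbit_of G w)"
    if "z \<in> UHP" "w \<in> UHP" for z w using \<phi>(2)[of "q z" "q w"] q that by simp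
  ultimately have "uniformizes G X q"
    unfolding uniformizes_def using orbit_dist_less[OF G] by simp
  then show ?thesis using that by blast
qed

lemma uniformizes_surj: "uniformizes G Y q \<Longrightarrow> y \<in> mspace Y \<Longrightarrow> \<exists>z\<in>UHP. y = q z"
  and uniformizes_mem: "uniformizes G Y q \<Longrightarrow> z \<in> UHP \<Longrightarrow> q z \<in> mspace Y"
  by (auto simp: uniformizes_def)

lemma uniformizes_less:
  "\<lbrakk>uniformizes G Y q; z \<in> UHP; w \<in> UHP\<rbrakk> \<Longrightarrow> mdist Y (q z) (q w) < R \<longleftrightarrow> (\<exists>g\<in>G. hyp_dist z (hact g w) < R)"
  by (auto simp: uniformizes_def)

context schottky
begin

lemma orbit_distance_zero:
  assumes z: "z \<in> UHP" and w: "w \<in> UHP" and G: "G \<subseteq> \<Gamma>"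
    and small: "\<And>R. R > 0 \<Longrightarrow> \<exists>g\<in>G. hyp_dist z (hact g w) < R"
  shows "\<exists>g\<in>G. hact g w = z"
proof (rule ccontr)
  assume none: "\<not> ?thesis"
  let ?F = "{g \<in> G. hyp_dist z (hact g w) < 1}"
  have U: "hact g w \<in> UHP" if "g \<in> G" for g using that G \<Gamma>_carrier hact_UHP w by blast
  have fin: "finite ?F" using finite_\<Gamma>[OF z w, of 1] G by (rule_tac finite_subset) auto
  define m where "m = Min (insert 1 ((\<lambda>g. hyp_dist z (hact g w)) ` ?F))"
  have "hyp_dist z (hact g w) > 0" if "g \<in> ?F" for g
    using that none hyp_dist_nonneg[OF z U] hyp_dist_zero_iff[OF z U] by (metis (mono_tags, lifting) less_eq_real_def mem_Collect_eq)
  then have "m > 0" unfolding m_def using fin by (subst Min_gr_iff) auto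
  then obtain g where g: "g \<in> G" "hyp_dist z (hact g w) < m" using small by blast
  have "m \<le> 1" unfolding m_def using fin by simp
  then have "g \<in> ?F" using g by simp
  then have "m \<le> hyp_dist z (hact g w)" unfolding m_def using fin by (intro Min_le) auto
  then show False using g by simp
qed

lemma uniformizes_eq_iff:
  assumes Y: "uniformizes G Y q" and G: "subgroup G PSL2R" "G \<subseteq> \<Gamma>" and z: "z \<in> UHP" and w: "w \<in> UHP"
  shows "q z = q w \<longleftrightarrow> (\<exists>g\<in>G. hact g w = z)"
proof
  assume "q z = q w"
  then have "mdist Y (q z) (q w) = 0" using uniformizes_mem[OF Y] z w by simp
  then show "\<exists>g\<in>G. hact g w = z"
    using uniformizes_less[OF Y z w] by (intro orbit_distance_zero[OF z w G(2)]) auto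
next
  assume "\<exists>g\<in>G. hact g w = z"
  then obtain g where g: "g \<in> G" "hyp_dist z (hact g w) = 0" using hyp_dist_zero_iff[OF z z] by auto
  have "mdist Y (q z) (q w) \<le> 0"
  proof (rule field_le_epsilon)
    fix e :: real assume "e > 0"
    then have "\<exists>g\<in>G. hyp_dist z (hact g w) < e" using g by (intro bexI[of _ g]) auto
    then have "mdist Y (q z) (q w) < e" using uniformizes_less[OF Y z w] by blast
    then show "mdist Y (q z) (q w) \<le> 0 + e" by simp
  qed
  then have "mdist Y (q z) (q w) = 0" using mdist_nonneg[of Y "q z" "q w"] by linarith
  then show "q z = q w" using mdist_zero[OF uniformizes_mem[OF Y z] uniformizes_mem[OF Y w]] by simp
qed

text \<open>A nontrivial element that brought a translate of one point closer would move \<open>z\<close> by less than \<open>4 e\<close>.\<close>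

lemma local_isometry:
  assumes Y: "uniformizes G Y q" and G: "subgroup G PSL2R" "G \<subseteq> \<Gamma>" and z: "z \<in> UHP"
    and e: "\<And>g. \<lbrakk>g \<in> \<Gamma>; g \<noteq> \<one>\<^bsub>PSL2R\<^esub>\<rbrakk> \<Longrightarrow> hyp_dist z (hact g z) \<ge> 4 * e"
    and u: "u \<in> UHP" "hyp_dist z u < e" and v: "v \<in> UHP" "hyp_dist z v < e"
  shows "mdist Y (q u) (q v) = hyp_dist u v"
proof (rule antisym)
  show "mdist Y (q u) (q v) \<le> hyp_dist u v"
  proof (rule field_le_epsilon)
    fix d :: real assume "d > 0"
    then have "\<exists>g\<in>G. hyp_dist u (hact g v) < hyp_dist u v + d"
      using subgroup.one_closed[OF G(1)] by (intro bexI[of _ "\<one>\<^bsub>PSL2R\<^esub>"]) auto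
    then show "mdist Y (q u) (q v) \<le> hyp_dist u v + d"
      using uniformizes_less[OF Y u(1) v(1)] by (meson less_imp_le)
  qed
  show "hyp_dist u v \<le> mdist Y (q u) (q v)"
  proof (rule ccontr)
    assume "\<not> ?thesis"
    then obtain g where g: "g \<in> G" "hyp_dist u (hact g v) < hyp_dist u v"
      using uniformizes_less[OF Y u(1) v(1), of "hyp_dist u v"] by auto
    then have g1: "g \<noteq> \<one>\<^bsub>PSL2R\<^esub>" by auto
    have gc: "g \<in> \<Gamma>" "g \<in> carrier PSL2R" using g G \<Gamma>_carrier by auto
    have gU: "hact g z \<in> UHP" "hact g v \<in> UHP" using gc z v hact_UHP by auto
    have "hyp_dist z (hact g z) \<le> hyp_dist z u + hyp_dist u (hact g z)"
      by (rule hyp_dist_triangle[OF z u(1) gU(1)])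
    moreover have "hyp_dist u (hact g z) \<le> hyp_dist u (hact g v) + hyp_dist (hact g v) (hact g z)"
      by (rule hyp_dist_triangle[OF u(1) gU(2) gU(1)])
    moreover have "hyp_dist (hact g v) (hact g z) = hyp_dist z v"
      using hyp_dist_hact[OF gc(2) v(1) z] hyp_dist_commute by simp
    moreover have "hyp_dist u v \<le> hyp_dist z u + hyp_dist z v"
      using hyp_dist_triangle[OF u(1) z v(1)] hyp_dist_commute[of u z] by simp
    ultimately show False using e[OF gc(1) g1] g(2) u(2) v(2) by linarith
  qed
qed

lemma uniformizes_ball:
  assumes Y: "uniformizes G Y q" and G: "subgroup G PSL2R" "G \<subseteq> \<Gamma>" and z: "z \<in> UHP"
  shows "{y \<in> mspace Y. mdist Y (q z) y < e} = q ` {w \<in> UHP. hyp_dist z w < e}"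
proof (intro equalityI subsetI)
  fix y assume "y \<in> {y \<in> mspace Y. mdist Y (q z) y < e}"
  then obtain w where w: "w \<in> UHP" "y = q w" "mdist Y (q z) (q w) < e" using uniformizes_surj[OF Y] by auto
  then obtain g where g: "g \<in> G" "hyp_dist z (hact g w) < e" using uniformizes_less[OF Y z w(1)] by auto
  have gw: "hact g w \<in> UHP" using g G \<Gamma>_carrier w hact_UHP by auto
  then have "q (hact g w) = q w" using uniformizes_eq_iff[OF Y G gw w(1)] g by blast
  then show "y \<in> q ` {w \<in> UHP. hyp_dist z w < e}" using gw g w by (intro image_eqI[of _ q "hact g w"]) auto
next
  fix y assume "y \<in> q ` {w \<in> UHP. hyp_dist z w < e}"
  then obtain w where w: "w \<in> UHP" "hyp_dist z w < e" "y = q w" by auto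
  then have "\<exists>g\<in>G. hyp_dist z (hact g w) < e"
    using subgroup.one_closed[OF G(1)] by (intro bexI[of _ "\<one>\<^bsub>PSL2R\<^esub>"]) auto
  then have "mdist Y (q z) (q w) < e" using uniformizes_less[OF Y z w(1)] by blast
  then show "y \<in> {y \<in> mspace Y. mdist Y (q z) y < e}"
    using w uniformizes_mem[OF Y w(1)] by auto
qed

text \<open>The uniformization is a covering with simply transitive action of the free group on its fibres;
  the Euler characteristic of the quotient is then at least that of a bouquet of \<open>r\<close> circles.\<close>

lemma \<Gamma>_uniformizes_euler:
  assumes X: "uniformizes \<Gamma> X q"
  shows "euler_characteristic (mtopology_of X) \<ge> 1 - int r"
proof -
  note G = \<Gamma>_subgroup order_refl[of \<Gamma>]
  have top: "top_of_set UHP = mtopology_of (submetric euclidean_metric UHP)"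
    by (simp add: mtopology_of_submetric)
  interpret free_quotient "top_of_set UHP" "mtopology_of X" q T r
  proof
    show "contractible_space (top_of_set UHP)"
      using convex_imp_contractible[OF convex_UHP] by simp
    show "continuous_map (top_of_set UHP) (mtopology_of X) q"
      unfolding top continuous_map_mtopology_of
    proof (intro conjI ballI allI impI)
      show "q ` mspace (submetric euclidean_metric UHP) \<subseteq> mspace X"
        using uniformizes_mem[OF X] by auto
      fix z and \<epsilon> :: real assume "z \<in> mspace (submetric euclidean_metric UHP)" and \<epsilon>: "\<epsilon> > 0"
      then have z: "z \<in> UHP" by simp
      obtain d where d: "d > 0" "\<And>w. cmod (z - w) < d \<Longrightarrow> w \<in> UHP \<and> hyp_dist z w < \<epsilon>"
        using ball_in_hyp_ball[OF z \<epsilon>] by blast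
      have "mdist X (q z) (q w) < \<epsilon>" if "cmod (z - w) < d" for w
        using uniformizes_ball[OF X G z, of \<epsilon>] d(2)[OF that] by blast
      then show "\<exists>\<delta>>0. \<forall>x. x \<in> mspace (submetric euclidean_metric UHP) \<and>
          mdist (submetric euclidean_metric UHP) z x < \<delta> \<longrightarrow> mdist X (q z) (q x) < \<epsilon>"
        using d(1) by (intro exI[of _ d]) (auto simp: dist_norm)
    qed
  next
    fix i assume i: "i \<in> I"
    obtain A where A: "det A = 1" "S i = psl A" using S_carrier[OF i] by (rule PSL2R_cases)
    have "continuous_on UHP (\<lambda>z. (of_real (A$1$1) * z + of_real (A$1$2)) / (of_real (A$2$1) * z + of_real (A$2$2)))"
      using denominator_nonzero[OF A(1)] by (intro continuous_intros) auto
    then have "continuous_on UHP (T i)"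
      by (rule continuous_on_eq) (simp add: A hact_psl)
    then show "continuous_map (top_of_set UHP) (top_of_set UHP) (T i)"
      using T_UHP[OF i] by (auto simp: continuous_map_in_subtopology)
    show "T i (T (- i) z) = z" if "z \<in> topspace (top_of_set UHP)" for z using T_uminus[OF i] that by simp
    show "q (T i z) = q z" if "z \<in> topspace (top_of_set UHP)" for z
      using that uniformizes_eq_iff[OF X G T_UHP[OF i] , of z z] S_in_\<Gamma>[OF i] by auto
  next
    fix y z assume "y \<in> topspace (top_of_set UHP)" "z \<in> topspace (top_of_set UHP)" "q y = q z"
    then have yz: "y \<in> UHP" "z \<in> UHP" "q z = q y" by auto
    then obtain g where "g \<in> \<Gamma>" "hact g y = z" using uniformizes_eq_iff[OF X G yz(2,1)] by auto
    moreover from this obtain w where "reduced_word r w" "g = word_elt w" using \<Gamma>_words by blast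
    ultimately show "\<exists>w. reduced_word r w \<and> z = foldr T w y"
      using hact_word_elt[OF reduced_set yz(1)] by auto
  next
    fix z v w assume "z \<in> topspace (top_of_set UHP)" and r: "reduced_word r v" "reduced_word r w"
      and eq: "foldr T v z = foldr T w z"
    then have z: "z \<in> UHP" by simp
    let ?v = "word_elt v" and ?w = "word_elt w"
    have \<Gamma>: "?v \<in> \<Gamma>" "?w \<in> \<Gamma>" using r reduced_set word_elt_\<Gamma> by auto
    then have c: "?v \<in> carrier PSL2R" "?w \<in> carrier PSL2R" using \<Gamma>_carrier by auto
    have "hact ?v z = hact ?w z" using eq r by (simp add: hact_word_elt reduced_set z)
    then have "hact (inv\<^bsub>PSL2R\<^esub> ?v \<otimes>\<^bsub>PSL2R\<^esub> ?w) z = z"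
      using c z hact_inv(1)[OF c(1) z] by (simp add: hact_mult)
    then have "inv\<^bsub>PSL2R\<^esub> ?v \<otimes>\<^bsub>PSL2R\<^esub> ?w = \<one>\<^bsub>PSL2R\<^esub>"
      using \<Gamma> z \<Gamma>_subgroup by (intro free_action) (auto intro: subgroup.m_closed subgroup.m_inv_closed)
    then have "?v = ?w" using c by (metis PSL.inv_closed PSL.inv_equality PSL.inv_inv)
    then show "v = w" using word_elt_inj r by blast
  next
    fix z assume "z \<in> topspace (top_of_set UHP)"
    then have z: "z \<in> UHP" by simp
    obtain e where e: "e > 0" "\<And>g. \<lbrakk>g \<in> \<Gamma>; g \<noteq> \<one>\<^bsub>PSL2R\<^esub>\<rbrakk> \<Longrightarrow> hyp_dist z (hact g z) \<ge> 4 * e"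
      using injectivity_radius[OF z] by blast
    let ?V = "{w \<in> UHP. hyp_dist z w < e}"
    have "open ?V" unfolding open_dist
    proof
      fix y assume y: "y \<in> ?V"
      then obtain d where d: "d > 0" "\<And>w. cmod (y - w) < d \<Longrightarrow> w \<in> UHP \<and> hyp_dist y w < e - hyp_dist z y"
        using ball_in_hyp_ball[of y "e - hyp_dist z y"] by auto
      have "w \<in> ?V" if "dist w y < d" for w
      proof -
        have w: "w \<in> UHP" "hyp_dist y w < e - hyp_dist z y"
          using d(2)[of w] that by (auto simp: dist_norm norm_minus_commute)
        then show ?thesis using hyp_dist_triangle[OF z _ w(1), of y] y by auto
      qed
      then show "\<exists>e'>0. \<forall>w. dist w y < e' \<longrightarrow> w \<in> ?V" using d(1) by blast
    qed
    then have "openin (top_of_set UHP) ?V" by (intro open_subset) auto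
    moreover have "z \<in> ?V" using z e(1) hyp_dist_zero_iff[OF z z] by simp
    moreover have "w = []" if w: "reduced_word r w" "y \<in> ?V" "foldr T w y \<in> ?V" for w y
    proof (rule ccontr)
      assume "w \<noteq> []"
      then have ne: "word_elt w \<noteq> \<one>\<^bsub>PSL2R\<^esub>" using word_elt_inj[OF w(1), of "[]"] by auto
      let ?g = "word_elt w"
      have g: "?g \<in> \<Gamma>" "?g \<in> carrier PSL2R" using w reduced_set word_elt_\<Gamma> word_elt_carrier by auto
      have y: "y \<in> UHP" "hyp_dist z y < e" using w by auto
      have gy: "hact ?g y \<in> UHP" "hyp_dist z (hact ?g y) < e" using w y by (auto simp: hact_word_elt reduced_set)
      have "hyp_dist z (hact ?g z) \<le> hyp_dist z (hact ?g y) + hyp_dist (hact ?g y) (hact ?g z)"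
        by (rule hyp_dist_triangle[OF z gy(1) hact_UHP[OF g(2) z]])
      also have "hyp_dist (hact ?g y) (hact ?g z) = hyp_dist z y"
        using hyp_dist_hact[OF g(2) y(1) z] hyp_dist_commute by simp
      finally show False using e(2)[OF g(1) ne] gy(2) y(2) e(1) by linarith
    qed
    ultimately show "\<exists>V. openin (top_of_set UHP) V \<and> z \<in> V \<and>
        (\<forall>w y. reduced_word r w \<longrightarrow> y \<in> V \<longrightarrow> foldr T w y \<in> V \<longrightarrow> w = [])" by blast
  next
    fix x assume "x \<in> topspace (mtopology_of X)"
    then obtain z where z: "z \<in> UHP" "x = q z" using uniformizes_surj[OF X] by auto
    obtain e where e: "e > 0" "\<And>g. \<lbrakk>g \<in> \<Gamma>; g \<noteq> \<one>\<^bsub>PSL2R\<^esub>\<rbrakk> \<Longrightarrow> hyp_dist z (hact g z) \<ge> 4 * e"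
      using injectivity_radius[OF z(1)] by blast
    let ?U = "{y \<in> mspace X. mdist X x y < e}"
    define s where "s y = (SOME w. w \<in> UHP \<and> hyp_dist z w < e \<and> q w = y)" for y
    have s: "s y \<in> UHP" "hyp_dist z (s y) < e" "q (s y) = y" if "y \<in> ?U" for y
    proof -
      have "y \<in> q ` {w \<in> UHP. hyp_dist z w < e}" using uniformizes_ball[OF X G z(1), of e] that z(2) by simp
      then have "\<exists>w. w \<in> UHP \<and> hyp_dist z w < e \<and> q w = y" by blast
      from someI_ex[OF this] show "s y \<in> UHP" "hyp_dist z (s y) < e" "q (s y) = y" by (auto simp: s_def)
    qed
    have iso: "hyp_dist (s y) (s y') = mdist X y y'" if "y \<in> ?U" "y' \<in> ?U" for y y'
      using local_isometry[OF X G z(1) e(2) s(1,2)[OF that(1)] s(1,2)[OF that(2)]] s(3) that by simp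
    have "continuous_map (subtopology (mtopology_of X) ?U) (top_of_set UHP) s"
      unfolding top mtopology_of_submetric[symmetric, of X] continuous_map_mtopology_of
    proof (intro conjI ballI allI impI)
      show "s ` mspace (submetric X ?U) \<subseteq> mspace (submetric euclidean_metric UHP)" using s(1) by auto
      fix a and \<epsilon> :: real assume "a \<in> mspace (submetric X ?U)" and \<epsilon>: "\<epsilon> > 0"
      then have a: "a \<in> ?U" by simp
      obtain d where d: "d > 0" "\<And>w. \<lbrakk>w \<in> UHP; hyp_dist (s a) w < d\<rbrakk> \<Longrightarrow> cmod (s a - w) < \<epsilon>"
        using hyp_ball_in_ball[OF s(1)[OF a] \<epsilon>] by blast
      have "dist (s a) (s y) < \<epsilon>" if "y \<in> ?U" "mdist X a y < d" for y
        using d(2)[OF s(1)[OF that(1)]] iso[OF a that(1)] that(2) by (simp add: dist_norm)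
      then show "\<exists>\<delta>>0. \<forall>y. y \<in> mspace (submetric X ?U) \<and> mdist (submetric X ?U) a y < \<delta> \<longrightarrow>
          mdist (submetric euclidean_metric UHP) (s a) (s y) < \<epsilon>"
        using d(1) by (intro exI[of _ d]) auto
    qed
    moreover have x: "x \<in> mspace X" using z uniformizes_mem[OF X] by simp
    moreover have "openin (mtopology_of X) ?U" by (rule openin_mtopology_of_ball[OF x])
    moreover have "x \<in> ?U" using x e(1) by (simp add: mdist_self)
    ultimately show "\<exists>U s. openin (mtopology_of X) U \<and> x \<in> U \<and>
          continuous_map (subtopology (mtopology_of X) U) (top_of_set UHP) s \<and> (\<forall>y\<in>U. q (s y) = y)"
      using s(3) by blast
  qed
  show ?thesis
  proof (rule euler_characteristic_ge)
    show "topspace (top_of_set UHP) \<noteq> {}" using base_UHP by auto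
    show "q ` topspace (top_of_set UHP) = topspace (mtopology_of X)"
      using X by (simp add: uniformizes_def)
  qed
qed

end

subsection \<open>Coverings by quotients of subgroups\<close>

context schottky
begin

text \<open>Both quotients of the half-plane are isometric to it on balls of a radius \<open>e\<close> that depends on the
  larger group only, so the sheets over such a ball are the balls around the preimages of its centre.\<close>

lemma uniformized_covering:
  assumes C: "uniformizes G C qC" and G: "subgroup G PSL2R" "G \<subseteq> \<Gamma>" and X: "uniformizes \<Gamma> X qX"
  shows "covers C X"
proof -
  note \<Gamma> = \<Gamma>_subgroup order_refl[of \<Gamma>]
  define p where "p y = qX (SOME z. z \<in> UHP \<and> qC z = y)" for y
  have p: "p (qC z) = qX z" if z: "z \<in> UHP" for z
  proof -
    let ?w = "SOME w. w \<in> UHP \<and> qC w = qC z"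
    have "\<exists>w. w \<in> UHP \<and> qC w = qC z" using z by blast
    from someI_ex[OF this] have w: "?w \<in> UHP" "qC ?w = qC z" by auto
    then have "\<exists>g\<in>\<Gamma>. hact g z = ?w" using uniformizes_eq_iff[OF C G w(1) z] G(2) by blast
    then show ?thesis unfolding p_def using uniformizes_eq_iff[OF X \<Gamma> w(1) z] by simp
  qed
  have img: "p ` mspace C = mspace X"
    using C X p unfolding uniformizes_def by (metis (no_types, lifting) image_cong image_image)
  have ball: "p ` {y \<in> mspace C. mdist C (qC z) y < e} = {x \<in> mspace X. mdist X (qX z) x < e}" if z: "z \<in> UHP" for z e
    unfolding uniformizes_ball[OF C G z] uniformizes_ball[OF X \<Gamma> z] image_image
    using p by (intro image_cong) auto
  have iso: "mdist X (p y) (p y') = mdist C y y'"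
    if z: "z \<in> UHP" and e: "\<And>g. \<lbrakk>g \<in> \<Gamma>; g \<noteq> \<one>\<^bsub>PSL2R\<^esub>\<rbrakk> \<Longrightarrow> hyp_dist z (hact g z) \<ge> 4 * e"
      and y: "y \<in> mspace C" "mdist C (qC z) y < e" and y': "y' \<in> mspace C" "mdist C (qC z) y' < e" for z e y y'
  proof -
    have "y \<in> qC ` {w \<in> UHP. hyp_dist z w < e}" "y' \<in> qC ` {w \<in> UHP. hyp_dist z w < e}"
      using y y' uniformizes_ball[OF C G z, of e] by auto
    then obtain u u' where u: "u \<in> UHP" "hyp_dist z u < e" "y = qC u"
      and u': "u' \<in> UHP" "hyp_dist z u' < e" "y' = qC u'" by blast
    show ?thesis
      using local_isometry[OF C G z e u(1,2) u'(1,2)] local_isometry[OF X \<Gamma> z e u(1,2) u'(1,2)] u u' p by simp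
  qed
  have "hyperbolic_covering C X p"
    unfolding hyperbolic_covering_def covering_map_def topspace_mtopology_of
  proof (intro conjI ballI)
    show "continuous_map (mtopology_of C) (mtopology_of X) p"
      unfolding continuous_map_mtopology_of
    proof (intro conjI ballI allI impI)
      show "p ` mspace C \<subseteq> mspace X" using img by simp
      fix a and \<epsilon> :: real assume a: "a \<in> mspace C" and \<epsilon>: "\<epsilon> > 0"
      then obtain z where z: "z \<in> UHP" "a = qC z" using uniformizes_surj[OF C] by blast
      have "mdist X (p a) (p x) < \<epsilon>" if "x \<in> mspace C" "mdist C a x < \<epsilon>" for x
        using ball[OF z(1), of \<epsilon>] that z p by auto
      then show "\<exists>\<delta>>0. \<forall>x. x \<in> mspace C \<and> mdist C a x < \<delta> \<longrightarrow> mdist X (p a) (p x) < \<epsilon>"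
        using \<epsilon> by blast
    qed
    show "p ` mspace C = mspace X" by (rule img)
  next
    fix x assume x: "x \<in> mspace X"
    then obtain z where z: "z \<in> UHP" "x = qX z" using uniformizes_surj[OF X] by blast
    obtain e where e: "e > 0" "\<And>g. \<lbrakk>g \<in> \<Gamma>; g \<noteq> \<one>\<^bsub>PSL2R\<^esub>\<rbrakk> \<Longrightarrow> hyp_dist z (hact g z) \<ge> 4 * e"
      using injectivity_radius[OF z(1)] by blast
    let ?T = "{y \<in> mspace X. mdist X x y < e}"
    let ?B = "\<lambda>g. {y \<in> mspace C. mdist C (qC (hact g z)) y < e}"
    let ?V = "?B ` \<Gamma>"
    have gz: "hact g z \<in> UHP" "qX (hact g z) = x" if "g \<in> \<Gamma>" for g
    proof -
      show "hact g z \<in> UHP" using that \<Gamma>_carrier hact_UHP z(1) by blast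
      then show "qX (hact g z) = x" using uniformizes_eq_iff[OF X \<Gamma> _ z(1)] that z(2) by blast
    qed
    have e': "hyp_dist (hact h z) (hact g (hact h z)) \<ge> 4 * e"
      if h: "h \<in> \<Gamma>" and g: "g \<in> \<Gamma>" "g \<noteq> \<one>\<^bsub>PSL2R\<^esub>" for g h
    proof -
      have c: "g \<in> carrier PSL2R" "h \<in> carrier PSL2R" using g h \<Gamma>_carrier by auto
      let ?k = "inv\<^bsub>PSL2R\<^esub> h \<otimes>\<^bsub>PSL2R\<^esub> (g \<otimes>\<^bsub>PSL2R\<^esub> h)"
      have k: "?k \<in> \<Gamma>" using g h \<Gamma>_subgroup by (simp add: subgroup.m_closed subgroup.m_inv_closed)
      have hk: "h \<otimes>\<^bsub>PSL2R\<^esub> ?k = g \<otimes>\<^bsub>PSL2R\<^esub> h" using c by (simp flip: PSL.m_assoc)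
      have "?k \<noteq> \<one>\<^bsub>PSL2R\<^esub>"
      proof
        assume "?k = \<one>\<^bsub>PSL2R\<^esub>"
        then have "h = g \<otimes>\<^bsub>PSL2R\<^esub> h" using hk c by simp
        then show False using c g(2) by simp
      qed
      then have "4 * e \<le> hyp_dist z (hact ?k z)" using e(2) k by blast
      also have "\<dots> = hyp_dist (hact h z) (hact h (hact ?k z))"
        using hyp_dist_hact[OF c(2) z(1) gz(1)[OF k]] by simp
      also have "hact h (hact ?k z) = hact g (hact h z)"
        using hk c z(1) by (simp flip: hact_mult)
      finally show ?thesis .
    qed
    show "\<exists>T. x \<in> T \<and> openin (mtopology_of X) T \<and>
        (\<exists>\<V>. \<Union>\<V> = mspace C \<inter> p -` T \<and> (\<forall>U\<in>\<V>. openin (mtopology_of C) U) \<and> pairwise disjnt \<V> \<and>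
             (\<forall>U\<in>\<V>. homeomorphic_map (subtopology (mtopology_of C) U) (subtopology (mtopology_of X) T) p))"
    proof (intro exI[of _ ?T] exI[of _ ?V] conjI)
      show "x \<in> ?T" using x e(1) by (simp add: mdist_self)
      show "openin (mtopology_of X) ?T" by (rule openin_mtopology_of_ball[OF x])
      show "\<forall>U\<in>?V. openin (mtopology_of C) U"
        using gz(1) uniformizes_mem[OF C] by (auto intro!: openin_mtopology_of_ball)
      show "\<Union>?V = mspace C \<inter> p -` ?T"
      proof (intro equalityI subsetI)
        fix y assume "y \<in> \<Union>?V"
        then obtain g where g: "g \<in> \<Gamma>" "y \<in> ?B g" by blast
        then have "p y \<in> ?T" using ball[OF gz(1)[OF g(1)], of e] gz(2)[OF g(1)] by blast
        then show "y \<in> mspace C \<inter> p -` ?T" using g by blast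
      next
        fix y assume y: "y \<in> mspace C \<inter> p -` ?T"
        then obtain w where w: "w \<in> UHP" "y = qC w" using uniformizes_surj[OF C] by blast
        then have "mdist X (qX w) (qX z) < e" using y p z(2) by (simp add: mdist_commute)
        then obtain g where g: "g \<in> \<Gamma>" "hyp_dist w (hact g z) < e" using uniformizes_less[OF X w(1) z(1)] by blast
        then have "y \<in> qC ` {w \<in> UHP. hyp_dist (hact g z) w < e}" using w by (auto simp: hyp_dist_commute)
        then have "y \<in> ?B g" using uniformizes_ball[OF C G gz(1)[OF g(1)], of e] by simp
        then show "y \<in> \<Union>?V" using g(1) by blast
      qed
      show "pairwise disjnt ?V"
      proof (rule pairwiseI)
        fix U U' assume "U \<in> ?V" "U' \<in> ?V" and ne: "U \<noteq> U'"
        then obtain g g' where g: "g \<in> \<Gamma>" "U = ?B g" and g': "g' \<in> \<Gamma>" "U' = ?B g'" by blast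
        show "disjnt U U'"
        proof (rule ccontr)
          assume "\<not> disjnt U U'"
          then obtain y where "y \<in> U" "y \<in> U'" by (auto simp: disjnt_def)
          then have "y \<in> qC ` {w \<in> UHP. hyp_dist (hact g z) w < e}" "y \<in> qC ` {w \<in> UHP. hyp_dist (hact g' z) w < e}"
            using g g' uniformizes_ball[OF C G gz(1)[OF g(1)], of e] uniformizes_ball[OF C G gz(1)[OF g'(1)], of e] by simp_all
          then obtain w w' where w: "w \<in> UHP" "hyp_dist (hact g z) w < e" "y = qC w"
            and w': "w' \<in> UHP" "hyp_dist (hact g' z) w' < e" "y = qC w'" by blast
          then obtain h where h: "h \<in> G" "hact h w' = w" using uniformizes_eq_iff[OF C G w(1) w'(1)] by auto
          have h\<Gamma>: "h \<in> \<Gamma>" "h \<in> carrier PSL2R" using h G \<Gamma>_carrier by auto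
          let ?k = "h \<otimes>\<^bsub>PSL2R\<^esub> g' \<otimes>\<^bsub>PSL2R\<^esub> inv\<^bsub>PSL2R\<^esub> g"
          have c: "g \<in> carrier PSL2R" "g' \<in> carrier PSL2R" using g g' \<Gamma>_carrier by auto
          have k: "?k \<in> \<Gamma>" using h\<Gamma> g g' \<Gamma>_subgroup by (simp add: subgroup.m_closed subgroup.m_inv_closed)
          have kg: "hact ?k (hact g z) = hact h (hact g' z)"
            using c h\<Gamma> z(1) by (simp add: hact_mult hact_inv hact_UHP)
          have hU: "hact h (hact g' z) \<in> UHP" using hact_UHP[OF h\<Gamma>(2) gz(1)[OF g'(1)]] .
          have "hyp_dist (hact h (hact g' z)) w = hyp_dist (hact g' z) w'"
            using hyp_dist_hact[OF h\<Gamma>(2) gz(1)[OF g'(1)] w'(1)] h(2) by simp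
          then have "hyp_dist (hact g z) (hact ?k (hact g z)) < 2 * e"
            using hyp_dist_triangle[OF gz(1)[OF g(1)] w(1) hU] w(2) w'(2) hyp_dist_commute kg by (smt (verit))
          then have "?k = \<one>\<^bsub>PSL2R\<^esub>" using e'[OF g(1) k] e(1) by force
          then have "hact h (hact g' z) = hact g z" using kg by simp
          then have "qC (hact g z) = qC (hact g' z)"
            using uniformizes_eq_iff[OF C G gz(1)[OF g(1)] gz(1)[OF g'(1)]] h(1) by blast
          then show False using ne g g' by simp
        qed
      qed
      show "\<forall>U\<in>?V. homeomorphic_map (subtopology (mtopology_of C) U) (subtopology (mtopology_of X) ?T) p"
      proof
        fix U assume "U \<in> ?V"
        then obtain g where g: "g \<in> \<Gamma>" "U = ?B g" by blast
        note g_iso = iso[OF gz(1)[OF g(1)] e'[OF g(1)]]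
        have "inj_on p U"
        proof (rule inj_onI)
          fix y y' assume y: "y \<in> U" "y' \<in> U" "p y = p y'"
          have "mdist C y y' = mdist X (p y) (p y')" using g_iso[of y y'] g(2) y(1,2) by simp
          also have "p y \<in> mspace X" using y img g(2) by blast
          then have "mdist X (p y) (p y') = 0" using y(3) by simp
          finally show "y = y'" using y g(2) by simp
        qed
        moreover have "p ` U = ?T" using ball[OF gz(1)[OF g(1)], of e] gz(2)[OF g(1)] g(2) by simp
        ultimately have "bij_betw p U ?T" by (simp add: bij_betw_def)
        then show "homeomorphic_map (subtopology (mtopology_of C) U) (subtopology (mtopology_of X) ?T) p"
          using g_iso g(2) by (intro isometric_bij_homeomorphic) auto
      qed
    qed
  next
    fix y assume y: "y \<in> mspace C"
    then obtain z where z: "z \<in> UHP" "y = qC z" using uniformizes_surj[OF C] by blast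
    obtain e where e: "e > 0" "\<And>g. \<lbrakk>g \<in> \<Gamma>; g \<noteq> \<one>\<^bsub>PSL2R\<^esub>\<rbrakk> \<Longrightarrow> hyp_dist z (hact g z) \<ge> 4 * e"
      using injectivity_radius[OF z(1)] by blast
    show "\<exists>e>0. \<forall>u\<in>mspace C. \<forall>v\<in>mspace C. mdist C y u < e \<longrightarrow> mdist C y v < e \<longrightarrow>
        mdist X (p u) (p v) = mdist C u v"
      using iso[OF z(1) e(2)] e(1) z(2) by blast
  qed
  then show ?thesis unfolding covers_def by blast
qed

text \<open>Different orbits have positive distance because only finitely many points of an orbit lie in a ball.\<close>

lemma quotient_metric:
  assumes G: "subgroup G PSL2R" "G \<subseteq> \<Gamma>"
  obtains C :: "complex set metric" where "isometric_to_quotient C G"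
proof -
  let ?M = "orbit_space G"
  define d where "d P Q = (if P \<in> ?M \<and> Q \<in> ?M then orbit_dist P Q else 0)" for P Q
  have c: "g \<in> carrier PSL2R" if "g \<in> G" for g using that G \<Gamma>_carrier by blast
  have less: "d (orbit_of G z) (orbit_of G w) < R \<longleftrightarrow> (\<exists>g\<in>G. hyp_dist z (hact g w) < R)"
    if "z \<in> UHP" "w \<in> UHP" for z w R
    using orbit_dist_less[OF G(1) that] that by (simp add: d_def orbit_space_def)
  have nonneg: "0 \<le> d P Q" for P Q
  proof (cases "P \<in> ?M \<and> Q \<in> ?M")
    case True
    then obtain z w where zw: "z \<in> UHP" "w \<in> UHP" "P = orbit_of G z" "Q = orbit_of G w"
      by (auto simp: orbit_space_def)
    have "0 \<le> hyp_dist z (hact g w)" if "g \<in> G" for g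
      using hyp_dist_nonneg[OF zw(1) hact_UHP[OF c[OF that] zw(2)]] .
    then have "\<not> d P Q < 0" using less[OF zw(1,2), of 0] zw(3,4) by fastforce
    then show ?thesis by simp
  qed (auto simp: d_def)
  have le: "d (orbit_of G w) (orbit_of G z) \<le> d (orbit_of G z) (orbit_of G w)"
    if zw: "z \<in> UHP" "w \<in> UHP" for z w
  proof (rule field_le_epsilon)
    fix e :: real assume "e > 0"
    then obtain g where g: "g \<in> G" "hyp_dist z (hact g w) < d (orbit_of G z) (orbit_of G w) + e"
      using less[OF zw, of "d (orbit_of G z) (orbit_of G w) + e"] by auto
    let ?h = "inv\<^bsub>PSL2R\<^esub> g"
    have h: "?h \<in> G" using g G(1) by (simp add: subgroup.m_inv_closed)
    have "hyp_dist z (hact g w) = hyp_dist (hact ?h z) (hact ?h (hact g w))"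
      using hyp_dist_hact[OF c[OF h] zw(1) hact_UHP[OF c[OF g(1)] zw(2)]] by simp
    also have "\<dots> = hyp_dist w (hact ?h z)" using hact_inv(1)[OF c[OF g(1)] zw(2)] by (simp add: hyp_dist_commute)
    finally show "d (orbit_of G w) (orbit_of G z) \<le> d (orbit_of G z) (orbit_of G w) + e"
      using less[OF zw(2,1)] g(2) h by (metis less_imp_le)
  qed
  interpret M: Metric_space ?M d
  proof
    show "0 \<le> d P Q" for P Q by (rule nonneg)
    show "d P Q = d Q P" for P Q
    proof (cases "P \<in> ?M \<and> Q \<in> ?M")
      case True
      then obtain z w where zw: "z \<in> UHP" "w \<in> UHP" "P = orbit_of G z" "Q = orbit_of G w"
        by (auto simp: orbit_space_def)
      show ?thesis using le[OF zw(1,2)] le[OF zw(2,1)] zw(3,4) by simp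
    qed (auto simp: d_def)
    show "d P Q = 0 \<longleftrightarrow> P = Q" if PQ: "P \<in> ?M" "Q \<in> ?M" for P Q
    proof -
      obtain z w where zw: "z \<in> UHP" "w \<in> UHP" "P = orbit_of G z" "Q = orbit_of G w"
        using PQ by (auto simp: orbit_space_def)
      show ?thesis
      proof
        assume "d P Q = 0"
        then have "\<exists>g\<in>G. hact g w = z"
          using less[OF zw(1,2)] zw(3,4) by (intro orbit_distance_zero[OF zw(1,2) G(2)]) auto
        then obtain g where g: "g \<in> G" "hact g w = z" by blast
        have sub: "subgroup G PSL2R" by (rule G(1))
        have Gc: "G \<subseteq> carrier PSL2R" using c by blast
        have "hact h z \<in> (\<lambda>g. hact g w) ` G" if "h \<in> G" for h
          using that g c zw(2) subgroup.m_closed[OF sub that g(1)] by (intro image_eqI[of _ _ "h \<otimes>\<^bsub>PSL2R\<^esub> g"]) (auto simp: hact_mult)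
        moreover have "hact h w \<in> (\<lambda>g. hact g z) ` G" if "h \<in> G" for h
        proof (rule image_eqI[of _ _ "h \<otimes>\<^bsub>PSL2R\<^esub> inv\<^bsub>PSL2R\<^esub> g"])
          show "h \<otimes>\<^bsub>PSL2R\<^esub> inv\<^bsub>PSL2R\<^esub> g \<in> G" using that g(1) sub by (simp add: subgroup.m_closed subgroup.m_inv_closed)
          show "hact h w = hact (h \<otimes>\<^bsub>PSL2R\<^esub> inv\<^bsub>PSL2R\<^esub> g) z"
            using that g c zw by (simp add: hact_mult hact_inv flip: g(2))
        qed
        ultimately show "P = Q" unfolding zw(3,4) orbit_of_eq[OF Gc zw(1)] orbit_of_eq[OF Gc zw(2)] by blast
      next
        assume "P = Q"
        have "\<exists>g\<in>G. hyp_dist z (hact g z) < e" if "e > 0" for e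
          using subgroup.one_closed[OF G(1)] that hyp_dist_zero_iff[OF zw(1) zw(1)] by (intro bexI[of _ "\<one>\<^bsub>PSL2R\<^esub>"]) auto
        then have "d P P < e" if "e > 0" for e using less[OF zw(1) zw(1)] zw(3) that by simp
        then have "d P P \<le> 0" using not_less by blast
        then show "d P Q = 0" using nonneg[of P P] \<open>P = Q\<close> by simp
      qed
    qed
    show "d P R \<le> d P Q + d Q R" if PQR: "P \<in> ?M" "Q \<in> ?M" "R \<in> ?M" for P Q R
    proof (rule field_le_epsilon)
      fix e :: real assume e: "e > 0"
      obtain x y z where xyz: "x \<in> UHP" "y \<in> UHP" "z \<in> UHP" "P = orbit_of G x" "Q = orbit_of G y" "R = orbit_of G z"
        using PQR by (auto simp: orbit_space_def)
      obtain g where g: "g \<in> G" "hyp_dist x (hact g y) < d P Q + e / 2"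
        using less[OF xyz(1,2), of "d P Q + e / 2"] e xyz by auto
      obtain h where h: "h \<in> G" "hyp_dist y (hact h z) < d Q R + e / 2"
        using less[OF xyz(2,3), of "d Q R + e / 2"] e xyz by auto
      let ?k = "g \<otimes>\<^bsub>PSL2R\<^esub> h"
      have k: "?k \<in> G" using g h G(1) by (simp add: subgroup.m_closed)
      have gU: "hact g y \<in> UHP" "hact h z \<in> UHP" using g h c hact_UHP xyz by auto
      have kz: "hact ?k z = hact g (hact h z)" using c g h xyz by (simp add: hact_mult)
      have "hyp_dist x (hact ?k z) \<le> hyp_dist x (hact g y) + hyp_dist (hact g y) (hact ?k z)"
        unfolding kz by (intro hyp_dist_triangle hact_UHP c[OF g(1)] gU xyz(1-3))
      also have "hyp_dist (hact g y) (hact ?k z) = hyp_dist y (hact h z)"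
        unfolding kz using hyp_dist_hact[OF c[OF g(1)] xyz(2) gU(2)] .
      finally have "hyp_dist x (hact ?k z) < d P Q + d Q R + e" using g h by simp
      then show "d P R \<le> d P Q + d Q R + e" using less[OF xyz(1,3)] k xyz by (metis less_imp_le)
    qed
  qed
  have "isometric_to_quotient (metric (?M, d)) G"
    unfolding isometric_to_quotient_def
    by (intro exI[of _ id]) (auto simp: bij_betw_def d_def)
  then show ?thesis using that by blast
qed

end

section \<open>Generators of Schottky groups are hyperbolic\<close>

lemma quadratic_nonpos_leading:
  fixes \<alpha> \<beta> \<gamma> :: real
  assumes "\<And>k::nat. k \<ge> 1 \<Longrightarrow> \<alpha> + \<beta> * real k + \<gamma> * (real k)\<^sup>2 \<le> 0"
  shows "\<gamma> \<le> 0"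
proof (rule ccontr)
  assume "\<not> \<gamma> \<le> 0"
  then have g: "\<gamma> > 0" by simp
  obtain k :: nat where k: "real k > (\<bar>\<alpha>\<bar> + \<bar>\<beta>\<bar>) / \<gamma> + 1" using reals_Archimedean2 by blast
  have "(\<bar>\<alpha>\<bar> + \<bar>\<beta>\<bar>) / \<gamma> \<ge> 0" using g by simp
  then have k1: "real k > 1" using k by linarith
  have "\<bar>\<alpha>\<bar> + \<bar>\<beta>\<bar> < \<gamma> * real k" using k g by (simp add: field_simps)
  then have "(\<bar>\<alpha>\<bar> + \<bar>\<beta>\<bar>) * real k < \<gamma> * real k * real k" using k1 by (intro mult_strict_right_mono) auto
  moreover have "\<bar>\<alpha>\<bar> * 1 \<le> \<bar>\<alpha>\<bar> * real k" using k1 by (intro mult_left_mono) auto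
  moreover have "- \<beta> * real k \<le> \<bar>\<beta>\<bar> * real k" by (intro mult_right_mono) auto
  ultimately have "0 < \<alpha> + \<beta> * real k + \<gamma> * (real k)\<^sup>2"
    by (simp add: power2_eq_square distrib_right)
  then show False using assms[of k] k1 by simp
qed

text \<open>The fixed points are the roots of \<open>c z\<^sup>2 + (d - a) z - b\<close>, whose discriminant is
  \<open>(a + d)\<^sup>2 - 4\<close>.\<close>

lemma elliptic_fixed_point:
  assumes A: "det A = 1" and t: "\<bar>A$1$1 + A$2$2\<bar> < 2"
  obtains z where "z \<in> UHP" "hact (psl A) z = z"
proof -
  define a b c d where abcd: "a = A$1$1" "b = A$1$2" "c = A$2$1" "d = A$2$2"
  have det: "a * d - b * c = 1" using A by (simp add: det_2 abcd)
  have t2: "(a + d)\<^sup>2 < 4" using t abs_square_less_1[of "(a + d) / 2"] by (simp add: abcd power_divide)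
  have c: "c \<noteq> 0"
  proof
    assume "c = 0"
    then have "(a + d)\<^sup>2 = (a - d)\<^sup>2 + 4" using det by (simp add: power2_eq_square algebra_simps)
    then show False using t2 by (smt (verit) zero_le_power2)
  qed
  define s where "s = sqrt (4 - (a + d)\<^sup>2)"
  have s: "s > 0" "s * s = 4 - (a + d)\<^sup>2" using t2 by (auto simp: s_def)
  define z where "z = Complex ((a - d) / (2 * c)) (s / (2 * \<bar>c\<bar>))"
  have z: "z \<in> UHP" using s c by (simp add: in_UHP z_def)
  have "(Re z)\<^sup>2 + (Im z)\<^sup>2 = ((a - d)\<^sup>2 + s * s) / (4 * c\<^sup>2)"
    using c by (simp add: z_def power_divide power_mult_distrib power2_eq_square add_divide_distrib)
  also have "(a - d)\<^sup>2 + s * s = - 4 * b * c"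
    unfolding s(2) using det by (simp add: power2_eq_square algebra_simps)
  finally have n: "(Re z)\<^sup>2 + (Im z)\<^sup>2 = - b / c" using c by (simp add: power2_eq_square)
  have "c * ((Re z)\<^sup>2 - (Im z)\<^sup>2) + (d - a) * Re z - b = 0"
  proof -
    have "c * ((Re z)\<^sup>2 - (Im z)\<^sup>2) = 2 * c * (Re z)\<^sup>2 - c * ((Re z)\<^sup>2 + (Im z)\<^sup>2)" by (simp add: algebra_simps)
    also have "\<dots> = (a - d) * Re z + b" unfolding n using c by (simp add: z_def power2_eq_square)
    finally show ?thesis by (simp add: algebra_simps)
  qed
  moreover have "2 * c * Re z * Im z + (d - a) * Im z = 0"
  proof -
    have 0: "2 * c * Re z = a - d" using c by (simp add: z_def)
    have "2 * c * Re z * Im z + (d - a) * Im z = (2 * c * Re z + (d - a)) * Im z" by (simp add: algebra_simps)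
    then show ?thesis unfolding 0 by simp
  qed
  ultimately have "of_real c * z * z + of_real (d - a) * z - of_real b = 0"
    by (simp add: complex_eq_iff power2_eq_square algebra_simps)
  then have "of_real a * z + of_real b = z * (of_real c * z + of_real d)"
    by (simp add: algebra_simps)
  then have "hact (psl A) z = z"
    using denominator_nonzero[OF A z] by (simp add: hact_psl[OF A z] abcd)
  then show ?thesis using that z by blast
qed

text \<open>The columns of \<open>P\<close> are eigenvectors of \<open>A\<close>.\<close>

lemma hyperbolic_diagonalizable:
  assumes A: "det A = 1" and t: "A$1$1 + A$2$2 > 2"
  obtains l P where "l > 0" "det P = 1" "A ** P = P ** mat2 (exp (l / 2)) 0 0 (exp (- (l / 2)))"
proof -
  define a b c d where abcd: "a = A$1$1" "b = A$1$2" "c = A$2$1" "d = A$2$2"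
  have det: "a * d = 1 + b * c" using A by (simp add: det_2 abcd)
  \<comment> \<open>The eigenvalues are \<open>exp (\<plusminus> l / 2)\<close>, so the trace is \<open>2 cosh (l / 2)\<close>.\<close>
  define l where "l = 2 * arcosh ((a + d) / 2)"
  have ch: "cosh (l / 2) = (a + d) / 2" using t by (simp add: l_def abcd)
  have "arcosh ((a + d) / 2) \<ge> 0" using t by (simp add: abcd arcosh_nonneg_real)
  moreover have "l \<noteq> 0" using ch t by (auto simp: abcd)
  ultimately have l: "l > 0" by (simp add: l_def)
  define x y where xy: "x = exp (l / 2)" "y = exp (- (l / 2))"
  have x: "x * y = 1" "x > y" using l by (auto simp: xy simp flip: exp_add)
  have tr: "x + y = a + d" using ch by (simp add: cosh_def xy)
  have ev: "a * e - 1 = e * e - d * e" if "e = x \<or> e = y" for e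
  proof -
    have "(e - x) * (e - y) = 0" using that by auto
    then have "e * e - e * (x + y) + x * y = 0" by (simp add: algebra_simps)
    then show ?thesis unfolding tr x by (simp add: algebra_simps)
  qed
  have "\<exists>P. det P = 1 \<and> A ** P = P ** mat2 x 0 0 y"
  proof (cases "c = 0")
    case False
    define k where "k = 1 / (c * (x - y))"
    have k: "k * (c * (x - y)) = 1" using False x by (simp add: k_def)
    let ?P = "mat2 ((x - d) * k) (y - d) (c * k) c"
    have "det ?P = k * (c * (x - y))" by (simp add: det_2 algebra_simps)
    moreover have "a * (e - d) + b * c = (e - d) * e" if "e = x \<or> e = y" for e
      using ev[OF that] det by (simp add: algebra_simps)
    then have 1: "a * (x - d) + b * c = (x - d) * x" "a * (y - d) + b * c = (y - d) * y" by auto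
    have "a * ((x - d) * k) + b * (c * k) = k * (a * (x - d) + b * c)" by (simp add: algebra_simps)
    then have "a * ((x - d) * k) + b * (c * k) = (x - d) * k * x" using 1 by simp
    then have "A ** ?P = ?P ** mat2 x 0 0 y"
      using 1 by (simp add: matrix22_eq_iff abcd[symmetric]) (simp add: algebra_simps)
    ultimately show ?thesis using k by (intro exI[of _ ?P]) simp
  next
    case True
    then have ad: "a * d = 1" using det by simp
    have "(a - x) * (a - y) = a * a - a * (x + y) + x * y" by (simp add: algebra_simps)
    also have "\<dots> = 0" unfolding tr x using ad by (simp add: algebra_simps)
    finally consider "a = x" | "a = y" by auto
    then show ?thesis
    proof cases
      case 1
      then have d: "d = y" using tr by simp
      let ?P = "mat2 (1 / (y - x)) b 0 (y - x)"
      have "det ?P = 1" "A ** ?P = ?P ** mat2 x 0 0 y"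
        using x True 1 d by (auto simp: det_2 matrix22_eq_iff abcd[symmetric] algebra_simps)
      then show ?thesis by blast
    next
      case 2
      then have d: "d = x" using tr by simp
      let ?P = "mat2 b (- 1 / (x - y)) (x - y) 0"
      have "det ?P = 1" "A ** ?P = ?P ** mat2 x 0 0 y"
        using x True 2 d by (auto simp: det_2 matrix22_eq_iff abcd[symmetric] algebra_simps)
      then show ?thesis by blast
    qed
  qed
  then show ?thesis using that l unfolding xy by blast
qed

context schottky
begin

lemma S_nontrivial: assumes "j \<in> I" shows "S j \<noteq> \<one>\<^bsub>PSL2R\<^esub>"
  using word_elt_inj[of "[j]" "[]"] assms by (auto simp: reduced_word_Cons)

text \<open>The powers of a parabolic generator would move the base point towards the fixed point
  in both directions, and that point would lie in both closed disks: the powers are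
  \<open>1 + k N\<close> with \<open>N\<^sup>2 = 0\<close>, and the form of each disk, evaluated at
  \<open>v + k N v\<close>, has leading coefficient its value at \<open>N v\<close>.\<close>

lemma generator_not_parabolic:
  assumes j: "j \<in> I" and A: "det A = 1" "S j = psl A" and tr: "A$1$1 + A$2$2 = 2"
  shows False
proof -
  define n1 n2 n3 where n: "n1 = A$1$1 - 1" "n2 = A$1$2" "n3 = A$2$1"
  have n4: "A$2$2 = 1 - n1" using tr by (simp add: n)
  have nil: "n1 * n1 + n2 * n3 = 0" using A(1) by (simp add: det_2 n4) (simp add: n algebra_simps)
  define M where "M s = mat2 (1 + s * n1) (s * n2) (s * n3) (1 - s * n1)" for s
  have det: "det (M s) = 1" for s
  proof -
    have "det (M s) = 1 - s * s * (n1 * n1 + n2 * n3)" by (simp add: M_def det_2 algebra_simps)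
    then show ?thesis using nil by simp
  qed
  have MM: "M s ** M t = M (s + t)" for s t
  proof -
    have "s * t * (n1 * n1 + n2 * n3) = 0" using nil by simp
    then have "(1 + s * n1) * (1 + t * n1) + s * n2 * (t * n3) = 1 + (s + t) * n1"
      "s * n3 * (t * n2) + (1 - s * n1) * (1 - t * n1) = 1 - (s + t) * n1"
      by (simp_all add: algebra_simps)
    then show ?thesis by (simp add: M_def matrix22_eq_iff) (simp add: algebra_simps)
  qed
  have M1: "A = M 1" "adj2 A = M (- 1)" by (simp_all add: M_def matrix22_eq_iff n n4)
  have SM: "S j = psl (M 1)" "S (- j) = psl (M (- 1))"
    using A M1 S_uminus(2)[OF j] by (simp_all add: psl_inv)
  have pow: "foldr T (replicate k i) base = hact (psl (M (real k * s))) base"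
    if "i \<in> I" "S i = psl (M s)" for k i s
  proof (induction k)
    case 0
    have "M 0 = mat 1" by (simp add: M_def matrix22_eq_iff)
    then show ?case by (simp flip: psl_one)
  next
    case (Suc k)
    have "hact (psl (M s) \<otimes>\<^bsub>PSL2R\<^esub> psl (M (real k * s))) base = T i (hact (psl (M (real k * s))) base)"
      using that(2) det base_UHP by (simp add: hact_mult)
    moreover have "psl (M s) \<otimes>\<^bsub>PSL2R\<^esub> psl (M (real k * s)) = psl (M (real (Suc k) * s))"
      by (simp add: psl_mult det MM algebra_simps)
    ultimately show ?case using Suc by simp
  qed
  let ?u = "of_real n1 * base + of_real n2" and ?v = "of_real n3 * base - of_real n1"
  have nz: "?u \<noteq> 0 \<or> ?v \<noteq> 0"
  proof (rule ccontr)
    assume "\<not> ?thesis"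
    then have 0: "?u = 0" "?v = 0" by auto
    then have "Im ?u = 0" "Im ?v = 0" "Re ?u = 0" "Re ?v = 0" by (simp_all only: zero_complex.simps)
    then have "n1 = 0" "n2 = 0" "n3 = 0" using base_UHP by (auto simp: in_UHP)
    then have "A = mat 1" by (simp add: M1 M_def matrix22_eq_iff)
    then show False using S_nontrivial[OF j] A(2) psl_one by simp
  qed
  have in_K: "homog ?u ?v \<in> K (- i)" if i: "i \<in> I" "S i = psl (M s)" and s: "s = 1 \<or> s = - 1" for i s
  proof -
    obtain a b c where q: "K (- i) = {p. qform a b c p \<le> 0}"
      using D_qform[of "- i"] i(1) by auto
    let ?Q = "\<lambda>u v. a * (cmod u)\<^sup>2 + 2 * b * Re (u * cnj v) + c * (cmod v)\<^sup>2"
    \<comment> \<open>The coefficient of the linear term in the expansion at \<open>v + k N v\<close>.\<close>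
    define \<beta> where "\<beta> = 2 * a * Re (base * cnj ?u) + 2 * b * (Re (base * cnj ?v) + Re ?u) + 2 * c * Re ?v"
    have "?Q base 1 + (s * \<beta>) * real k + ?Q ?u ?v * (real k)\<^sup>2 \<le> 0" if k: "k \<ge> 1" for k
    proof -
      let ?s = "real k * s"
      let ?x = "base + of_real ?s * ?u" and ?y = "1 + of_real ?s * ?v"
      have red: "reduced_word r (replicate m i)" for m
        using i(1) by (induction m) (auto simp: reduced_word_Cons sym_index_def)
      obtain m where m: "k = Suc m" using k by (cases k) auto
      have "Some (foldr T (replicate k i) base) \<in> K (- i)"
        using ping_pong_base[OF red[of k]] m by simp
      then have inK: "Some (hact (psl (M ?s)) base) \<in> K (- i)" using pow[OF i] by simp
      have "of_real (M ?s $ 2 $ 1) * base + of_real (M ?s $ 2 $ 2) = ?y"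
        "of_real (M ?s $ 1 $ 1) * base + of_real (M ?s $ 1 $ 2) = ?x"
        by (simp_all add: M_def algebra_simps)
      then have "?y \<noteq> 0" "hact (psl (M ?s)) base = ?x / ?y"
        using denominator_nonzero[OF det base_UHP, of ?s] hact_psl[OF det base_UHP, of ?s] by simp_all
      then have "homog ?x ?y \<in> K (- i)" "?x \<noteq> 0 \<or> ?y \<noteq> 0" using inK by (simp_all add: homog_def)
      then have "?Q ?x ?y \<le> 0" using sgn_eq_less_iff[OF qform_homog] q by blast
      also have "?Q ?x ?y = ?Q base 1 + \<beta> * ?s + ?Q ?u ?v * ?s\<^sup>2"
        unfolding \<beta>_def cmod_power2 by (simp add: power2_eq_square algebra_simps)
      also have "?s\<^sup>2 = (real k)\<^sup>2" using s by (auto simp: power_mult_distrib)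
      finally show ?thesis by (simp add: algebra_simps)
    qed
    then have "?Q ?u ?v \<le> 0" by (rule quadratic_nonpos_leading)
    then show ?thesis using sgn_eq_less_iff[OF qform_homog[OF nz, of a b c]] q by simp
  qed
  have "homog ?u ?v \<in> K (- j)" using in_K[OF j SM(1)] by simp
  moreover have "homog ?u ?v \<in> K j" using in_K[of "- j" "- 1"] j SM(2) by simp
  moreover have "K (- j) \<inter> K j = {}" using j by (intro K_disjoint) (auto simp: sym_index_def)
  ultimately show False by blast
qed

text \<open>An elliptic generator would have a fixed point in the half-plane, where the action is free.\<close>

lemma generator_hyperbolic:
  assumes j: "j \<in> I"
  obtains l p where "l > 0" "p \<in> carrier PSL2R"
    "S j = p \<otimes>\<^bsub>PSL2R\<^esub> translation_elt l \<otimes>\<^bsub>PSL2R\<^esub> inv\<^bsub>PSL2R\<^esub> p"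
proof -
  obtain A0 where A0: "det A0 = 1" "S j = psl A0" using S_carrier[OF j] by (rule PSL2R_cases)
  define A where "A = (if A0$1$1 + A0$2$2 \<ge> 0 then A0 else - A0)"
  have "psl (- A0) = psl A0" by (simp add: psl_eq_iff)
  then have A: "det A = 1" "S j = psl A" "A$1$1 + A$2$2 \<ge> 0" using A0 by (auto simp: A_def)
  have "\<not> A$1$1 + A$2$2 < 2"
  proof
    assume "A$1$1 + A$2$2 < 2"
    then obtain z where "z \<in> UHP" "hact (psl A) z = z" using elliptic_fixed_point[OF A(1)] A(3) by auto
    then show False using free_action S_in_\<Gamma>[OF j] S_nontrivial[OF j] A(2) by simp
  qed
  moreover have "A$1$1 + A$2$2 \<noteq> 2" using generator_not_parabolic[OF j A(1,2)] by blast
  ultimately have "A$1$1 + A$2$2 > 2" by simp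
  then obtain l P where l: "l > 0" and P: "det P = 1" and AP: "A ** P = P ** mat2 (exp (l / 2)) 0 0 (exp (- (l / 2)))"
    using hyperbolic_diagonalizable[OF A(1)] by blast
  let ?L = "mat2 (exp (l / 2)) 0 0 (exp (- (l / 2)))"
  have L: "det ?L = 1" by (simp add: det_2 flip: exp_add)
  have "P ** ?L ** adj2 P = A ** (P ** adj2 P)" unfolding AP[symmetric] by (simp add: matrix_mul_assoc)
  then have "P ** ?L ** adj2 P = A" using adj2_mult(2)[OF P] by simp
  then have "S j = psl P \<otimes>\<^bsub>PSL2R\<^esub> translation_elt l \<otimes>\<^bsub>PSL2R\<^esub> inv\<^bsub>PSL2R\<^esub> (psl P)"
    using P L A(2) by (simp add: translation_elt_def psl_inv psl_mult det_mul)
  then show ?thesis using that[OF l psl_in_carrier[OF P]] by blast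
qed

end

section \<open>The operators \<open>\<tau>\<^sub>s\<close> on powers of quadratic forms\<close>

text \<open>Numerator and denominator enter through their quotient and the square of the denominator, which are
  the same for both representing matrices.\<close>

lemma tau_psl:
  assumes "inv\<^bsub>PSL2R\<^esub> h = psl A"
  shows "tau s h f z =
     (if of_real (A$2$1) * z + of_real (A$2$2) = 0
      then Lim (at z) (\<lambda>w. (1 / (of_real (A$2$1) * w + of_real (A$2$2))\<^sup>2) powi s *
             f ((of_real (A$1$1) * w + of_real (A$1$2)) / (of_real (A$2$1) * w + of_real (A$2$2))))
      else (1 / (of_real (A$2$1) * z + of_real (A$2$2))\<^sup>2) powi s *
             f ((of_real (A$1$1) * z + of_real (A$1$2)) / (of_real (A$2$1) * z + of_real (A$2$2))))"
proof -
  define B where "B = rep (psl A)"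
  have neg: "of_real ((- A)$i$1) * w + of_real ((- A)$i$2) = - (of_real (A$i$1) * w + of_real (A$i$2))" for i and w :: complex
    by simp
  have "B = A \<or> B = - A" unfolding B_def by (rule rep_psl)
  then show ?thesis
    unfolding tau_def assms Let_def B_def[symmetric]
    by (elim disjE) (simp_all only: neg power2_minus minus_divide_divide neg_equal_0_iff_equal)
qed

text \<open>A function of the form \<open>(q(z, 1))\<^sup>n\<close>, with \<open>q\<close> a product of two linear forms, behaves like
  a section of degree \<open>2 n\<close> on the sphere: substitution of the homogeneous coordinates gives \<open>\<tau>\<close>,
  also at the point mapped to infinity, where the value is defined by a limit.\<close>

lemma tau_power:
  fixes q :: "complex \<Rightarrow> complex \<Rightarrow> complex" and z \<alpha> \<beta> \<gamma> \<delta> \<kappa> :: complex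
  assumes h: "inv\<^bsub>PSL2R\<^esub> h = psl A" and A: "det A = 1"
    and q: "\<And>u v. q u v = (\<alpha> * u + \<beta> * v) * (\<gamma> * u + \<delta> * v)"
    and U: "open U" "z \<in> U"
    and f: "\<And>w x. \<lbrakk>w \<in> U; moebius A (Some w) = Some x\<rbrakk> \<Longrightarrow> f x = \<kappa> * (q x 1) ^ n"
  shows "tau (- int n) h f z =
    \<kappa> * (q (of_real (A$1$1) * z + of_real (A$1$2)) (of_real (A$2$1) * z + of_real (A$2$2))) ^ n"
proof -
  let ?n = "\<lambda>w. of_real (A$1$1) * w + of_real (A$1$2) :: complex"
  let ?d = "\<lambda>w. of_real (A$2$1) * w + of_real (A$2$2) :: complex"
  let ?F = "\<lambda>w. (1 / (?d w)\<^sup>2) powi (- int n) * f (?n w / ?d w)"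
  let ?G = "\<lambda>w. \<kappa> * (q (?n w) (?d w)) ^ n"
  have hom: "d\<^sup>2 * q (x / d) 1 = q x d" if "d \<noteq> 0" for x d
    using that unfolding q by (simp add: field_simps power2_eq_square)
  have FG: "?F w = ?G w" if "w \<in> U" "?d w \<noteq> 0" for w
  proof -
    have "f (?n w / ?d w) = \<kappa> * (q (?n w / ?d w) 1) ^ n" using that by (intro f[of w]) auto
    moreover have "(?d w)\<^sup>2 * q (?n w / ?d w) 1 = q (?n w) (?d w)"
      by (rule hom[OF that(2)])
    moreover have "(1 / (?d w)\<^sup>2) powi (- int n) = ((?d w)\<^sup>2) ^ n"
      by (simp add: power_int_minus power_one_over)
    ultimately show ?thesis by (simp add: power_mult_distrib[symmetric] mult.left_commute)
  qed
  show ?thesis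
  proof (cases "?d z = 0")
    case False
    then show ?thesis using FG[OF U(2)] unfolding tau_psl[OF h] by simp
  next
    case True
    have c: "A$2$1 \<noteq> 0"
    proof
      assume "A$2$1 = 0"
      then show False using True A by (simp add: det_2)
    qed
    have "?d w \<noteq> 0" if "w \<noteq> z" for w
    proof
      assume "?d w = 0"
      moreover have "of_real (A$2$1) * (w - z) = ?d w - ?d z" by (simp add: algebra_simps)
      ultimately have "of_real (A$2$1) * (w - z) = 0" using True by simp
      then show False using c that by simp
    qed
    moreover have "eventually (\<lambda>w. w \<in> U) (at z)" using U by (rule eventually_at_in_open')
    ultimately have ev: "eventually (\<lambda>w. ?G w = ?F w) (at z)"
      using FG by (auto simp: eventually_at_filter elim!: eventually_mono)
    have "isCont ?G z" unfolding q by (intro continuous_intros)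
    then have "(?G \<longlongrightarrow> ?G z) (at z)" by (simp add: isCont_def)
    then have "(?F \<longlongrightarrow> ?G z) (at z)" by (rule Lim_transform_eventually[OF _ ev])
    then have "Lim (at z) ?F = ?G z" by (intro tendsto_Lim) auto
    then show ?thesis using True unfolding tau_psl[OF h] by simp
  qed
qed

lemma tau_zero: "tau s h (\<lambda>z. 0) z = 0"
  by (simp add: tau_def Let_def tendsto_Lim)

section \<open>Bergman spaces\<close>

lemma square_integrable_holomorphic_entire:
  assumes U: "open U" "bounded U" and G: "G holomorphic_on UNIV" and eq: "\<And>z. z \<in> U \<Longrightarrow> f z = G z"
  shows "square_integrable_holomorphic U f"
  unfolding square_integrable_holomorphic_def
proof
  show "f holomorphic_on U"
    using holomorphic_on_subset[OF G subset_UNIV] by (rule holomorphic_transform) (simp add: eq)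
  obtain a b where ab: "U \<subseteq> cbox a b" using bounded_subset_cbox_symmetric[OF U(2)] by blast
  have "continuous_on (cbox a b) (\<lambda>z. (cmod (G z))\<^sup>2)"
    by (intro continuous_intros holomorphic_on_imp_continuous_on holomorphic_on_subset[OF G subset_UNIV])
  then have "(\<lambda>z. (cmod (G z))\<^sup>2) absolutely_integrable_on cbox a b"
    by (rule absolutely_integrable_continuous)
  then have "set_integrable lebesgue U (\<lambda>z. (cmod (G z))\<^sup>2)"
    using ab U(1) by (rule_tac set_integrable_subset) (auto intro: borel_open)
  moreover have "set_integrable lebesgue U (\<lambda>z. (cmod (G z))\<^sup>2) \<longleftrightarrow> set_integrable lebesgue U (\<lambda>z. (cmod (f z))\<^sup>2)"
    by (rule set_integrable_cong) (auto simp: eq)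
  ultimately show "set_integrable lebesgue U (\<lambda>z. (cmod (f z))\<^sup>2)" by simp
qed

lemma restrict_power_in_bergman:
  fixes q :: "complex \<Rightarrow> complex \<Rightarrow> complex" and \<alpha> \<beta> \<gamma> \<delta> \<kappa> :: complex
  assumes E: "real_centered_open_disk E"
    and q: "\<And>u v. q u v = (\<alpha> * u + \<beta> * v) * (\<gamma> * u + \<delta> * v)"
  shows "restrict_to E (\<lambda>z. \<kappa> * (q z 1) ^ n) \<in> bergman (- int n) E"
proof -
  let ?f = "restrict_to E (\<lambda>z. \<kappa> * (q z 1) ^ n)"
  obtain a b c where "E = {p. qform a b c p < 0}" using E by (rule real_centered_open_disk_qform)
  then have op: "open (finite_part E)"
    using openin_riemann_sphere_finite[OF openin_qform] by (simp add: finite_part_def)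
  have "square_integrable_holomorphic (finite_part E) ?f" if "bounded_in_plane E"
  proof (rule square_integrable_holomorphic_entire[OF op])
    show "bounded (finite_part E)" using that by (simp add: bounded_in_plane_def)
    show "(\<lambda>z. \<kappa> * (q z 1) ^ n) holomorphic_on UNIV" unfolding q by (intro holomorphic_intros)
  qed (simp add: restrict_to_def)
  moreover have "\<exists>g\<in>carrier PSL2R. bounded_in_plane (act g ` E) \<and>
             square_integrable_holomorphic (finite_part (act g ` E)) (tau (- int n) g ?f)"
  proof -
    obtain g x \<rho> where g: "g \<in> carrier PSL2R" and \<rho>: "\<rho> > 0"
      and gE: "act g ` E = Some ` ball (complex_of_real x) \<rho>"
      using E unfolding real_centered_open_disk_def by blast
    have fin: "finite_part (act g ` E) = ball (complex_of_real x) \<rho>" unfolding gE by (auto simp: finite_part_def)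
    have "inv\<^bsub>PSL2R\<^esub> g \<in> carrier PSL2R" using g by simp
    then obtain A where A: "det A = 1" "inv\<^bsub>PSL2R\<^esub> g = psl A" by (rule PSL2R_cases)
    let ?G = "\<lambda>z. \<kappa> * (q (of_real (A$1$1) * z + of_real (A$1$2)) (of_real (A$2$1) * z + of_real (A$2$2))) ^ n"
    have "tau (- int n) g ?f z = ?G z" if z: "z \<in> ball (complex_of_real x) \<rho>" for z
    proof (rule tau_power[OF A(2,1) q open_ball z])
      fix w y assume w: "w \<in> ball (complex_of_real x) \<rho>" and y: "moebius A (Some w) = Some y"
      then obtain p where p: "p \<in> E" "act g p = Some w" using gE by (metis imageE imageI)
      have "p = act (psl A) (Some w)" using act_inv(1)[OF g, of p] p(2) A(2) by simp
      then have "Some y \<in> E" using p(1) y by (simp add: act_psl)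
      then show "?f y = \<kappa> * (q y 1) ^ n" by (simp add: restrict_to_def finite_part_def)
    qed
    moreover have "?G holomorphic_on UNIV" unfolding q by (intro holomorphic_intros)
    ultimately have "square_integrable_holomorphic (finite_part (act g ` E)) (tau (- int n) g ?f)"
      unfolding fin by (intro square_integrable_holomorphic_entire[of _ ?G]) auto
    moreover have "bounded_in_plane (act g ` E)"
      unfolding bounded_in_plane_def fin using gE by auto
    ultimately show ?thesis using g by blast
  qed
  moreover have "?f z = 0" if "z \<notin> finite_part E" for z using that by (simp add: restrict_to_def)
  ultimately show ?thesis by (auto simp: bergman_def)
qed

section \<open>Eigenfunctions\<close>

text \<open>The product of the two coordinates in the basis given by the columns of \<open>P\<close>; it is invariant
  under the conjugates by \<open>P\<close> of diagonal matrices of determinant 1.\<close>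

definition axis_form :: "real^2^2 \<Rightarrow> complex \<Rightarrow> complex \<Rightarrow> complex" where
  "axis_form P u v = (of_real (P$2$2) * u - of_real (P$1$2) * v) * (of_real (P$1$1) * v - of_real (P$2$1) * u)"

lemma axis_form_linear:
  "axis_form P u v = (of_real (P$2$2) * u + (- of_real (P$1$2)) * v) * ((- of_real (P$2$1)) * u + of_real (P$1$1) * v)"
  by (simp add: axis_form_def)

lemma axis_form_invariant:
  assumes P: "det P = 1" and m: "m * m' = 1" and B: "B = P ** mat2 m 0 0 m' ** adj2 P"
  shows "axis_form P (of_real (B$1$1) * u + of_real (B$1$2) * v) (of_real (B$2$1) * u + of_real (B$2$2) * v) = axis_form P u v"
proof -
  define a b c d where abcd: "a = P$1$1" "b = P$1$2" "c = P$2$1" "d = P$2$2"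
  have det: "a * d - b * c = 1" using P by (simp add: det_2 abcd)
  have Bs: "B$1$1 = a * m * d - b * m' * c" "B$1$2 = - a * m * b + b * m' * a"
    "B$2$1 = c * m * d - d * m' * c" "B$2$2 = - c * m * b + d * m' * a"
    by (simp_all add: B abcd)
  have rows: "d * (B$1$1) - b * (B$2$1) = m * d * (a * d - b * c)" "d * (B$1$2) - b * (B$2$2) = - (m * b * (a * d - b * c))"
    "a * (B$2$1) - c * (B$1$1) = - (m' * c * (a * d - b * c))" "a * (B$2$2) - c * (B$1$2) = m' * a * (a * d - b * c)"
    unfolding Bs by (simp_all add: algebra_simps)
  have 1: "of_real d * (of_real (B$1$1) * u + of_real (B$1$2) * v) - of_real b * (of_real (B$2$1) * u + of_real (B$2$2) * v)
      = of_real m * (of_real d * u - of_real b * v)"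
  proof -
    have "of_real d * (of_real (B$1$1) * u + of_real (B$1$2) * v) - of_real b * (of_real (B$2$1) * u + of_real (B$2$2) * v)
      = of_real (d * (B$1$1) - b * (B$2$1)) * u + of_real (d * (B$1$2) - b * (B$2$2)) * v"
      by (simp add: algebra_simps)
    also have "\<dots> = of_real m * (of_real d * u - of_real b * v)"
      unfolding rows det by (simp add: algebra_simps)
    finally show ?thesis .
  qed
  have 2: "of_real a * (of_real (B$2$1) * u + of_real (B$2$2) * v) - of_real c * (of_real (B$1$1) * u + of_real (B$1$2) * v)
      = of_real m' * (of_real a * v - of_real c * u)"
  proof -
    have "of_real a * (of_real (B$2$1) * u + of_real (B$2$2) * v) - of_real c * (of_real (B$1$1) * u + of_real (B$1$2) * v)
      = of_real (a * (B$2$1) - c * (B$1$1)) * u + of_real (a * (B$2$2) - c * (B$1$2)) * v"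
      by (simp add: algebra_simps)
    also have "\<dots> = of_real m' * (of_real a * v - of_real c * u)"
      unfolding rows det by (simp add: algebra_simps)
    finally show ?thesis .
  qed
  have "complex_of_real m * of_real m' = 1" using m by (metis of_real_1 of_real_mult)
  then have "of_real m * (of_real d * u - of_real b * v) * (of_real m' * (of_real a * v - of_real c * u))
      = (of_real d * u - of_real b * v) * (of_real a * v - of_real c * u)"
    by (metis (no_types, lifting) mult.assoc mult.left_commute mult_1)
  then show ?thesis unfolding axis_form_def abcd[symmetric] 1 2 .
qed

lemma axis_form_nonzero:
  assumes P: "det P = 1" and z: "z \<in> UHP" shows "axis_form P z 1 \<noteq> 0"
proof -
  have lin: "of_real x * z + of_real y \<noteq> 0" if "x \<noteq> 0 \<or> y \<noteq> 0" for x y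
  proof
    assume 0: "of_real x * z + of_real y = 0"
    then have "Im (of_real x * z + of_real y) = 0" by simp
    then have "x = 0" using z by (simp add: in_UHP)
    then show False using 0 that by simp
  qed
  have "P$2$2 \<noteq> 0 \<or> - P$1$2 \<noteq> 0" "- P$2$1 \<noteq> 0 \<or> P$1$1 \<noteq> 0" using P by (auto simp: det_2)
  from lin[OF this(1)] lin[OF this(2)] show ?thesis by (simp add: axis_form_def)
qed

lemma tau_axis_form:
  assumes P: "det P = 1"
  shows "tau (- int n) (psl P) (\<lambda>z. z ^ n) z = axis_form P z 1 ^ n"
    "tau (- int n) (psl P \<otimes>\<^bsub>PSL2R\<^esub> inversion_elt) (\<lambda>z. z ^ n) z = (- 1) ^ n * axis_form P z 1 ^ n"
proof -
  let ?q = "\<lambda>u v :: complex. u * v"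
  have q: "?q u v = (1 * u + 0 * v) * (0 * u + 1 * v)" for u v by simp
  have "tau (- int n) (psl P) (\<lambda>z. z ^ n) z =
     1 * (?q (of_real (adj2 P$1$1) * z + of_real (adj2 P$1$2)) (of_real (adj2 P$2$1) * z + of_real (adj2 P$2$2))) ^ n"
    by (rule tau_power[OF _ _ q, where U = UNIV]) (use P in \<open>auto simp: psl_inv\<close>)
  then show "tau (- int n) (psl P) (\<lambda>z. z ^ n) z = axis_form P z 1 ^ n"
    by (simp add: axis_form_def)
  let ?J = "mat2 0 1 (- 1) 0"
  have J: "det ?J = 1" by (simp add: det_2)
  have "psl P \<otimes>\<^bsub>PSL2R\<^esub> inversion_elt = psl (P ** ?J)" using P J by (simp add: inversion_elt_def psl_mult)
  moreover have "det (P ** ?J) = 1" using P J by (simp add: det_mul)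
  ultimately have inv: "inv\<^bsub>PSL2R\<^esub> (psl P \<otimes>\<^bsub>PSL2R\<^esub> inversion_elt) = psl (adj2 (P ** ?J))"
    and d: "det (adj2 (P ** ?J)) = 1" by (simp_all add: psl_inv)
  let ?A = "adj2 (P ** ?J)"
  have "tau (- int n) (psl P \<otimes>\<^bsub>PSL2R\<^esub> inversion_elt) (\<lambda>z. z ^ n) z =
     1 * (?q (of_real (?A$1$1) * z + of_real (?A$1$2)) (of_real (?A$2$1) * z + of_real (?A$2$2))) ^ n"
    by (rule tau_power[OF inv d q, where U = UNIV]) auto
  also have "?q (of_real (?A$1$1) * z + of_real (?A$1$2)) (of_real (?A$2$1) * z + of_real (?A$2$2)) = - axis_form P z 1"
    by (simp add: axis_form_def) (simp add: algebra_simps)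
  finally show "tau (- int n) (psl P \<otimes>\<^bsub>PSL2R\<^esub> inversion_elt) (\<lambda>z. z ^ n) z = (- 1) ^ n * axis_form P z 1 ^ n"
    by (simp add: power_minus[of "axis_form P z 1"])
qed

context schottky
begin

text \<open>The eigenfunctions of the cylinder of the \<open>j\<close>-th generator on its two disks, combined with opposite
  signs: both are given by the same polynomial, and every other disk receives their sum.\<close>

definition axis_family :: "nat \<Rightarrow> int \<Rightarrow> real^2^2 \<Rightarrow> disk_family" where
  "axis_family n j P = (\<lambda>i. if i = j then restrict_to (D j) (\<lambda>z. 1 * axis_form P z 1 ^ n)
     else if i = - j then restrict_to (D (- j)) (\<lambda>z. - 1 * axis_form P z 1 ^ n) else (\<lambda>z. 0))"

text \<open>The polynomial is fixed by the generator; its restriction to the disk \<open>D k\<close> suffices, because the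
  inverse generator maps \<open>D i\<close> into \<open>D k\<close>.\<close>

lemma tau_generator:
  assumes k: "k \<in> I" and i: "i \<in> I" "i \<noteq> - k" and z: "z \<in> finite_part (D i)"
    and P: "det P = 1" and m: "m * m' = 1" and S: "S (- k) = psl (P ** mat2 m 0 0 m' ** adj2 P)"
  shows "tau (- int n) (S k) (restrict_to (D k) (\<lambda>z. \<kappa> * axis_form P z 1 ^ n)) z = \<kappa> * axis_form P z 1 ^ n"
proof -
  let ?B = "P ** mat2 m 0 0 m' ** adj2 P"
  have inv: "inv\<^bsub>PSL2R\<^esub> (S k) = psl ?B" using S S_uminus[OF k] by simp
  have det: "det ?B = 1" using P m by (simp add: det_mul) (simp add: det_2)
  have U: "open (finite_part (D i))"
    using openin_riemann_sphere_finite[OF D_openin[OF i(1)]] by (simp add: finite_part_def)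
  have "tau (- int n) (S k) (restrict_to (D k) (\<lambda>z. \<kappa> * axis_form P z 1 ^ n)) z =
     \<kappa> * (axis_form P (of_real (?B$1$1) * z + of_real (?B$1$2)) (of_real (?B$2$1) * z + of_real (?B$2$2))) ^ n"
  proof (rule tau_power[OF inv det axis_form_linear U z])
    fix w x assume "w \<in> finite_part (D i)" and x: "moebius ?B (Some w) = Some x"
    then have "act (S (- k)) (Some w) \<in> D k" using act_into_D[OF i(1) k i(2)] by (simp add: finite_part_def)
    then have "x \<in> finite_part (D k)" using x unfolding S act_psl by (simp add: finite_part_def)
    then show "restrict_to (D k) (\<lambda>z. \<kappa> * axis_form P z 1 ^ n) x = \<kappa> * axis_form P x 1 ^ n"
      by (simp add: restrict_to_def)
  qed
  also have "\<dots> = \<kappa> * axis_form P z 1 ^ n"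
    using axis_form_invariant[OF P m refl, of z 1] by simp
  finally show ?thesis .
qed

lemma axis_family_eigenfunction:
  assumes j: "j \<in> {1..int r}" and P: "det P = 1"
    and S: "S j = psl P \<otimes>\<^bsub>PSL2R\<^esub> translation_elt l \<otimes>\<^bsub>PSL2R\<^esub> inv\<^bsub>PSL2R\<^esub> (psl P)"
  shows "axis_family n j P \<in> eigenspace (bergman_sum (- int n) r D) (transfer_op (- int n) r D S) 1"
proof -
  let ?h = "\<lambda>z. axis_form P z 1 ^ n" and ?f = "axis_family n j P"
  have jI: "j \<in> I" "- j \<in> I" "j \<noteq> - j" using j by (auto simp: sym_index_def)
  define x y where xy: "x = exp (l / 2)" "y = exp (- (l / 2))"
  have x: "x * y = 1" "y * x = 1" by (simp_all add: xy flip: exp_add)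
  have "det (mat2 x 0 0 y) = 1" using x by (simp add: det_2)
  then have Sj: "S j = psl (P ** mat2 x 0 0 y ** adj2 P)"
    using S P by (simp add: translation_elt_def psl_inv psl_mult det_mul xy[symmetric])
  have det: "det (P ** mat2 x 0 0 y ** adj2 P) = 1" using P x by (simp add: det_mul) (simp add: det_2)
  have "adj2 (P ** mat2 x 0 0 y ** adj2 P) = P ** mat2 y 0 0 x ** adj2 P"
    by (simp add: matrix22_eq_iff)
  then have Smj: "S (- j) = psl (P ** mat2 y 0 0 x ** adj2 P)"
    using S_uminus(2)[OF jI(1)] Sj det by (simp add: psl_inv)
  have berg: "?f i \<in> bergman (- int n) (D i)" if "i \<in> I" for i
  proof -
    have disk: "real_centered_open_disk (D i)" using data that by (simp add: schottky_data_def)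
    have "restrict_to (D i) (\<lambda>z. \<kappa> * ?h z) \<in> bergman (- int n) (D i)" for \<kappa>
      by (rule restrict_power_in_bergman[OF disk axis_form_linear])
    from this[of 1] this[of "- 1"] this[of 0] show ?thesis
      by (auto simp: axis_family_def restrict_to_def)
  qed
  have sum: "?f \<in> bergman_sum (- int n) r D"
    unfolding bergman_sum_def using berg jI by (auto simp: axis_family_def)
  have "transfer_op (- int n) r D S ?f i z = ?f i z" for i z
  proof (cases "i \<in> I \<and> z \<in> finite_part (D i)")
    case False
    then show ?thesis using jI unfolding transfer_op_def by (auto simp: axis_family_def restrict_to_def)
  next
    case True
    have t1: "tau (- int n) (S j) (?f j) z = ?h z" if "i \<noteq> - j"
      using tau_generator[OF jI(1) _ that _ P x(2) Smj, of z n 1] True by (simp add: axis_family_def)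
    have t2: "tau (- int n) (S (- j)) (?f (- j)) z = - ?h z" if "i \<noteq> j"
      using tau_generator[OF jI(2) _ _ _ P x(1), of i z n "- 1"] that True jI(3) Sj by (simp add: axis_family_def)
    have t0: "tau (- int n) (S k) (?f k) z = 0" if "k \<noteq> j" "k \<noteq> - j" for k
      using that by (simp add: axis_family_def tau_zero)
    have "transfer_op (- int n) r D S ?f i z = (\<Sum>k\<in>I - {- i}. tau (- int n) (S k) (?f k) z)"
      using True by (simp add: transfer_op_def)
    also have "\<dots> = (\<Sum>k\<in>{j, - j} - {- i}. tau (- int n) (S k) (?f k) z)"
      by (rule sum.mono_neutral_right) (use finite_I jI t0 in auto)
    also have "\<dots> = ?f i z"
    proof -
      consider "i = j" | "i = - j" | "i \<noteq> j" "i \<noteq> - j" by blast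
      then show ?thesis
      proof cases
        case 1
        then have "{j, - j} - {- i} = {j}" using jI by auto
        then show ?thesis using 1 t1 jI(3) True by (simp add: axis_family_def restrict_to_def)
      next
        case 2
        then have "{j, - j} - {- i} = {- j}" using jI by auto
        then show ?thesis using 2 t2 jI(3) True by (simp add: axis_family_def restrict_to_def)
      next
        case 3
        then have "{j, - j} - {- i} = {j, - j}" by auto
        moreover have "?f i z = 0" using 3 by (simp add: axis_family_def)
        ultimately show ?thesis using t1[OF 3(2)] t2[OF 3(1)] jI(3) by simp
      qed
    qed
    finally show ?thesis .
  qed
  then have "transfer_op (- int n) r D S ?f = family_scale 1 ?f"
    by (simp add: family_scale_def fun_eq_iff)
  then show ?thesis using sum by (simp add: eigenspace_def)
qed

lemma axis_family_nonzero:
  assumes j: "j \<in> {1..int r}" and P: "det P = 1"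
  obtains z where "axis_family n j P j z \<noteq> 0"
proof -
  obtain z where z: "z \<in> UHP" "Some z \<in> D j" using D_meets_UHP[OF sym_index_pos[OF j]] .
  then have "axis_family n j P j z = axis_form P z 1 ^ n"
    by (simp add: axis_family_def restrict_to_def finite_part_def)
  then show ?thesis using that[of z] axis_form_nonzero[OF P z(1)] by simp
qed

lemma cylinder_data:
  assumes j: "j \<in> {1..int r}"
  shows "schottky_data (generate PSL2R {S j}) 1 (\<lambda>i. D (i * j)) (\<lambda>i. S (i * j))"
proof -
  have jI: "i * j \<in> I" if "i \<in> sym_index 1" for i
  proof -
    have "i = 1 \<or> i = - 1" using that by (auto simp: sym_index_def)
    then show ?thesis using j by (auto simp: sym_index_def)
  qed
  have jne: "i * j \<noteq> i' * j" if "i \<noteq> i'" for i i' using j that by auto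
  have gen: "(\<lambda>i. S (i * j)) ` {1..int 1} = {S j}" by auto
  have "\<forall>i\<in>sym_index 1. real_centered_open_disk (D (i * j))"
    using data jI by (simp add: schottky_data_def)
  moreover have "\<forall>i\<in>sym_index 1. \<forall>i'\<in>sym_index 1. i \<noteq> i' \<longrightarrow> K (i * j) \<inter> K (i' * j) = {}"
    using K_disjoint jI jne by blast
  moreover have "\<forall>i\<in>{1..int 1}. S (i * j) \<in> carrier PSL2R \<and>
        act (S (i * j)) ` (- K (i * j)) = D (- i * j) \<and> S (- i * j) = inv\<^bsub>PSL2R\<^esub> (S (i * j))"
    using data j by (auto simp: schottky_data_def)
  ultimately show ?thesis unfolding schottky_data_def gen by simp
qed

text \<open>The second cylinder eigenfunction is \<open>(-1)\<^sup>n\<close> times the polynomial of the first one, because the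
  inversion exchanges the two coordinates up to a sign; this explains the coefficient
  \<open>- (-1)\<^sup>n\<close>.\<close>

lemma axis_family_induced:
  assumes j: "j \<in> {1..int r}" and P: "det P = 1" and l: "l > 0"
    and S: "S j = psl P \<otimes>\<^bsub>PSL2R\<^esub> translation_elt l \<otimes>\<^bsub>PSL2R\<^esub> inv\<^bsub>PSL2R\<^esub> (psl P)"
    and X: "isometric_to_quotient X \<Gamma>"
  shows "induced_from_cylinder X n r D S (axis_family n j P)"
proof -
  let ?DC = "\<lambda>i. D (i * j)" and ?SC = "\<lambda>i. S (i * j)" and ?G = "generate PSL2R {S j}"
  interpret cyl: schottky ?G 1 ?DC ?SC by unfold_locales (rule cylinder_data[OF j])
  have Sj: "S j \<in> \<Gamma>" using S_in_\<Gamma> sym_index_pos[OF j] by simp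
  have G: "subgroup ?G PSL2R" by (rule cyl.\<Gamma>_subgroup)
  have G\<Gamma>: "?G \<subseteq> \<Gamma>" using PSL.generate_subgroup_incl[OF _ \<Gamma>_subgroup] Sj by simp
  obtain C :: "complex set metric" where C: "isometric_to_quotient C ?G" using quotient_metric[OF G G\<Gamma>] .
  obtain qC where qC: "uniformizes ?G C qC" using isometric_to_quotient_uniformizes[OF G C] .
  obtain qX where qX: "uniformizes \<Gamma> X qX" using isometric_to_quotient_uniformizes[OF \<Gamma>_subgroup X] .
  have cov: "covers C X" by (rule uniformized_covering[OF qC G G\<Gamma> qX])
  let ?g = "family_scale 1 (cylinder_eigenfun1 n ?DC (psl P))
            + family_scale (- ((- 1) ^ n)) (cylinder_eigenfun2 n ?DC (psl P))"
  have one: "(1::int) \<noteq> - 1" by simp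
  have sq: "(- 1 :: complex) ^ n * (- 1) ^ n = 1" by (simp flip: power_mult_distrib)
  have g: "?g = cyl.axis_family n 1 P"
  proof (intro ext)
    fix i z
    have "- ((- 1 :: complex) ^ n) * ((- 1) ^ n * w) = - w" for w
      using sq by (metis minus_mult_left mult.assoc mult_1)
    then show "?g i z = cyl.axis_family n 1 P i z"
      by (auto simp: family_scale_def cylinder_eigenfun1_def cylinder_eigenfun2_def cyl.axis_family_def
          restrict_to_def tau_axis_form[OF P])
  qed
  have eig: "?g \<in> eigenspace (bergman_sum (- int n) 1 ?DC) (transfer_op (- int n) 1 ?DC ?SC) 1"
    unfolding g by (rule cyl.axis_family_eigenfunction[OF _ P, of 1 l]) (use S in auto)
  have f: "axis_family n j P = (\<lambda>i. if i = j then ?g 1 else if i = - j then ?g (- 1) else (\<lambda>z. 0))"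
    unfolding g by (auto simp: axis_family_def cyl.axis_family_def fun_eq_iff)
  have dat: "schottky_data_for C ?G 1 ?DC ?SC"
    unfolding schottky_data_for_def using cylinder_data[OF j] C by simp
  show ?thesis
    unfolding induced_from_cylinder_def
    by (rule bexI[OF _ j], intro exI[of _ C] exI[of _ ?G] exI[of _ ?DC] exI[of _ ?SC] exI[of _ l]
        exI[of _ "psl P"] exI[of _ "1::complex"] exI[of _ "- ((- 1) ^ n) :: complex"] exI[of _ ?g])
       (use dat cov l P S eig f in auto)
qed

end

lemma independent_by_separation:
  fixes F :: "nat \<Rightarrow> disk_family"
  assumes nz: "\<And>k. k < m \<Longrightarrow> F k (idx k) (z k) \<noteq> 0"
    and sep: "\<And>k l. \<lbrakk>k < m; l < m; k \<noteq> l\<rbrakk> \<Longrightarrow> F l (idx k) (z k) = 0"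
  shows "inj_on F {..<m}" "family.independent (F ` {..<m})"
proof -
  show inj: "inj_on F {..<m}"
  proof (rule inj_onI, rule ccontr)
    fix k l assume kl: "k \<in> {..<m}" "l \<in> {..<m}" "F k = F l" "k \<noteq> l"
    then have "F k (idx k) (z k) = 0" using sep[of k l] by simp
    then show False using nz[of k] kl by simp
  qed
  show "family.independent (F ` {..<m})"
  proof (rule family.independent_if_scalars_zero)
    fix c f assume 0: "(\<Sum>x\<in>F ` {..<m}. family_scale (c x) x) = 0" and "f \<in> F ` {..<m}"
    then obtain k where k: "k < m" "f = F k" by auto
    have "0 = (\<Sum>l<m. family_scale (c (F l)) (F l)) (idx k) (z k)"
      using 0 by (simp add: sum.reindex[OF inj] zero_fun_def)
    also have "\<dots> = (\<Sum>l<m. c (F l) * F l (idx k) (z k))"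
    proof -
      have "(\<Sum>l\<in>A. family_scale (c (F l)) (F l)) i x = (\<Sum>l\<in>A. c (F l) * F l i x)" for A i x
        by (induction A rule: infinite_finite_induct) (auto simp: family_scale_def)
      then show ?thesis .
    qed
    also have "\<dots> = (\<Sum>l\<in>{k}. c (F l) * F l (idx k) (z k))"
      by (rule sum.mono_neutral_right) (use sep k in auto)
    finally show "c f = 0" using nz[OF k(1)] k by simp
  qed simp
qed

theorem theorem1p4:
  fixes X :: "'a metric"
    and \<Gamma> :: "(real^2^2) set set"
    and r n :: nat
    and D :: "int \<Rightarrow> complex option set"
    and S :: "int \<Rightarrow> (real^2^2) set"
    and s :: int
  assumes "schottky_surface X"
    and "schottky_data_for X \<Gamma> r D S"
    and "s = - int n"
  shows "is_eigenvalue (bergman_sum s r D) (transfer_op s r D S) 1 \<and>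
    geometric_multiplicity (bergman_sum s r D) (transfer_op s r D S) 1
      \<ge> enat (nat (1 - euler_characteristic (mtopology_of X))) \<and>
    (\<exists>F :: nat \<Rightarrow> disk_family.
       inj_on F {..<nat (1 - euler_characteristic (mtopology_of X))} \<and>
       family.independent (F ` {..<nat (1 - euler_characteristic (mtopology_of X))}) \<and>
       (\<forall>k<nat (1 - euler_characteristic (mtopology_of X)).
          F k \<in> eigenspace (bergman_sum s r D) (transfer_op s r D S) 1 \<and>
          induced_from_cylinder X n r D S (F k)))"
proof -
  have data: "schottky_data \<Gamma> r D S" and X: "isometric_to_quotient X \<Gamma>"
    using assms(2) by (auto simp: schottky_data_for_def)
  interpret schottky \<Gamma> r D S by unfold_locales (rule data)
  define m where "m = nat (1 - euler_characteristic (mtopology_of X))"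
  obtain q where "uniformizes \<Gamma> X q" using isometric_to_quotient_uniformizes[OF \<Gamma>_subgroup X] .
  then have m: "m \<le> r" using \<Gamma>_uniformizes_euler unfolding m_def by fastforce
  let ?j = "\<lambda>k::nat. int k + 1"
  have j: "?j k \<in> {1..int r}" if "k < r" for k using that by auto
  have "\<exists>l P. l > 0 \<and> det P = 1 \<and>
      S (?j k) = psl P \<otimes>\<^bsub>PSL2R\<^esub> translation_elt l \<otimes>\<^bsub>PSL2R\<^esub> inv\<^bsub>PSL2R\<^esub> (psl P)" if k: "k < r" for k
  proof -
    obtain l p where lp: "l > 0" "p \<in> carrier PSL2R"
      "S (?j k) = p \<otimes>\<^bsub>PSL2R\<^esub> translation_elt l \<otimes>\<^bsub>PSL2R\<^esub> inv\<^bsub>PSL2R\<^esub> p"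
      by (rule generator_hyperbolic[OF sym_index_pos[OF j[OF k]]])
    moreover obtain P where "det P = 1" "p = psl P" using lp(2) by (rule PSL2R_cases)
    ultimately show ?thesis by blast
  qed
  then obtain L P where LP: "\<And>k. k < r \<Longrightarrow> L k > 0" "\<And>k. k < r \<Longrightarrow> det (P k) = 1"
    "\<And>k. k < r \<Longrightarrow> S (?j k) = psl (P k) \<otimes>\<^bsub>PSL2R\<^esub> translation_elt (L k) \<otimes>\<^bsub>PSL2R\<^esub> inv\<^bsub>PSL2R\<^esub> (psl (P k))"
    by metis
  define F where "F k = axis_family n (?j k) (P k)" for k
  have eig: "F k \<in> eigenspace (bergman_sum s r D) (transfer_op s r D S) 1" if "k < r" for k
    unfolding F_def assms(3) using axis_family_eigenfunction[OF j[OF that] LP(2)[OF that] LP(3)[OF that]] .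
  have ind: "induced_from_cylinder X n r D S (F k)" if "k < r" for k
    unfolding F_def using axis_family_induced[OF j[OF that] LP(2)[OF that] LP(1)[OF that] LP(3)[OF that] X] .
  have "\<exists>z. F k (?j k) z \<noteq> 0" if "k < r" for k
    unfolding F_def using axis_family_nonzero[OF j[OF that] LP(2)[OF that]] by metis
  then obtain z where z: "\<And>k. k < r \<Longrightarrow> F k (?j k) (z k) \<noteq> 0" by metis
  have sep: "F l (?j k) (z k) = 0" if "k \<noteq> l" for k l
    using that by (auto simp: F_def axis_family_def)
  have inj: "inj_on F {..<m}" and indep: "family.independent (F ` {..<m})"
    using independent_by_separation[of m F ?j z] z sep m by auto
  have "is_eigenvalue (bergman_sum s r D) (transfer_op s r D S) 1"
    unfolding is_eigenvalue_def using eig[of 0] z[of 0] r_pos by (metis less_le_trans zero_fun_apply zero_less_one)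
  moreover have "geometric_multiplicity (bergman_sum s r D) (transfer_op s r D S) 1 \<ge> enat m"
  proof -
    have "enat m = enat (card (F ` {..<m}))" by (simp add: card_image[OF inj])
    also have "\<dots> \<le> geometric_multiplicity (bergman_sum s r D) (transfer_op s r D S) 1"
      unfolding geometric_multiplicity_def
      by (rule SUP_upper) (use eig m indep in auto)
    finally show ?thesis .
  qed
  moreover have "\<forall>k<m. F k \<in> eigenspace (bergman_sum s r D) (transfer_op s r D S) 1 \<and>
          induced_from_cylinder X n r D S (F k)" using eig ind m by auto
  ultimately show ?thesis unfolding m_def[symmetric] using inj indep by blast
qed

end
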